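(* Suppose $B$ is a ring which admits a surjective homomorphism from a direct product ring, $f:\prod_{i\in I}R_i\to B$, such that the composite $\pi f:\prod_{i\in I}R_i\to B\to B/Z(B)$ factors through the product of finitely many ultraproducts of the $R_i$, but not through the product of finitely many countably complete ultraproducts. (So if $\mathrm{card}(I)$ is less than all uncountable measurable cardinals, if any exist, the latter condition simply says that $\pi f$ does not factor through any finite product of the $R_i$.) Then the additive group of $B/Z(B)$ has a nonzero cotorsion subgroup; equivalently, it either contains nonzero elements of finite order, or a copy of the additive group of $\mathbb Q$, or a copy of the additive group of the $p$-adic integers for some prime $p$.
   Context: Here a ring means an abelian group given with an arbitrary bilinear multiplication (not necessarily associative, commutative or unital). $Z(B)=\{b\in B\mid bB=Bb=\{0\}\}$, and $\pi:B\to B/Z(B)$ is the quotient map. An ultrafilter is countably complete if it is closed under countable intersections (principal ultrafilters included); a countably complete ultraproduct is one with respect to a countably complete ultrafilter. A homomorphism on $\prod_{i\in I}R_i$ factors through the product of finitely many ultraproducts if, for some finite (possibly empty) family of ultrafilters $\mathcal U_0,\dots,\mathcal U_{n-1}$ on $I$ (of the indicated kind), it is the composite of the natural map $\prod_{i\in I}R_i\to\prod_{i\in I}R_i/\mathcal U_0\times\dots\times\prod_{i\in I}R_i/\mathcal U_{n-1}$ with a homomorphism defined on that product. An abelian group $C$ is cotorsion if it is a direct summand in every abelian overgroup $A\supseteq C$ such that $A/C$ is torsion-free. An uncountable measurable cardinal is an uncountable cardinal $\kappa$ carrying a nonprincipal $\kappa$-complete ultrafilter. The equivalence of the two descriptions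 in the conclusion is a known result. *)

theory Defs
  imports "HOL-Library.Countable_Set" "HOL-Computational_Algebra.Primes" "HOL-Algebra.QuotRing" "HOL-Algebra.Product_Groups"
begin

section \<open>Nonassociative rings\<close>

text \<open>
  The \<^verbatim>\<open>one\<close> field of the ring record carries no meaning: no axiom mentions it and
  homomorphisms need not preserve it.
\<close>

locale na_ring = abelian_group R for R (structure) +
  assumes m_closed: "\<lbrakk>x \<in> carrier R; y \<in> carrier R\<rbrakk> \<Longrightarrow> x \<otimes> y \<in> carrier R"
    and l_distr: "\<lbrakk>x \<in> carrier R; y \<in> carrier R; z \<in> carrier R\<rbrakk>
      \<Longrightarrow> (x \<oplus> y) \<otimes> z = x \<otimes> z \<oplus> y \<otimes> z"
    and r_distr: "\<lbrakk>x \<in> carrier R; y \<in> carrier R; z \<in> carrier R\<rbrakk>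
      \<Longrightarrow> z \<otimes> (x \<oplus> y) = z \<otimes> x \<oplus> z \<otimes> y"

definition na_hom :: "('a, 'm) ring_scheme \<Rightarrow> ('b, 'n) ring_scheme \<Rightarrow> ('a \<Rightarrow> 'b) set" where
  "na_hom R S = hom R S \<inter> hom (add_monoid R) (add_monoid S)"

definition prod_ring :: "'i set \<Rightarrow> ('i \<Rightarrow> 'a ring) \<Rightarrow> ('i \<Rightarrow> 'a) ring" where
  "prod_ring I R =
    \<lparr>carrier = (\<Pi>\<^sub>E i\<in>I. carrier (R i)),
     monoid.mult = (\<lambda>x y. \<lambda>i\<in>I. x i \<otimes>\<^bsub>R i\<^esub> y i),
     one = (\<lambda>i\<in>I. \<one>\<^bsub>R i\<^esub>),
     zero = (\<lambda>i\<in>I. \<zero>\<^bsub>R i\<^esub>),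
     add = (\<lambda>x y. \<lambda>i\<in>I. x i \<oplus>\<^bsub>R i\<^esub> y i)\<rparr>"

definition annihilator :: "('b, 'n) ring_scheme \<Rightarrow> 'b set" where
  "annihilator B =
    {b \<in> carrier B. \<forall>x\<in>carrier B. b \<otimes>\<^bsub>B\<^esub> x = \<zero>\<^bsub>B\<^esub> \<and> x \<otimes>\<^bsub>B\<^esub> b = \<zero>\<^bsub>B\<^esub>}"

definition ann_quotient :: "('b, 'n) ring_scheme \<Rightarrow> 'b set ring" where
  "ann_quotient B = B Quot annihilator B"

definition ann_proj :: "('b, 'n) ring_scheme \<Rightarrow> 'b \<Rightarrow> 'b set" where
  "ann_proj B b = annihilator B +>\<^bsub>B\<^esub> b"


section \<open>Ultrafilters, ultraproducts and factorization\<close>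

text \<open>An ultrafilter on the set \<^term>\<open>I\<close> is a filter on the ambient type that contains \<^term>\<open>I\<close>.\<close>

definition ultrafilter_on :: "'i set \<Rightarrow> 'i filter \<Rightarrow> bool" where
  "ultrafilter_on I F \<longleftrightarrow>
    F \<noteq> bot \<and> F \<le> principal I \<and> (\<forall>P. eventually P F \<or> eventually (\<lambda>i. \<not> P i) F)"

definition countably_complete :: "'i filter \<Rightarrow> bool" where
  "countably_complete F \<longleftrightarrow>
    (\<forall>P :: nat \<Rightarrow> 'i \<Rightarrow> bool. (\<forall>n. eventually (P n) F) \<longrightarrow> eventually (\<lambda>i. \<forall>n. P n i) F)"

text \<open>
  Two elements of the direct product have the same coset modulo \<^verbatim>\<open>null_ideal\<close> iff they agree on a
  set of the ultrafilter; see \<^verbatim>\<open>ultra_map_eq_iff\<close> below.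
\<close>

definition null_ideal :: "'i set \<Rightarrow> ('i \<Rightarrow> 'a ring) \<Rightarrow> 'i filter \<Rightarrow> ('i \<Rightarrow> 'a) set" where
  "null_ideal I R F = {x \<in> carrier (prod_ring I R). eventually (\<lambda>i. x i = \<zero>\<^bsub>R i\<^esub>) F}"

definition ultraproduct :: "'i set \<Rightarrow> ('i \<Rightarrow> 'a ring) \<Rightarrow> 'i filter \<Rightarrow> ('i \<Rightarrow> 'a) set ring" where
  "ultraproduct I R F = prod_ring I R Quot null_ideal I R F"

definition ultra_map :: "'i set \<Rightarrow> ('i \<Rightarrow> 'a ring) \<Rightarrow> 'i filter \<Rightarrow> ('i \<Rightarrow> 'a) \<Rightarrow> ('i \<Rightarrow> 'a) set" where
  "ultra_map I R F x = null_ideal I R F +>\<^bsub>prod_ring I R\<^esub> x"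

definition factors_through_ultraproducts ::
  "('i filter \<Rightarrow> bool) \<Rightarrow> 'i set \<Rightarrow> ('i \<Rightarrow> 'a ring) \<Rightarrow> ('c, 'n) ring_scheme \<Rightarrow> (('i \<Rightarrow> 'a) \<Rightarrow> 'c) \<Rightarrow> bool"
  where
  "factors_through_ultraproducts \<Phi> I R S h \<longleftrightarrow>
    (\<exists>(n::nat) U. (\<forall>k<n. ultrafilter_on I (U k) \<and> \<Phi> (U k)) \<and>
      (\<exists>g \<in> na_hom (prod_ring {..<n} (\<lambda>k. ultraproduct I R (U k))) S.
        \<forall>x\<in>carrier (prod_ring I R). h x = g (\<lambda>k\<in>{..<n}. ultra_map I R (U k) x)))"

definition factors_through_finite_product ::
  "'i set \<Rightarrow> ('i \<Rightarrow> 'a ring) \<Rightarrow> ('c, 'n) ring_scheme \<Rightarrow> (('i \<Rightarrow> 'a) \<Rightarrow> 'c) \<Rightarrow> bool" where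
  "factors_through_finite_product I R S h \<longleftrightarrow>
    (\<exists>J. finite J \<and> J \<subseteq> I \<and>
      (\<exists>g \<in> na_hom (prod_ring J R) S. \<forall>x\<in>carrier (prod_ring I R). h x = g (restrict x J)))"


section \<open>Measurable cardinals\<close>

text \<open>The cardinal of the set \<^term>\<open>K\<close> is an uncountable measurable cardinal.\<close>

definition uncountable_measurable :: "'k set \<Rightarrow> bool" where
  "uncountable_measurable K \<longleftrightarrow> uncountable K \<and>
    (\<exists>F. ultrafilter_on K F \<and> (\<forall>x\<in>K. F \<noteq> principal {x}) \<and>
      (\<forall>\<S> :: 'k set set. (card_of \<S>, card_of K) \<in> ordLess \<longrightarrow>
        (\<forall>S\<in>\<S>. eventually (\<lambda>x. x \<in> S) F) \<longrightarrow> eventually (\<lambda>x. x \<in> \<Inter>\<S>) F))"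

text \<open>
  It is enough to let \<^term>\<open>K\<close> range over sets of the element type of \<^term>\<open>I\<close>: a cardinal
  that no such set represents exceeds the cardinal of that type, hence that of \<^term>\<open>I\<close>.
\<close>

definition below_measurable_cardinals :: "'i set \<Rightarrow> bool" where
  "below_measurable_cardinals I \<longleftrightarrow>
    (\<forall>K :: 'i set. uncountable_measurable K \<longrightarrow> (card_of I, card_of K) \<in> ordLess)"


section \<open>Abelian groups\<close>

definition torsion_free :: "('c, 'm) monoid_scheme \<Rightarrow> bool" where
  "torsion_free G \<longleftrightarrow> (\<forall>x\<in>carrier G. \<forall>n::nat. 0 < n \<longrightarrow> x [^]\<^bsub>G\<^esub> n = \<one>\<^bsub>G\<^esub> \<longrightarrow> x = \<one>\<^bsub>G\<^esub>)"

definition direct_summand :: "'c set \<Rightarrow> ('c, 'm) monoid_scheme \<Rightarrow> bool" where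
  "direct_summand H G \<longleftrightarrow> subgroup H G \<and>
    (\<exists>K. subgroup K G \<and> H \<inter> K = {\<one>\<^bsub>G\<^esub>} \<and> H <#>\<^bsub>G\<^esub> K = carrier G)"

text \<open>
  Overgroups are given by injective homomorphisms. A definition cannot quantify over groups on all
  types; restricting to overgroups carried by the type \<^typ>\<open>'c \<times> rat\<close> loses nothing,
  since it implies the splitting property for overgroups on every type: this is
  \<^verbatim>\<open>cotorsion_direct_summand\<close> below.
\<close>

definition cotorsion :: "('c, 'm) monoid_scheme \<Rightarrow> bool" where
  "cotorsion C \<longleftrightarrow> comm_group C \<and>
    (\<forall>(A :: ('c \<times> rat) monoid) j. comm_group A \<and> j \<in> mon C A \<and>
      torsion_free (A Mod (j ` carrier C)) \<longrightarrow> direct_summand (j ` carrier C) A)"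

definition has_nonzero_cotorsion_subgroup :: "('c, 'm) monoid_scheme \<Rightarrow> bool" where
  "has_nonzero_cotorsion_subgroup G \<longleftrightarrow>
    (\<exists>H. subgroup H G \<and> H \<noteq> {\<one>\<^bsub>G\<^esub>} \<and> cotorsion (G\<lparr>carrier := H\<rparr>))"

definition rat_group :: "rat monoid" where
  "rat_group = \<lparr>carrier = UNIV, monoid.mult = (+), one = 0\<rparr>"

text \<open>
  The \<^term>\<open>p\<close>-adic integers as the inverse limit of the groups of integers modulo
  \<^term>\<open>p ^ n\<close>, with residues represented in \<^term>\<open>{0..<p ^ n}\<close>.
\<close>

definition padic_group :: "nat \<Rightarrow> (nat \<Rightarrow> int) monoid" where
  "padic_group p =
    \<lparr>carrier = {x. \<forall>n. x n \<in> {0..<int p ^ n} \<and> x (Suc n) mod int p ^ n = x n},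
     monoid.mult = (\<lambda>x y n. (x n + y n) mod int p ^ n),
     one = (\<lambda>n. 0)\<rparr>"


section \<open>Justification of the encodings\<close>

lemma na_ring_prod_ring_group:
  assumes "\<And>i. i \<in> I \<Longrightarrow> na_ring (R i)"
  shows "group (add_monoid (prod_ring I R))"
proof -
  have "group (product_group I (\<lambda>i. add_monoid (R i)))"
    by (rule product_group) (rule abelian_group.a_group[OF na_ring.axioms(1)[OF assms]])
  moreover have "product_group I (\<lambda>i. add_monoid (R i)) = add_monoid (prod_ring I R)"
    by (simp add: product_group_def prod_ring_def)
  ultimately show ?thesis by simp
qed

lemma subgroup_null_ideal:
  assumes R: "\<And>i. i \<in> I \<Longrightarrow> na_ring (R i)" and F: "F \<le> principal I"
  shows "subgroup (null_ideal I R F) (add_monoid (prod_ring I R))"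
proof -
  let ?A = "add_monoid (prod_ring I R)"
  interpret A: group ?A by (rule na_ring_prod_ring_group[OF R])
  have gR: "group (add_monoid (R i))" if "i \<in> I" for i
    by (rule abelian_group.a_group[OF na_ring.axioms(1)[OF R[OF that]]])
  have inF: "eventually (\<lambda>i. i \<in> I) F"
    using F by (simp add: le_principal)
  have inv: "(inv\<^bsub>?A\<^esub> x) i = inv\<^bsub>add_monoid (R i)\<^esub> (x i)"
    if x: "x \<in> carrier ?A" and i: "i \<in> I" for x i
  proof -
    have m: "inv\<^bsub>?A\<^esub> x \<in> carrier ?A" by (rule A.inv_closed[OF x])
    have "(inv\<^bsub>?A\<^esub> x \<otimes>\<^bsub>?A\<^esub> x) i = \<one>\<^bsub>?A\<^esub> i" using x A.l_inv by metis
    then have "(inv\<^bsub>?A\<^esub> x) i \<otimes>\<^bsub>add_monoid (R i)\<^esub> x i = \<one>\<^bsub>add_monoid (R i)\<^esub>"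
      using i by (simp add: prod_ring_def)
    moreover have "(inv\<^bsub>?A\<^esub> x) i \<in> carrier (add_monoid (R i))" "x i \<in> carrier (add_monoid (R i))"
      using x m i by (auto simp: prod_ring_def PiE_iff)
    ultimately show ?thesis
      using group.inv_equality[OF gR[OF i]] by metis
  qed
  show ?thesis
  proof (rule A.subgroupI)
    show "null_ideal I R F \<subseteq> carrier ?A"
      by (auto simp: null_ideal_def)
    have "\<one>\<^bsub>?A\<^esub> \<in> null_ideal I R F"
    proof -
      have "\<one>\<^bsub>?A\<^esub> \<in> carrier ?A" by (rule A.one_closed)
      moreover have "eventually (\<lambda>i. \<one>\<^bsub>?A\<^esub> i = \<zero>\<^bsub>R i\<^esub>) F"
        using inF by eventually_elim (simp add: prod_ring_def)
      ultimately show ?thesis by (simp add: null_ideal_def)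
    qed
    then show "null_ideal I R F \<noteq> {}" by blast
  next
    fix x assume "x \<in> null_ideal I R F"
    then have x: "x \<in> carrier ?A" and e: "eventually (\<lambda>i. x i = \<zero>\<^bsub>R i\<^esub>) F"
      by (auto simp: null_ideal_def)
    have "eventually (\<lambda>i. (inv\<^bsub>?A\<^esub> x) i = \<zero>\<^bsub>R i\<^esub>) F"
      using e inF
    proof eventually_elim
      case (elim i)
      then show ?case
        using inv[OF x] group.is_monoid[OF gR] monoid.inv_one by fastforce
    qed
    moreover have "inv\<^bsub>?A\<^esub> x \<in> carrier ?A" by (rule A.inv_closed[OF x])
    ultimately show "inv\<^bsub>?A\<^esub> x \<in> null_ideal I R F" by (simp add: null_ideal_def)
  next
    fix x y assume "x \<in> null_ideal I R F" "y \<in> null_ideal I R F"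
    then have x: "x \<in> carrier ?A" "eventually (\<lambda>i. x i = \<zero>\<^bsub>R i\<^esub>) F"
      and y: "y \<in> carrier ?A" "eventually (\<lambda>i. y i = \<zero>\<^bsub>R i\<^esub>) F"
      by (auto simp: null_ideal_def)
    have "eventually (\<lambda>i. (x \<otimes>\<^bsub>?A\<^esub> y) i = \<zero>\<^bsub>R i\<^esub>) F"
      using x(2) y(2) inF
    proof eventually_elim
      case (elim i)
      have "\<one>\<^bsub>add_monoid (R i)\<^esub> \<otimes>\<^bsub>add_monoid (R i)\<^esub> \<one>\<^bsub>add_monoid (R i)\<^esub> = \<one>\<^bsub>add_monoid (R i)\<^esub>"
        using group.is_monoid[OF gR[OF elim(3)]] monoid.l_one monoid.one_closed by metis
      with elim show ?case by (simp add: prod_ring_def)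
    qed
    moreover have "x \<otimes>\<^bsub>?A\<^esub> y \<in> carrier ?A" using x y by (rule_tac A.m_closed)
    ultimately show "x \<otimes>\<^bsub>?A\<^esub> y \<in> null_ideal I R F" by (simp add: null_ideal_def)
  qed
qed

lemma ultra_map_eq_iff:
  assumes R: "\<And>i. i \<in> I \<Longrightarrow> na_ring (R i)" and F: "ultrafilter_on I F"
    and x: "x \<in> carrier (prod_ring I R)" and y: "y \<in> carrier (prod_ring I R)"
  shows "ultra_map I R F x = ultra_map I R F y \<longleftrightarrow> eventually (\<lambda>i. x i = y i) F"
proof -
  let ?A = "add_monoid (prod_ring I R)"
  let ?N = "null_ideal I R F"
  interpret A: group ?A by (rule na_ring_prod_ring_group[OF R])
  have FI: "F \<le> principal I" using F by (simp add: ultrafilter_on_def)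
  have N: "subgroup ?N ?A" by (rule subgroup_null_ideal[OF R FI])
  have gR: "group (add_monoid (R i))" if "i \<in> I" for i
    by (rule abelian_group.a_group[OF na_ring.axioms(1)[OF R[OF that]]])
  have inF: "eventually (\<lambda>i. i \<in> I) F"
    using FI by (simp add: le_principal)
  have x': "x \<in> carrier ?A" and y': "y \<in> carrier ?A" using x y by auto
  define z where "z = x \<otimes>\<^bsub>?A\<^esub> inv\<^bsub>?A\<^esub> y"
  have z: "z \<in> carrier ?A" unfolding z_def using x' y' by (intro A.m_closed A.inv_closed)
  have zy: "z \<otimes>\<^bsub>?A\<^esub> y = x"
    unfolding z_def using A.inv_solve_right' x' y' z z_def by metis
  have "ultra_map I R F x = ultra_map I R F y \<longleftrightarrow> z \<in> ?N"
  proof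
    assume "ultra_map I R F x = ultra_map I R F y"
    then have "x \<in> ?N #>\<^bsub>?A\<^esub> y"
      unfolding ultra_map_def a_r_coset_def using A.rcos_self[OF x' N] by simp
    then obtain n where n: "n \<in> ?N" "x = n \<otimes>\<^bsub>?A\<^esub> y"
      unfolding r_coset_def by blast
    have "n = z"
      using n zy y' z subgroup.mem_carrier[OF N n(1)] A.right_cancel by metis
    with n show "z \<in> ?N" by simp
  next
    assume zN: "z \<in> ?N"
    have "?N #>\<^bsub>?A\<^esub> x = ?N #>\<^bsub>?A\<^esub> y"
    proof (rule A.repr_independence[OF _ _ N, symmetric])
      show "x \<in> ?N #>\<^bsub>?A\<^esub> y" unfolding r_coset_def using zN zy by blast
      show "y \<in> carrier ?A" by (rule y')
    qed
    then show "ultra_map I R F x = ultra_map I R F y"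
      unfolding ultra_map_def a_r_coset_def .
  qed
  also have "\<dots> \<longleftrightarrow> eventually (\<lambda>i. z i = \<zero>\<^bsub>R i\<^esub>) F"
    using z by (simp add: null_ideal_def)
  also have "\<dots> \<longleftrightarrow> eventually (\<lambda>i. x i = y i) F"
  proof (rule eventually_subst)
    show "eventually (\<lambda>i. (z i = \<zero>\<^bsub>R i\<^esub>) = (x i = y i)) F"
      using inF
    proof eventually_elim
      case (elim i)
      let ?G = "add_monoid (R i)"
      have c: "z i \<in> carrier ?G" "y i \<in> carrier ?G"
        using z y elim by (auto simp: prod_ring_def PiE_iff)
      have "x i = (z \<otimes>\<^bsub>?A\<^esub> y) i" using zy by simp
      then have "x i = z i \<otimes>\<^bsub>?G\<^esub> y i" using elim by (simp add: prod_ring_def)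
      then have "x i = y i \<longleftrightarrow> z i = \<one>\<^bsub>?G\<^esub>"
        using c group.r_cancel_one[OF gR[OF elim]] by metis
      then show ?case by simp
    qed
  qed
  finally show ?thesis .
qed

lemma torsion_free_Mod_iff:
  assumes "comm_group A" and H: "subgroup H A"
  shows "torsion_free (A Mod H) \<longleftrightarrow>
    (\<forall>x\<in>carrier A. \<forall>n::int. n \<noteq> 0 \<longrightarrow> x [^]\<^bsub>A\<^esub> n \<in> H \<longrightarrow> x \<in> H)"
proof -
  interpret A: comm_group A by fact
  interpret N: normal H A
    using A.normal_iff_subgroup H by blast
  have coset: "H #>\<^bsub>A\<^esub> y = H \<longleftrightarrow> y \<in> H" if "y \<in> carrier A" for y
    using that A.rcos_self[OF that H] A.coset_join2[OF that H] by auto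
  have "torsion_free (A Mod H) \<longleftrightarrow>
    (\<forall>x\<in>carrier A. \<forall>n::nat. 0 < n \<longrightarrow> x [^]\<^bsub>A\<^esub> n \<in> H \<longrightarrow> x \<in> H)"
    unfolding torsion_free_def carrier_FactGroup one_FactGroup
    by (auto simp: N.FactGroup_pow coset)
  also have "\<dots> \<longleftrightarrow>
    (\<forall>x\<in>carrier A. \<forall>n::int. n \<noteq> 0 \<longrightarrow> x [^]\<^bsub>A\<^esub> n \<in> H \<longrightarrow> x \<in> H)"
  proof (intro iffI ballI allI impI)
    fix x and n :: int
    assume h: "\<forall>x\<in>carrier A. \<forall>n::nat. 0 < n \<longrightarrow> x [^]\<^bsub>A\<^esub> n \<in> H \<longrightarrow> x \<in> H"
      and x: "x \<in> carrier A" and n: "n \<noteq> 0" and e: "x [^]\<^bsub>A\<^esub> n \<in> H"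
    have "x [^]\<^bsub>A\<^esub> nat \<bar>n\<bar> \<in> H"
    proof (cases "0 \<le> n")
      case True
      then have "x [^]\<^bsub>A\<^esub> n = x [^]\<^bsub>A\<^esub> nat \<bar>n\<bar>"
        using int_pow_int[of A x "nat \<bar>n\<bar>"] by simp
      then show ?thesis using e by simp
    next
      case False
      define k where "k = nat \<bar>n\<bar>"
      have "n = - int k" using False by (simp add: k_def)
      then have "x [^]\<^bsub>A\<^esub> n = inv\<^bsub>A\<^esub> (x [^]\<^bsub>A\<^esub> nat \<bar>n\<bar>)"
        unfolding k_def[symmetric] using A.int_pow_neg_int[OF x, of k] by (rule ssubst)
      then have "x [^]\<^bsub>A\<^esub> nat \<bar>n\<bar> = inv\<^bsub>A\<^esub> (x [^]\<^bsub>A\<^esub> n)"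
        using A.inv_inv[OF A.nat_pow_closed[OF x]] by metis
      then show ?thesis using N.m_inv_closed[OF e] by metis
    qed
    moreover have "0 < nat \<bar>n\<bar>" using n by simp
    ultimately show "x \<in> H" using h x by blast
  next
    fix x and n :: nat
    assume h: "\<forall>x\<in>carrier A. \<forall>n::int. n \<noteq> 0 \<longrightarrow> x [^]\<^bsub>A\<^esub> n \<in> H \<longrightarrow> x \<in> H"
      and x: "x \<in> carrier A" and n: "0 < n" and e: "x [^]\<^bsub>A\<^esub> n \<in> H"
    have "x [^]\<^bsub>A\<^esub> int n \<in> H" using e by (simp add: int_pow_int)
    moreover have "int n \<noteq> 0" using n by simp
    ultimately show "x \<in> H" using h x by blast
  qed
  finally show ?thesis .
qed

lemma mon_image_subgroup:
  assumes "comm_group A" "comm_group C" "j \<in> mon C A"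
  shows "subgroup (j ` carrier C) A"
  using assms group_hom.img_is_subgroup[of C A j]
  by (auto simp: mon_def group_hom_def group_hom_axioms_def comm_group_def)

lemma direct_summand_imp_retraction:
  assumes "comm_group A" "comm_group C" and j: "j \<in> mon C A"
    and ds: "direct_summand (j ` carrier C) A"
  obtains r where "r \<in> hom A C" "\<And>c. c \<in> carrier C \<Longrightarrow> r (j c) = c"
proof -
  interpret A: comm_group A by fact
  interpret C: comm_group C by fact
  interpret jh: group_hom C A j
    using j by unfold_locales (simp add: mon_def)
  have jinj: "inj_on j (carrier C)" using j by (simp add: mon_def)
  obtain K where K: "subgroup K A" and int: "j ` carrier C \<inter> K = {\<one>\<^bsub>A\<^esub>}"
    and sum: "(j ` carrier C) <#>\<^bsub>A\<^esub> K = carrier A"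
    using ds by (auto simp: direct_summand_def)
  interpret K: subgroup K A by fact
  define P where "P x c \<longleftrightarrow> c \<in> carrier C \<and> (\<exists>k\<in>K. x = j c \<otimes>\<^bsub>A\<^esub> k)" for x c
  have ex: "\<exists>c. P x c" if "x \<in> carrier A" for x
    using that unfolding sum[symmetric] set_mult_def P_def by blast
  have uniq: "c = d" if cd: "P x c" "P x d" for x c d
  proof -
    obtain k l where k: "k \<in> K" "x = j c \<otimes>\<^bsub>A\<^esub> k" and l: "l \<in> K" "x = j d \<otimes>\<^bsub>A\<^esub> l"
      and c: "c \<in> carrier C" and d: "d \<in> carrier C"
      using cd by (auto simp: P_def)
    have kc: "k \<in> carrier A" "l \<in> carrier A" using k l by auto
    have "j (c \<otimes>\<^bsub>C\<^esub> inv\<^bsub>C\<^esub> d) = j c \<otimes>\<^bsub>A\<^esub> inv\<^bsub>A\<^esub> (j d)"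
      using c d by simp
    also have "\<dots> = l \<otimes>\<^bsub>A\<^esub> inv\<^bsub>A\<^esub> k"
    proof -
      have "j c = j d \<otimes>\<^bsub>A\<^esub> l \<otimes>\<^bsub>A\<^esub> inv\<^bsub>A\<^esub> k"
        using k l kc c d by (metis A.inv_solve_right A.m_closed jh.hom_closed)
      then have "j c = (l \<otimes>\<^bsub>A\<^esub> inv\<^bsub>A\<^esub> k) \<otimes>\<^bsub>A\<^esub> j d"
        using kc d by (simp add: A.m_ac)
      then show ?thesis
        using kc c d by (metis A.inv_closed A.inv_solve_right' A.m_closed jh.hom_closed)
    qed
    finally have "j (c \<otimes>\<^bsub>C\<^esub> inv\<^bsub>C\<^esub> d) \<in> K" using k l by simp
    moreover have "j (c \<otimes>\<^bsub>C\<^esub> inv\<^bsub>C\<^esub> d) \<in> j ` carrier C" using c d by blast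
    ultimately have "j (c \<otimes>\<^bsub>C\<^esub> inv\<^bsub>C\<^esub> d) = j \<one>\<^bsub>C\<^esub>" using int by auto
    then have "c \<otimes>\<^bsub>C\<^esub> inv\<^bsub>C\<^esub> d = \<one>\<^bsub>C\<^esub>" using inj_onD[OF jinj] c d by simp
    then show "c = d" using c d by (metis C.inv_equality C.inv_inv C.inv_closed)
  qed
  define r where "r x = (THE c. P x c)" for x
  have r_eq: "r x = c" if "P x c" for x c
    unfolding r_def using that uniq by blast
  have rP: "P x (r x)" if "x \<in> carrier A" for x
    using ex[OF that] r_eq by metis
  show thesis
  proof
    show "r \<in> hom A C"
    proof (rule homI)
      show "r x \<in> carrier C" if "x \<in> carrier A" for x
        using rP[OF that] by (simp add: P_def)
    next
      fix x y assume x: "x \<in> carrier A" and y: "y \<in> carrier A"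
      obtain k l where k: "k \<in> K" "x = j (r x) \<otimes>\<^bsub>A\<^esub> k" and l: "l \<in> K" "y = j (r y) \<otimes>\<^bsub>A\<^esub> l"
        and c: "r x \<in> carrier C" "r y \<in> carrier C"
        using rP[OF x] rP[OF y] by (auto simp: P_def)
      have "x \<otimes>\<^bsub>A\<^esub> y = (j (r x) \<otimes>\<^bsub>A\<^esub> k) \<otimes>\<^bsub>A\<^esub> (j (r y) \<otimes>\<^bsub>A\<^esub> l)"
        using k(2) l(2) by simp
      also have "\<dots> = j (r x \<otimes>\<^bsub>C\<^esub> r y) \<otimes>\<^bsub>A\<^esub> (k \<otimes>\<^bsub>A\<^esub> l)"
        using k(1) l(1) c by (simp add: A.m_ac)
      finally have "P (x \<otimes>\<^bsub>A\<^esub> y) (r x \<otimes>\<^bsub>C\<^esub> r y)"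
        using k(1) l(1) c by (auto simp: P_def)
      then show "r (x \<otimes>\<^bsub>A\<^esub> y) = r x \<otimes>\<^bsub>C\<^esub> r y" by (rule r_eq)
    qed
  next
    fix c assume "c \<in> carrier C"
    then have "P (j c) c" by (auto simp: P_def intro!: bexI[of _ "\<one>\<^bsub>A\<^esub>"])
    then show "r (j c) = c" by (rule r_eq)
  qed
qed

lemma retraction_imp_direct_summand:
  assumes "comm_group A" "comm_group C" and j: "j \<in> mon C A"
    and r: "r \<in> hom A C" "\<And>c. c \<in> carrier C \<Longrightarrow> r (j c) = c"
  shows "direct_summand (j ` carrier C) A"
proof -
  interpret A: comm_group A by fact
  interpret C: comm_group C by fact
  interpret jh: group_hom C A j
    using j by unfold_locales (simp add: mon_def)
  interpret rh: group_hom A C r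
    using r by unfold_locales simp
  have K: "subgroup (kernel A C r) A" by (rule rh.subgroup_kernel)
  have "j ` carrier C \<inter> kernel A C r = {\<one>\<^bsub>A\<^esub>}"
  proof -
    have "j c = \<one>\<^bsub>A\<^esub>" if "c \<in> carrier C" "r (j c) = \<one>\<^bsub>C\<^esub>" for c
      using that r(2) by simp
    moreover have "\<one>\<^bsub>A\<^esub> \<in> j ` carrier C"
      using jh.hom_one C.one_closed by (metis imageI)
    moreover have "\<one>\<^bsub>A\<^esub> \<in> kernel A C r" by (simp add: kernel_def)
    ultimately show ?thesis unfolding kernel_def by blast
  qed
  moreover have "(j ` carrier C) <#>\<^bsub>A\<^esub> kernel A C r = carrier A"
  proof
    show "(j ` carrier C) <#>\<^bsub>A\<^esub> kernel A C r \<subseteq> carrier A"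
      by (auto simp: set_mult_def kernel_def)
    show "carrier A \<subseteq> (j ` carrier C) <#>\<^bsub>A\<^esub> kernel A C r"
    proof
      fix x assume x: "x \<in> carrier A"
      let ?k = "inv\<^bsub>A\<^esub> (j (r x)) \<otimes>\<^bsub>A\<^esub> x"
      have "r ?k = \<one>\<^bsub>C\<^esub>" using x r(2) by simp
      then have "?k \<in> kernel A C r" using x by (simp add: kernel_def)
      moreover have "x = j (r x) \<otimes>\<^bsub>A\<^esub> ?k"
        using x by (simp add: A.m_assoc[symmetric])
      moreover have "j (r x) \<in> j ` carrier C" using x by simp
      ultimately show "x \<in> (j ` carrier C) <#>\<^bsub>A\<^esub> kernel A C r"
        unfolding set_mult_def by blast
    qed
  qed
  ultimately show ?thesis
    using K mon_image_subgroup[OF assms(1-3)] by (auto simp: direct_summand_def)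
qed

text \<open>
  A retraction defined on a subgroup with torsion-free quotient extends to the pure closure of that
  subgroup and one further element; the extension problem is an overgroup of \<^term>\<open>C\<close> whose quotient
  embeds in the rationals.
\<close>

lemma cotorsion_extend_retraction:
  assumes A: "comm_group A" and cot: "cotorsion (C :: ('c, 'm) monoid_scheme)"
    and j: "j \<in> mon C A"
    and H: "subgroup H A" and jH: "j ` carrier C \<subseteq> H"
    and pure: "\<And>x n::int. \<lbrakk>x \<in> carrier A; n \<noteq> 0; x [^]\<^bsub>A\<^esub> n \<in> H\<rbrakk> \<Longrightarrow> x \<in> H"
    and r: "r \<in> hom (A\<lparr>carrier := H\<rparr>) C" "\<And>c. c \<in> carrier C \<Longrightarrow> r (j c) = c"
    and a: "a \<in> carrier A" "a \<notin> H"
  obtains K r' where "subgroup K A" "H \<subseteq> K" "a \<in> K"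
    "\<And>x n::int. \<lbrakk>x \<in> carrier A; n \<noteq> 0; x [^]\<^bsub>A\<^esub> n \<in> K\<rbrakk> \<Longrightarrow> x \<in> K"
    "r' \<in> hom (A\<lparr>carrier := K\<rparr>) C" "\<And>x. x \<in> H \<Longrightarrow> r' x = r x"
proof -
  interpret A: comm_group A by fact
  have Cg: "comm_group C" using cot by (simp add: cotorsion_def)
  interpret C: comm_group C by fact
  interpret jh: group_hom C A j
    using j by unfold_locales (simp add: mon_def)
  interpret H: subgroup H A by fact
  have Hpow: "x [^]\<^bsub>A\<^esub> (n::int) \<in> H" if "x \<in> H" for x n
    using A.subgroup_int_pow_closed[OF H that] .
  have rm: "r (x \<otimes>\<^bsub>A\<^esub> y) = r x \<otimes>\<^bsub>C\<^esub> r y" if "x \<in> H" "y \<in> H" for x y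
    using r(1) that by (simp add: hom_def)
  have rc: "r x \<in> carrier C" if "x \<in> H" for x
    using r(1) that by (auto simp: hom_def)
  have r1: "r \<one>\<^bsub>A\<^esub> = \<one>\<^bsub>C\<^esub>"
    using r(2)[OF C.one_closed] by simp
  have apow: "m = 0" if "a [^]\<^bsub>A\<^esub> (m::int) \<in> H" for m
    using pure[OF a(1) _ that] a(2) by blast
  define P where "P x n m \<longleftrightarrow> n \<noteq> 0 \<and> x [^]\<^bsub>A\<^esub> n \<otimes>\<^bsub>A\<^esub> a [^]\<^bsub>A\<^esub> m \<in> H" for x and n m :: int
  define K where "K = {x \<in> carrier A. \<exists>n m. P x n m}"
  have Kc: "x \<in> carrier A" if "x \<in> K" for x using that by (simp add: K_def)
  have P_uniq: "m * n' = m' * n"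
    if x: "x \<in> carrier A" and p: "P x n m" "P x n' m'" for x n m n' m'
  proof -
    let ?u = "x [^]\<^bsub>A\<^esub> n \<otimes>\<^bsub>A\<^esub> a [^]\<^bsub>A\<^esub> m"
    let ?v = "x [^]\<^bsub>A\<^esub> n' \<otimes>\<^bsub>A\<^esub> a [^]\<^bsub>A\<^esub> m'"
    have "?u [^]\<^bsub>A\<^esub> n' \<otimes>\<^bsub>A\<^esub> ?v [^]\<^bsub>A\<^esub> (- n) \<in> H"
      using p Hpow by (auto simp: P_def)
    also have "?u [^]\<^bsub>A\<^esub> n' \<otimes>\<^bsub>A\<^esub> ?v [^]\<^bsub>A\<^esub> (- n)
      = (x [^]\<^bsub>A\<^esub> (n * n') \<otimes>\<^bsub>A\<^esub> a [^]\<^bsub>A\<^esub> (m * n')) \<otimes>\<^bsub>A\<^esub> (x [^]\<^bsub>A\<^esub> (n' * (- n)) \<otimes>\<^bsub>A\<^esub> a [^]\<^bsub>A\<^esub> (m' * (- n)))"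
      using x a by (simp only: A.int_pow_distrib A.int_pow_pow A.int_pow_closed)
    also have "\<dots> = (x [^]\<^bsub>A\<^esub> (n * n') \<otimes>\<^bsub>A\<^esub> x [^]\<^bsub>A\<^esub> (n' * (- n))) \<otimes>\<^bsub>A\<^esub> (a [^]\<^bsub>A\<^esub> (m * n') \<otimes>\<^bsub>A\<^esub> a [^]\<^bsub>A\<^esub> (m' * (- n)))"
      using x a by (simp add: A.m_ac)
    also have "\<dots> = x [^]\<^bsub>A\<^esub> (n * n' + n' * (- n)) \<otimes>\<^bsub>A\<^esub> a [^]\<^bsub>A\<^esub> (m * n' + m' * (- n))"
      using x a by (simp only: A.int_pow_mult)
    also have "\<dots> = a [^]\<^bsub>A\<^esub> (m * n' + m' * (- n))"
      using x a by (simp add: mult.commute)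
    finally show ?thesis using apow by fastforce
  qed
  have P_mult: "P (x \<otimes>\<^bsub>A\<^esub> y) (n * n') (m * n' + m' * n)"
    if x: "x \<in> carrier A" and y: "y \<in> carrier A" and p: "P x n m" "P y n' m'" for x y n m n' m'
  proof -
    let ?u = "x [^]\<^bsub>A\<^esub> n \<otimes>\<^bsub>A\<^esub> a [^]\<^bsub>A\<^esub> m"
    let ?v = "y [^]\<^bsub>A\<^esub> n' \<otimes>\<^bsub>A\<^esub> a [^]\<^bsub>A\<^esub> m'"
    have "?u [^]\<^bsub>A\<^esub> n' \<otimes>\<^bsub>A\<^esub> ?v [^]\<^bsub>A\<^esub> n \<in> H"
      using p Hpow by (auto simp: P_def)
    also have "?u [^]\<^bsub>A\<^esub> n' \<otimes>\<^bsub>A\<^esub> ?v [^]\<^bsub>A\<^esub> n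
      = (x [^]\<^bsub>A\<^esub> (n * n') \<otimes>\<^bsub>A\<^esub> a [^]\<^bsub>A\<^esub> (m * n')) \<otimes>\<^bsub>A\<^esub> (y [^]\<^bsub>A\<^esub> (n' * n) \<otimes>\<^bsub>A\<^esub> a [^]\<^bsub>A\<^esub> (m' * n))"
      using x y a by (simp only: A.int_pow_distrib A.int_pow_pow A.int_pow_closed)
    also have "\<dots> = (x [^]\<^bsub>A\<^esub> (n * n') \<otimes>\<^bsub>A\<^esub> y [^]\<^bsub>A\<^esub> (n * n')) \<otimes>\<^bsub>A\<^esub> (a [^]\<^bsub>A\<^esub> (m * n') \<otimes>\<^bsub>A\<^esub> a [^]\<^bsub>A\<^esub> (m' * n))"
      using x y a by (simp add: A.m_ac mult.commute)
    also have "\<dots> = (x \<otimes>\<^bsub>A\<^esub> y) [^]\<^bsub>A\<^esub> (n * n') \<otimes>\<^bsub>A\<^esub> a [^]\<^bsub>A\<^esub> (m * n' + m' * n)"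
      using x y a by (simp only: A.int_pow_mult A.int_pow_distrib)
    finally show ?thesis using p by (simp add: P_def)
  qed
  have P_inv: "P (inv\<^bsub>A\<^esub> x) (- n) m" if x: "x \<in> carrier A" and p: "P x n m" for x n m
    using p x by (simp add: P_def A.int_pow_inv A.int_pow_neg)
  have P_H: "P x 1 0" if "x \<in> H" for x
    using that by (simp add: P_def)
  have HK: "H \<subseteq> K" using P_H by (auto simp: K_def)
  have aK: "a \<in> K"
  proof -
    have "P a 1 (- 1)" using a(1) by (simp add: P_def A.int_pow_neg)
    then show ?thesis using a(1) by (auto simp: K_def)
  qed
  have K: "subgroup K A"
  proof (rule A.subgroupI)
    show "K \<subseteq> carrier A" by (auto simp: K_def)
    show "K \<noteq> {}" using aK by blast
    show "inv\<^bsub>A\<^esub> x \<in> K" if x: "x \<in> K" for x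
    proof -
      obtain n m where "P x n m" "x \<in> carrier A" using x by (auto simp: K_def)
      then have "P (inv\<^bsub>A\<^esub> x) (- n) m" "inv\<^bsub>A\<^esub> x \<in> carrier A" using P_inv by auto
      then show ?thesis unfolding K_def by blast
    qed
    show "x \<otimes>\<^bsub>A\<^esub> y \<in> K" if xy: "x \<in> K" "y \<in> K" for x y
    proof -
      from xy obtain n m n' m' where p: "P x n m" "P y n' m'" and c: "x \<in> carrier A" "y \<in> carrier A"
        by (auto simp: K_def)
      show ?thesis using P_mult[OF c p] c unfolding K_def by blast
    qed
  qed
  note Km = subgroup.m_closed[OF K] and Ki = subgroup.m_inv_closed[OF K]
  have pureK: "x \<in> K" if x: "x \<in> carrier A" and n: "n \<noteq> 0" and xn: "x [^]\<^bsub>A\<^esub> n \<in> K"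
    for x and n :: int
  proof -
    obtain k m where "P (x [^]\<^bsub>A\<^esub> n) k m" using xn by (auto simp: K_def)
    then have "P x (n * k) m" using n x by (simp add: P_def A.int_pow_pow)
    then show ?thesis using x by (auto simp: K_def)
  qed
  define q :: "'a \<Rightarrow> rat" where "q x = (THE u. \<exists>n m. P x n m \<and> u = of_int m / of_int n)" for x
  have q_eq: "q x = of_int m / of_int n" if x: "x \<in> carrier A" and p: "P x n m" for x n m
    unfolding q_def
  proof (rule the_equality)
    show "\<exists>n' m'. P x n' m' \<and> (of_int m / of_int n :: rat) = of_int m' / of_int n'" using p by blast
    fix u :: rat assume "\<exists>n m. P x n m \<and> u = of_int m / of_int n"
    then obtain n' m' where p': "P x n' m'" and u: "u = of_int m' / of_int n'" by blast
    have "m * n' = m' * n" by (rule P_uniq[OF x p p'])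
    then have "(of_int m * of_int n' :: rat) = of_int m' * of_int n" by (metis of_int_mult)
    then show "u = of_int m / of_int n"
      using u p p' by (simp add: P_def frac_eq_eq)
  qed
  have q_mult: "q (x \<otimes>\<^bsub>A\<^esub> y) = q x + q y" if xy: "x \<in> K" "y \<in> K" for x y
  proof -
    obtain n m n' m' where p: "P x n m" "P y n' m'" and c: "x \<in> carrier A" "y \<in> carrier A"
      using xy by (auto simp: K_def)
    have "n \<noteq> 0" "n' \<noteq> 0" using p by (auto simp: P_def)
    then have "q x + q y = of_int (m * n' + m' * n) / of_int (n * n')"
      using q_eq[OF c(1) p(1)] q_eq[OF c(2) p(2)] by (simp add: add_frac_eq)
    also have "\<dots> = q (x \<otimes>\<^bsub>A\<^esub> y)"
      by (rule q_eq[OF A.m_closed[OF c] P_mult[OF c p], symmetric])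
    finally show ?thesis ..
  qed
  have q_H: "q x = 0" if "x \<in> H" for x
    using q_eq[OF _ P_H[OF that]] that by simp
  have H_q: "x \<in> H" if xK: "x \<in> K" and qx: "q x = 0" for x
  proof -
    obtain n m where p: "P x n m" and c: "x \<in> carrier A" using xK by (auto simp: K_def)
    have n: "n \<noteq> 0" using p by (simp add: P_def)
    then have "m = 0" using q_eq[OF c p] qx by simp
    then have "x [^]\<^bsub>A\<^esub> n \<in> H" using p c by (simp add: P_def)
    then show ?thesis using pure c n by blast
  qed
  have q_inv: "q (inv\<^bsub>A\<^esub> x) = - q x" if "x \<in> K" for x
    using q_mult[OF that Ki[OF that]] q_H[OF H.one_closed] Kc[OF that] by simp
  have diffH: "x \<otimes>\<^bsub>A\<^esub> inv\<^bsub>A\<^esub> y \<in> H" if "x \<in> K" "y \<in> K" "q x = q y" for x y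
    using that q_mult[OF that(1) Ki[OF that(2)]] q_inv[OF that(2)] Km[OF that(1) Ki[OF that(2)]]
    by (intro H_q) auto
  define s where "s u = (SOME y. y \<in> K \<and> q y = u)" for u
  have s: "s (q x) \<in> K" "q (s (q x)) = q x" if "x \<in> K" for x
    using someI[of "\<lambda>y. y \<in> K \<and> q y = q x" x] that by (auto simp: s_def)
  define \<psi> where "\<psi> x = (r (x \<otimes>\<^bsub>A\<^esub> inv\<^bsub>A\<^esub> (s (q x))), q x)" for x
  have xs: "x \<otimes>\<^bsub>A\<^esub> inv\<^bsub>A\<^esub> (s (q x)) \<in> H" if "x \<in> K" for x
    using that s[OF that] diffH by auto
  have \<psi>_iff: "\<psi> x = \<psi> y \<longleftrightarrow> x \<otimes>\<^bsub>A\<^esub> inv\<^bsub>A\<^esub> y \<in> H \<and> r (x \<otimes>\<^bsub>A\<^esub> inv\<^bsub>A\<^esub> y) = \<one>\<^bsub>C\<^esub>"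
    if x: "x \<in> K" and y: "y \<in> K" for x y
  proof (cases "q x = q y")
    case True
    let ?t = "s (q y)"
    have t: "?t \<in> carrier A" using s[OF y] Kc by blast
    have xy: "x \<otimes>\<^bsub>A\<^esub> inv\<^bsub>A\<^esub> y \<in> H" using diffH x y True by blast
    have c: "x \<in> carrier A" "y \<in> carrier A" using x y Kc by auto
    have "x \<otimes>\<^bsub>A\<^esub> inv\<^bsub>A\<^esub> ?t = (x \<otimes>\<^bsub>A\<^esub> inv\<^bsub>A\<^esub> y) \<otimes>\<^bsub>A\<^esub> (y \<otimes>\<^bsub>A\<^esub> inv\<^bsub>A\<^esub> ?t)"
      using c t by (metis A.inv_closed A.l_inv A.l_one A.m_assoc A.m_closed)
    then have "r (x \<otimes>\<^bsub>A\<^esub> inv\<^bsub>A\<^esub> ?t) = r (x \<otimes>\<^bsub>A\<^esub> inv\<^bsub>A\<^esub> y) \<otimes>\<^bsub>C\<^esub> r (y \<otimes>\<^bsub>A\<^esub> inv\<^bsub>A\<^esub> ?t)"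
      using rm xy xs[OF y] by simp
    then show ?thesis
      using True xy rc[OF xy] rc[OF xs[OF y]] by (simp add: \<psi>_def C.r_cancel_one)
  next
    case False
    have "x \<otimes>\<^bsub>A\<^esub> inv\<^bsub>A\<^esub> y \<notin> H"
    proof
      assume "x \<otimes>\<^bsub>A\<^esub> inv\<^bsub>A\<^esub> y \<in> H"
      then have "q (x \<otimes>\<^bsub>A\<^esub> inv\<^bsub>A\<^esub> y) = 0" by (rule q_H)
      then show False using False q_mult[OF x Ki[OF y]] q_inv[OF y] by simp
    qed
    then show ?thesis using False by (simp add: \<psi>_def)
  qed
  define \<phi> where "\<phi> e = (SOME x. x \<in> K \<and> \<psi> x = e)" for e
  have \<phi>: "\<phi> (\<psi> x) \<in> K" "\<psi> (\<phi> (\<psi> x)) = \<psi> x" if "x \<in> K" for x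
    using someI[of "\<lambda>y. y \<in> K \<and> \<psi> y = \<psi> x" x] that by (auto simp: \<phi>_def)
  have \<psi>_cong: "\<psi> (x \<otimes>\<^bsub>A\<^esub> y) = \<psi> (x' \<otimes>\<^bsub>A\<^esub> y')"
    if k: "x \<in> K" "y \<in> K" "x' \<in> K" "y' \<in> K" and e: "\<psi> x = \<psi> x'" "\<psi> y = \<psi> y'" for x y x' y'
  proof -
    have c: "x \<in> carrier A" "y \<in> carrier A" "x' \<in> carrier A" "y' \<in> carrier A" using k Kc by auto
    have "(x \<otimes>\<^bsub>A\<^esub> y) \<otimes>\<^bsub>A\<^esub> inv\<^bsub>A\<^esub> (x' \<otimes>\<^bsub>A\<^esub> y') = (x \<otimes>\<^bsub>A\<^esub> inv\<^bsub>A\<^esub> x') \<otimes>\<^bsub>A\<^esub> (y \<otimes>\<^bsub>A\<^esub> inv\<^bsub>A\<^esub> y')"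
      using c by (simp add: A.inv_mult A.m_ac)
    then show ?thesis
      using e k \<psi>_iff[OF k(1,3)] \<psi>_iff[OF k(2,4)]
      by (subst \<psi>_iff) (auto simp: rm Km)
  qed
  define E0 :: "('c \<times> rat) monoid" where
    "E0 = \<lparr>carrier = \<psi> ` K, monoid.mult = (\<lambda>e e'. \<psi> (\<phi> e \<otimes>\<^bsub>A\<^esub> \<phi> e')), one = \<psi> \<one>\<^bsub>A\<^esub>\<rparr>"
  interpret AK: comm_group "A\<lparr>carrier := K\<rparr>"
    by (rule group.group_comm_groupI[OF A.subgroup_imp_group[OF K]]) (simp add: A.m_comm Kc)
  have \<psi>_hom: "\<psi> \<in> hom (A\<lparr>carrier := K\<rparr>) E0"
  proof (rule homI)
    fix x y assume "x \<in> carrier (A\<lparr>carrier := K\<rparr>)" "y \<in> carrier (A\<lparr>carrier := K\<rparr>)"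
    then have x: "x \<in> K" and y: "y \<in> K" by auto
    have "\<psi> (x \<otimes>\<^bsub>A\<^esub> y) = \<psi> (\<phi> (\<psi> x) \<otimes>\<^bsub>A\<^esub> \<phi> (\<psi> y))"
      by (rule \<psi>_cong) (use x y \<phi> in auto)
    then show "\<psi> (x \<otimes>\<^bsub>A\<lparr>carrier := K\<rparr>\<^esub> y) = \<psi> x \<otimes>\<^bsub>E0\<^esub> \<psi> y"
      by (simp add: E0_def)
  qed (auto simp: E0_def)
  have E: "comm_group E0"
    using AK.hom_imp_img_comm_group[OF \<psi>_hom] by (simp add: E0_def)
  interpret E: comm_group E0 by (rule E)
  interpret \<psi>: group_hom "A\<lparr>carrier := K\<rparr>" E0 \<psi>
    by unfold_locales (rule \<psi>_hom)
  have \<psi>m: "\<psi> (x \<otimes>\<^bsub>A\<^esub> y) = \<psi> x \<otimes>\<^bsub>E0\<^esub> \<psi> y" if "x \<in> K" "y \<in> K" for x y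
    using \<psi>.hom_mult that by simp
  have jK: "j c \<in> K" if "c \<in> carrier C" for c
    using that jH HK by blast
  have jE: "(\<lambda>c. \<psi> (j c)) \<in> mon C E0"
    unfolding mon_def
  proof (intro CollectI conjI inj_onI homI)
    fix c d assume c: "c \<in> carrier C" and d: "d \<in> carrier C"
    then show "\<psi> (j (c \<otimes>\<^bsub>C\<^esub> d)) = \<psi> (j c) \<otimes>\<^bsub>E0\<^esub> \<psi> (j d)"
      using \<psi>m jK by simp
    assume "\<psi> (j c) = \<psi> (j d)"
    then have "r (j (c \<otimes>\<^bsub>C\<^esub> inv\<^bsub>C\<^esub> d)) = \<one>\<^bsub>C\<^esub>"
      using \<psi>_iff[OF jK[OF c] jK[OF d]] c d by simp
    then have "c \<otimes>\<^bsub>C\<^esub> inv\<^bsub>C\<^esub> d = \<one>\<^bsub>C\<^esub>"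
      using r(2)[OF C.m_closed[OF c C.inv_closed[OF d]]] by simp
    then show "c = d" using c d by (metis C.inv_equality C.inv_inv C.inv_closed)
  qed (use jK in \<open>auto simp: E0_def\<close>)
  have \<psi>H: "\<psi> x = \<psi> (j (r x))" if x: "x \<in> H" for x
  proof (subst \<psi>_iff)
    have rx: "r x \<in> carrier C" by (rule rc[OF x])
    show "x \<in> K" "j (r x) \<in> K" using x HK jK[OF rx] by auto
    have jr: "inv\<^bsub>A\<^esub> (j (r x)) = j (inv\<^bsub>C\<^esub> (r x))" using rx by simp
    have jm: "j (inv\<^bsub>C\<^esub> (r x)) \<in> H" using jH C.inv_closed[OF rx] by blast
    then show "x \<otimes>\<^bsub>A\<^esub> inv\<^bsub>A\<^esub> (j (r x)) \<in> H \<and> r (x \<otimes>\<^bsub>A\<^esub> inv\<^bsub>A\<^esub> (j (r x))) = \<one>\<^bsub>C\<^esub>"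
      unfolding jr using H.m_closed[OF x jm] rm[OF x jm] r(2)[OF C.inv_closed[OF rx]] rx
      by (simp del: jh.hom_inv)
  qed
  have "torsion_free (E0 Mod ((\<lambda>c. \<psi> (j c)) ` carrier C))"
  proof (subst torsion_free_Mod_iff[OF E mon_image_subgroup[OF E Cg jE]], intro ballI allI impI)
    fix e and n :: int
    assume "e \<in> carrier E0" and n: "n \<noteq> 0" and en: "e [^]\<^bsub>E0\<^esub> n \<in> (\<lambda>c. \<psi> (j c)) ` carrier C"
    then obtain x where x: "x \<in> K" "e = \<psi> x" by (auto simp: E0_def)
    obtain c where c: "c \<in> carrier C" "e [^]\<^bsub>E0\<^esub> n = \<psi> (j c)" using en by auto
    have "\<psi> (x [^]\<^bsub>A\<^esub> n) = \<psi> (j c)"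
      using \<psi>.hom_int_pow[of x n] A.int_pow_consistent[OF K x(1), of n] x c by simp
    then have "q (x [^]\<^bsub>A\<^esub> n) = q (j c)" by (simp add: \<psi>_def)
    also have "\<dots> = 0" using c jH q_H by blast
    finally have "x [^]\<^bsub>A\<^esub> n \<in> H"
      using H_q A.subgroup_int_pow_closed[OF K x(1)] by blast
    then have xH: "x \<in> H" using pure[OF Kc[OF x(1)] n] by blast
    then show "e \<in> (\<lambda>c. \<psi> (j c)) ` carrier C"
      using \<psi>H[OF xH] rc[OF xH] x by blast
  qed
  then have "direct_summand ((\<lambda>c. \<psi> (j c)) ` carrier C) E0"
    using cot E jE unfolding cotorsion_def by blast
  then obtain \<rho> where \<rho>: "\<rho> \<in> hom E0 C" "\<And>c. c \<in> carrier C \<Longrightarrow> \<rho> (\<psi> (j c)) = c"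
    using direct_summand_imp_retraction[OF E Cg jE] by metis
  show thesis
  proof
    show "subgroup K A" by (rule K)
    show "H \<subseteq> K" by (rule HK)
    show "a \<in> K" by (rule aK)
    show "x \<in> K" if "x \<in> carrier A" "n \<noteq> 0" "x [^]\<^bsub>A\<^esub> n \<in> K" for x and n :: int
      using pureK that by blast
    show "\<rho> \<circ> \<psi> \<in> hom (A\<lparr>carrier := K\<rparr>) C"
      using hom_compose[OF \<psi>_hom \<rho>(1)] .
    show "(\<rho> \<circ> \<psi>) x = r x" if "x \<in> H" for x
      using \<psi>H[OF that] \<rho>(2)[OF rc[OF that]] by simp
  qed
qed

theorem cotorsion_direct_summand:
  assumes cot: "cotorsion C" and A: "comm_group A" and j: "j \<in> mon C A"
    and tf: "torsion_free (A Mod (j ` carrier C))"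
  shows "direct_summand (j ` carrier C) A"
proof -
  interpret A: comm_group A by fact
  have Cg: "comm_group C" using cot by (simp add: cotorsion_def)
  interpret C: comm_group C by fact
  interpret jh: group_hom C A j
    using j by unfold_locales (simp add: mon_def)
  have jinj: "inj_on j (carrier C)" using j by (simp add: mon_def)
  have jS: "subgroup (j ` carrier C) A" by (rule mon_image_subgroup[OF A Cg j])
  define good where "good S \<longleftrightarrow>
      S \<subseteq> carrier A \<times> carrier C \<and>
      (\<forall>c\<in>carrier C. (j c, c) \<in> S) \<and>
      (\<forall>x c d. (x, c) \<in> S \<longrightarrow> (x, d) \<in> S \<longrightarrow> c = d) \<and>
      (\<forall>x c y d. (x, c) \<in> S \<longrightarrow> (y, d) \<in> S \<longrightarrow> (x \<otimes>\<^bsub>A\<^esub> y, c \<otimes>\<^bsub>C\<^esub> d) \<in> S) \<and>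
      (\<forall>x c. (x, c) \<in> S \<longrightarrow> inv\<^bsub>A\<^esub> x \<in> Domain S) \<and>
      (\<forall>x\<in>carrier A. \<forall>n::int. n \<noteq> 0 \<longrightarrow> x [^]\<^bsub>A\<^esub> n \<in> Domain S \<longrightarrow> x \<in> Domain S)" for S
  have "\<exists>S\<in>Collect good. \<forall>T\<in>Collect good. S \<subseteq> T \<longrightarrow> T = S"
  proof (rule subset_Zorn_nonempty)
    let ?S = "(\<lambda>c. (j c, c)) ` carrier C"
    have dom: "Domain ?S = j ` carrier C" by force
    have "good ?S"
      unfolding good_def dom
    proof (intro conjI)
      show "\<forall>x c d. (x, c) \<in> ?S \<longrightarrow> (x, d) \<in> ?S \<longrightarrow> c = d"
        using jinj by (auto dest: inj_onD)
      show "\<forall>x c y d. (x, c) \<in> ?S \<longrightarrow> (y, d) \<in> ?S \<longrightarrow> (x \<otimes>\<^bsub>A\<^esub> y, c \<otimes>\<^bsub>C\<^esub> d) \<in> ?S"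
        by (auto simp: image_iff)
      show "\<forall>x c. (x, c) \<in> ?S \<longrightarrow> inv\<^bsub>A\<^esub> x \<in> j ` carrier C"
        using subgroup.m_inv_closed[OF jS] by auto
      show "\<forall>x\<in>carrier A. \<forall>n::int. n \<noteq> 0 \<longrightarrow> x [^]\<^bsub>A\<^esub> n \<in> j ` carrier C \<longrightarrow> x \<in> j ` carrier C"
        using tf torsion_free_Mod_iff[OF A jS] by blast
    qed auto
    then show "Collect good \<noteq> {}" by blast
  next
    fix \<C> assume ne: "\<C> \<noteq> {}" and ch: "subset.chain (Collect good) \<C>"
    have g: "good S" if "S \<in> \<C>" for S using ch that by (auto simp: subset_chain_def)
    have two: "\<exists>S\<in>\<C>. u \<in> S \<and> v \<in> S" if "u \<in> \<Union>\<C>" "v \<in> \<Union>\<C>" for u v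
      using that ch unfolding subset_chain_def by blast
    have "good (\<Union>\<C>)"
      unfolding good_def
    proof (intro conjI)
      show "\<Union>\<C> \<subseteq> carrier A \<times> carrier C"
        using g unfolding good_def by blast
      show "\<forall>c\<in>carrier C. (j c, c) \<in> \<Union>\<C>"
        using g ne unfolding good_def by blast
      show "\<forall>x c d. (x, c) \<in> \<Union>\<C> \<longrightarrow> (x, d) \<in> \<Union>\<C> \<longrightarrow> c = d"
      proof (intro allI impI)
        fix x c d assume "(x, c) \<in> \<Union>\<C>" "(x, d) \<in> \<Union>\<C>"
        then obtain S where S: "S \<in> \<C>" "(x, c) \<in> S" "(x, d) \<in> S" using two by blast
        then show "c = d" using g[OF S(1)] unfolding good_def by blast
      qed
      show "\<forall>x c y d. (x, c) \<in> \<Union>\<C> \<longrightarrow> (y, d) \<in> \<Union>\<C> \<longrightarrow> (x \<otimes>\<^bsub>A\<^esub> y, c \<otimes>\<^bsub>C\<^esub> d) \<in> \<Union>\<C>"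
      proof (intro allI impI)
        fix x c y d assume "(x, c) \<in> \<Union>\<C>" "(y, d) \<in> \<Union>\<C>"
        then obtain S where S: "S \<in> \<C>" "(x, c) \<in> S" "(y, d) \<in> S" using two by blast
        then have "(x \<otimes>\<^bsub>A\<^esub> y, c \<otimes>\<^bsub>C\<^esub> d) \<in> S" using g[OF S(1)] by (simp add: good_def)
        then show "(x \<otimes>\<^bsub>A\<^esub> y, c \<otimes>\<^bsub>C\<^esub> d) \<in> \<Union>\<C>" using S(1) by blast
      qed
      show "\<forall>x c. (x, c) \<in> \<Union>\<C> \<longrightarrow> inv\<^bsub>A\<^esub> x \<in> Domain (\<Union>\<C>)"
      proof (intro allI impI)
        fix x c assume "(x, c) \<in> \<Union>\<C>"
        then obtain S where S: "S \<in> \<C>" "(x, c) \<in> S" by blast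
        then have "inv\<^bsub>A\<^esub> x \<in> Domain S" using g[OF S(1)] unfolding good_def by blast
        then show "inv\<^bsub>A\<^esub> x \<in> Domain (\<Union>\<C>)" using S(1) by blast
      qed
      show "\<forall>x\<in>carrier A. \<forall>n::int. n \<noteq> 0 \<longrightarrow> x [^]\<^bsub>A\<^esub> n \<in> Domain (\<Union>\<C>) \<longrightarrow> x \<in> Domain (\<Union>\<C>)"
      proof (intro ballI allI impI)
        fix x and n :: int
        assume x: "x \<in> carrier A" "n \<noteq> 0" "x [^]\<^bsub>A\<^esub> n \<in> Domain (\<Union>\<C>)"
        then obtain S where S: "S \<in> \<C>" "x [^]\<^bsub>A\<^esub> n \<in> Domain S" by blast
        then have "x \<in> Domain S" using g[OF S(1)] x by (simp add: good_def)
        then show "x \<in> Domain (\<Union>\<C>)" using S(1) by blast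
      qed
    qed
    then show "\<Union>\<C> \<in> Collect good" by simp
  qed
  then obtain S where S: "good S" and max: "\<And>T. \<lbrakk>good T; S \<subseteq> T\<rbrakk> \<Longrightarrow> T = S"
    by auto
  let ?H = "Domain S"
  have Sc: "x \<in> carrier A" "c \<in> carrier C" if "(x, c) \<in> S" for x c
    using S that by (auto simp: good_def)
  have Sj: "(j c, c) \<in> S" if "c \<in> carrier C" for c
    using S that by (simp add: good_def)
  have Su: "c = d" if "(x, c) \<in> S" "(x, d) \<in> S" for x c d
    using S that unfolding good_def by blast
  have Sm: "(x \<otimes>\<^bsub>A\<^esub> y, c \<otimes>\<^bsub>C\<^esub> d) \<in> S" if "(x, c) \<in> S" "(y, d) \<in> S" for x c y d
    using S that unfolding good_def by blast
  have Si: "inv\<^bsub>A\<^esub> x \<in> ?H" if "x \<in> ?H" for x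
    using S that unfolding good_def by blast
  have Sp: "x \<in> ?H" if "x \<in> carrier A" "n \<noteq> 0" "x [^]\<^bsub>A\<^esub> n \<in> ?H" for x and n :: int
    using S that unfolding good_def by blast
  define r where "r x = (THE c. (x, c) \<in> S)" for x
  have r_eq: "r x = c" if "(x, c) \<in> S" for x c
    unfolding r_def using that Su by blast
  have H: "subgroup ?H A"
  proof (rule A.subgroupI)
    show "?H \<subseteq> carrier A" using Sc by auto
    show "?H \<noteq> {}" using Sj[OF C.one_closed] by blast
    show "inv\<^bsub>A\<^esub> x \<in> ?H" if "x \<in> ?H" for x by (rule Si[OF that])
    show "x \<otimes>\<^bsub>A\<^esub> y \<in> ?H" if "x \<in> ?H" "y \<in> ?H" for x y using that Sm by blast
  qed
  have r_hom: "r \<in> hom (A\<lparr>carrier := ?H\<rparr>) C"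
  proof (rule homI)
    show "r x \<in> carrier C" if "x \<in> carrier (A\<lparr>carrier := ?H\<rparr>)" for x
      using that r_eq Sc by auto
    show "r (x \<otimes>\<^bsub>A\<lparr>carrier := ?H\<rparr>\<^esub> y) = r x \<otimes>\<^bsub>C\<^esub> r y"
      if xy: "x \<in> carrier (A\<lparr>carrier := ?H\<rparr>)" "y \<in> carrier (A\<lparr>carrier := ?H\<rparr>)" for x y
    proof -
      obtain c d where "(x, c) \<in> S" "(y, d) \<in> S" using xy by auto
      then show ?thesis using r_eq Sm by simp
    qed
  qed
  have r_j: "r (j c) = c" if "c \<in> carrier C" for c
    by (rule r_eq[OF Sj[OF that]])
  have "carrier A \<subseteq> ?H"
  proof (rule ccontr)
    assume "\<not> carrier A \<subseteq> ?H"
    then obtain a where a: "a \<in> carrier A" "a \<notin> ?H" by blast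
    have jH: "j ` carrier C \<subseteq> ?H" using Sj by blast
    show False
    proof (rule cotorsion_extend_retraction[OF A cot j H jH _ r_hom _ a])
      show "x \<in> ?H" if "x \<in> carrier A" "n \<noteq> 0" "x [^]\<^bsub>A\<^esub> n \<in> ?H" for x and n :: int
        by (rule Sp[OF that])
      show "r (j c) = c" if "c \<in> carrier C" for c by (rule r_j[OF that])
    next
      fix K r'
      assume K: "subgroup K A" and HK: "?H \<subseteq> K" and aK: "a \<in> K"
        and pK: "\<And>x n::int. \<lbrakk>x \<in> carrier A; n \<noteq> 0; x [^]\<^bsub>A\<^esub> n \<in> K\<rbrakk> \<Longrightarrow> x \<in> K"
        and r': "r' \<in> hom (A\<lparr>carrier := K\<rparr>) C" and r'H: "\<And>x. x \<in> ?H \<Longrightarrow> r' x = r x"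
      let ?T = "(\<lambda>x. (x, r' x)) ` K"
      have dom: "Domain ?T = K" by force
      have ST: "S \<subseteq> ?T"
      proof (rule subrelI)
        fix x c assume xc: "(x, c) \<in> S"
        then have "x \<in> K" "r' x = c" using HK r'H r_eq by auto
        then show "(x, c) \<in> ?T" by blast
      qed
      have "good ?T"
        unfolding good_def dom
      proof (intro conjI)
        show "?T \<subseteq> carrier A \<times> carrier C"
          using r' subgroup.subset[OF K] by (auto simp: hom_def)
        show "\<forall>c\<in>carrier C. (j c, c) \<in> ?T" using Sj ST by blast
        show "\<forall>x c y d. (x, c) \<in> ?T \<longrightarrow> (y, d) \<in> ?T \<longrightarrow> (x \<otimes>\<^bsub>A\<^esub> y, c \<otimes>\<^bsub>C\<^esub> d) \<in> ?T"
          using r' subgroup.m_closed[OF K] by (auto simp: hom_def image_iff)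
        show "\<forall>x c. (x, c) \<in> ?T \<longrightarrow> inv\<^bsub>A\<^esub> x \<in> K"
          using subgroup.m_inv_closed[OF K] by auto
        show "\<forall>x\<in>carrier A. \<forall>n::int. n \<noteq> 0 \<longrightarrow> x [^]\<^bsub>A\<^esub> n \<in> K \<longrightarrow> x \<in> K"
          using pK by blast
      qed auto
      then have "?T = S" using max ST by blast
      then show False using aK a(2) dom by metis
    qed
  qed
  then have HA: "?H = carrier A" using subgroup.subset[OF H] by blast
  have "r \<in> hom A C" using r_hom HA by simp
  then show ?thesis using retraction_imp_direct_summand[OF A Cg j] r_j by blast
qed

end

theory Submission
  imports Defs
begin

text \<open>
  The argument takes place in abelian groups. Let \<open>G\<close> be the additive group of \<open>B/Z(B)\<close> and \<open>h = \<pi>f\<close>. Call an additive map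
  \<open>L\<close> from integer sequences to \<open>G\<close> a limit homomorphism (\<^verbatim>\<open>limit_hom\<close>) if it kills all finitely
  supported sequences; it is interesting when \<open>L(1,1,1,\<dots>) \<noteq> 0\<close>. Everything is reduced to such
  maps.

  A limit homomorphism comes from a failure of countable completeness. Among the finite sets of
  ultrafilters that determine the values of \<open>h\<close>, choose one of least cardinality. If its members were
  all countably complete, \<open>h\<close> would factor through the product of the corresponding ultraproducts,
  because finitely many distinct ultrafilters can be separated by disjoint sets and so the direct
  product maps onto that product (\<^verbatim>\<open>factors_through_ultraproducts_iff\<close>). Hence some member
  \<open>F\<close> is not countably complete. By minimality there is \<open>z\<close> with \<open>h(z) \<noteq> 0\<close> that vanishes modulo every
  other member. Since \<open>F\<close> is not countably complete, the index set is, up to a null set, a countable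
  disjoint union of null sets; multiply \<open>z\<close> by the integer \<open>a\<^sub>n\<close> on the \<open>n\<close>th of them and apply \<open>h\<close>. The
  result \<open>L(a)\<close> is additive in \<open>a\<close>, is zero for finitely supported \<open>a\<close>, and \<open>L(1,1,\<dots>) = h(z)\<close>
  (\<^verbatim>\<open>limit_hom_if_not_countably_complete\<close>).

  A limit homomorphism with \<open>L(1,1,\<dots>) \<noteq> 0\<close> forces torsion, a copy of \<open>\<rat>\<close>, or a copy of some
  \<open>\<int>\<^sub>p\<close> (\<^verbatim>\<open>torsion_rat_or_padic\<close>). Indeed, if \<open>G\<close> is torsion-free without a copy of \<open>\<rat>\<close>, then \<open>0\<close>
  is its only element divisible by all positive integers, so \<open>L\<close> kills every sequence whose terms are,
  for each positive integer \<open>m\<close>, divisible by \<open>m\<close> from some point on. A \<open>p\<close>-adic integer given by its residues can therefore be fed to \<open>L\<close>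
  after correction by multipliers that are \<open>1\<close> modulo powers of \<open>p\<close> and highly divisible by all
  other primes: the carries in the addition of residues disappear, and one gets an embedding of
  \<open>\<int>\<^sub>p\<close>.

  The same notion gives the equivalence of the two descriptions in the conclusion. The eventually
  constant sequences are a pure subgroup of all integer sequences, so for every element \<open>x\<close> of a
  cotorsion group the map ``eventual value times \<open>x\<close>'' extends to all sequences, which is a limit
  homomorphism with \<open>L(1,1,\<dots>) = x\<close> (\<^verbatim>\<open>cotorsion_limit_hom\<close>). Conversely, the elements killed by a
  prime, the group \<open>\<rat>\<close> and the groups \<open>\<int>\<^sub>p\<close> are cotorsion: the first and the last are \<open>p\<close>-adically
  complete (\<^verbatim>\<open>cotorsion_padically_complete\<close>), the second is divisible.

  Finally, a nonprincipal countably complete ultrafilter on \<open>I\<close> yields an uncountable measurable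
  cardinal that is at most the cardinal of \<open>I\<close>
  (\<^verbatim>\<open>uncountable_measurable_if_nonprincipal\<close>). Below all such cardinals only principal
  ultrafilters are countably complete, and their ultraproducts are the factors of the direct product.
\<close>

section \<open>Divisibility in torsion-free abelian groups\<close>

lemma torsion_free_int_pow:
  assumes "group G" "torsion_free G" "x \<in> carrier G" "n \<noteq> 0" "x [^]\<^bsub>G\<^esub> (n::int) = \<one>\<^bsub>G\<^esub>"
  shows "x = \<one>\<^bsub>G\<^esub>"
proof -
  interpret group G by fact
  have "x [^]\<^bsub>G\<^esub> (int (nat \<bar>n\<bar>)) = \<one>\<^bsub>G\<^esub>"
    using assms int_pow_neg[OF assms(3), of n] by (auto simp: abs_if)
  then have "x [^]\<^bsub>G\<^esub> nat \<bar>n\<bar> = \<one>\<^bsub>G\<^esub>"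
    by (simp only: int_pow_int)
  then show ?thesis
    using assms unfolding torsion_free_def by (meson zero_less_abs_iff zero_less_nat_eq)
qed

lemma torsion_free_int_pow_cancel:
  assumes "comm_group G" "torsion_free G" "x \<in> carrier G" "y \<in> carrier G" "n \<noteq> 0"
    and "x [^]\<^bsub>G\<^esub> (n::int) = y [^]\<^bsub>G\<^esub> n"
  shows "x = y"
proof -
  interpret comm_group G by fact
  have "(x \<otimes>\<^bsub>G\<^esub> inv\<^bsub>G\<^esub> y) [^]\<^bsub>G\<^esub> n = \<one>\<^bsub>G\<^esub>"
    using assms by (simp add: int_pow_distrib int_pow_inv)
  then have "x \<otimes>\<^bsub>G\<^esub> inv\<^bsub>G\<^esub> y = \<one>\<^bsub>G\<^esub>"
    using torsion_free_int_pow[OF is_group assms(2)] assms by blast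
  then show ?thesis using assms(3,4) inv_solve_right' l_one one_closed by metis
qed

text \<open>
  In a torsion-free group roots are unique when they exist. So \<^term>\<open>q = a / b\<close> can be sent to the
  only element whose \<^term>\<open>b\<close>th power is the \<^term>\<open>a\<close>th power of \<^term>\<open>x\<close>.
\<close>

lemma mon_rat_group_if_divisible:
  assumes G: "comm_group G" and tf: "torsion_free G"
    and x: "x \<in> carrier G" "x \<noteq> \<one>\<^bsub>G\<^esub>"
    and div: "\<And>m::nat. 0 < m \<Longrightarrow> \<exists>y\<in>carrier G. x = y [^]\<^bsub>G\<^esub> m"
  shows "\<exists>h. h \<in> mon rat_group G"
proof -
  interpret comm_group G by fact
  define P where "P q y \<longleftrightarrow> y \<in> carrier G \<and>
    (\<exists>a b::int. b \<noteq> 0 \<and> q = of_int a / of_int b \<and> y [^]\<^bsub>G\<^esub> b = x [^]\<^bsub>G\<^esub> a)" for q :: rat and y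
  have uniq: "y = z" if yz: "P q y" "P q z" for q y z
  proof -
    obtain a b c d where ab: "b \<noteq> 0" "q = of_int a / of_int b" "y [^]\<^bsub>G\<^esub> b = x [^]\<^bsub>G\<^esub> a"
      and cd: "d \<noteq> 0" "q = of_int c / of_int d" "z [^]\<^bsub>G\<^esub> d = x [^]\<^bsub>G\<^esub> c"
      and yz: "y \<in> carrier G" "z \<in> carrier G"
      using yz unfolding P_def by blast
    have "of_int a * (of_int d :: rat) = of_int c * of_int b"
      using ab cd by (simp add: frac_eq_eq)
    then have e: "a * d = c * b" by (metis of_int_eq_iff of_int_mult)
    have "y [^]\<^bsub>G\<^esub> (b * d) = x [^]\<^bsub>G\<^esub> (a * d)"
      using ab(3) x yz by (simp flip: int_pow_pow)
    also have "\<dots> = z [^]\<^bsub>G\<^esub> (d * b)"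
      unfolding e using cd(3) x yz by (simp flip: int_pow_pow)
    finally show ?thesis
      using torsion_free_int_pow_cancel[OF G tf yz, of "b * d"] ab(1) cd(1)
      by (simp add: mult.commute)
  qed
  have add: "P (q + r) (y \<otimes>\<^bsub>G\<^esub> z)" if yz: "P q y" "P r z" for q r y z
  proof -
    obtain a b c d where ab: "b \<noteq> 0" "q = of_int a / of_int b" "y [^]\<^bsub>G\<^esub> b = x [^]\<^bsub>G\<^esub> a"
      and cd: "d \<noteq> 0" "r = of_int c / of_int d" "z [^]\<^bsub>G\<^esub> d = x [^]\<^bsub>G\<^esub> c"
      and yz: "y \<in> carrier G" "z \<in> carrier G"
      using yz unfolding P_def by blast
    have "(y \<otimes>\<^bsub>G\<^esub> z) [^]\<^bsub>G\<^esub> (b * d) = y [^]\<^bsub>G\<^esub> (b * d) \<otimes>\<^bsub>G\<^esub> z [^]\<^bsub>G\<^esub> (d * b)"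
      using yz by (simp add: int_pow_distrib mult.commute)
    also have "\<dots> = x [^]\<^bsub>G\<^esub> (a * d) \<otimes>\<^bsub>G\<^esub> x [^]\<^bsub>G\<^esub> (c * b)"
      using ab(3) cd(3) x yz by (simp flip: int_pow_pow)
    also have "\<dots> = x [^]\<^bsub>G\<^esub> (a * d + c * b)"
      using x by (simp add: int_pow_mult)
    finally show ?thesis
      unfolding P_def using yz ab cd
      by (intro conjI exI[of _ "a * d + c * b"] exI[of _ "b * d"])
        (auto simp: add_frac_eq mult.commute)
  qed
  have ex: "\<exists>y. P q y" for q
  proof -
    obtain a b :: int where ab: "q = of_int a / of_int b" "b > 0"
      using quotient_of_div[of q] quotient_of_denom_pos[of q] by (metis surj_pair)
    obtain z where z: "z \<in> carrier G" "x = z [^]\<^bsub>G\<^esub> nat b"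
      using div[of "nat b"] ab by auto
    have zb: "x = z [^]\<^bsub>G\<^esub> b" using z ab(2) int_pow_int[of G z "nat b"] by simp
    have "(z [^]\<^bsub>G\<^esub> a) [^]\<^bsub>G\<^esub> b = x [^]\<^bsub>G\<^esub> a"
      using z(1) by (simp add: zb int_pow_pow mult.commute)
    then show ?thesis unfolding P_def using ab z(1) by (metis int_pow_closed less_irrefl)
  qed
  define h where "h q = (THE y. P q y)" for q
  have h: "P q (h q)" for q
    unfolding h_def using ex[of q] uniq by (metis theI)
  have hadd: "h (q + r) = h q \<otimes>\<^bsub>G\<^esub> h r" for q r
    using uniq[OF h add[OF h h]] .
  have hc: "h q \<in> carrier G" for q using h[of q] by (simp add: P_def)
  have ker: "q = 0" if hq: "h q = \<one>\<^bsub>G\<^esub>" for q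
  proof -
    obtain a b where ab: "b \<noteq> 0" "q = of_int a / of_int b" "\<one>\<^bsub>G\<^esub> = x [^]\<^bsub>G\<^esub> (a::int)"
      using h[of q] unfolding hq by (auto simp: P_def)
    have "a = 0" using torsion_free_int_pow[OF is_group tf x(1) _ ab(3)[symmetric]] x(2) by blast
    then show ?thesis using ab by simp
  qed
  have "h q = h r \<Longrightarrow> q = r" for q r
    using hadd[of "q - r" r] ker[of "q - r"] hc by (simp add: r_cancel_one')
  then have "h \<in> mon rat_group G"
    by (auto simp: mon_def hom_def rat_group_def hadd hc inj_on_def)
  then show ?thesis by blast
qed

text \<open>
  Roots of coprime orders \<^term>\<open>k\<close> and \<^term>\<open>m\<close> combine, by a Bezout relation, to a root of order
  \<^term>\<open>k * m\<close>. A least order for which no root exists is therefore a prime power.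
\<close>

lemma (in comm_group) non_divisible_prime_power:
  assumes x: "x \<in> carrier G" and "0 < m" "\<nexists>y. y \<in> carrier G \<and> x = y [^] (m::nat)"
  shows "\<exists>p l. prime (p::nat) \<and> (\<nexists>y. y \<in> carrier G \<and> x = y [^] (p ^ l))"
proof -
  define D where "D m \<longleftrightarrow> (\<exists>y. y \<in> carrier G \<and> x = y [^] m)" for m :: nat
  have "\<exists>m. 0 < m \<and> \<not> D m" using assms by (auto simp: D_def)
  then obtain m where m: "0 < m" "\<not> D m" and least: "\<And>k. 0 < k \<Longrightarrow> k < m \<Longrightarrow> D k"
    using exists_least_iff[of "\<lambda>m. 0 < m \<and> \<not> D m"] by auto
  have "m \<noteq> 1" using m x by (auto simp: D_def intro!: exI[of _ x])
  then obtain p where p: "prime p" "p dvd m" using prime_factor_nat by blast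
  have "m \<noteq> 0" "\<not> is_unit p" using m(1) p(1) not_prime_unit by auto
  then obtain m' where m': "m = p ^ multiplicity p m * m'" "\<not> p dvd m'"
    using multiplicity_decompose' by blast
  define l where "l = multiplicity p m"
  have l: "0 < l" using p m by (simp add: l_def prime_multiplicity_gt_zero_iff)
  have "m' > 0" using m'(2) by (cases m') auto
  have pl: "p ^ l > 1" using one_less_power[OF prime_gt_1_nat[OF p(1)] l] .
  have "\<not> D (p ^ l)"
  proof
    assume "D (p ^ l)"
    then obtain y where y: "y \<in> carrier G" "x = y [^] (p ^ l)" by (auto simp: D_def)
    have "1 * m' < p ^ l * m'" using pl \<open>m' > 0\<close> by (intro mult_strict_right_mono) auto
    then have "m' < m" using m'(1) unfolding l_def by simp
    then obtain z where z: "z \<in> carrier G" "x = z [^] m'" using least \<open>m' > 0\<close> by (auto simp: D_def)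
    have "coprime (int (p ^ l)) (int m')"
      using prime_imp_coprime[OF p(1) m'(2)] by simp
    then obtain u v where uv: "u * int (p ^ l) + v * int m' = 1"
      using bezout_int[of "int (p ^ l)" "int m'"] by (auto simp: coprime_iff_gcd_eq_1)
    have xy: "x = y [^] int (p ^ l)" and xz: "x = z [^] int m'"
      using y z by (simp_all only: int_pow_int)
    have "x = x [^] (u * int (p ^ l) + v * int m')" using uv x by simp
    also have "\<dots> = x [^] (u * int (p ^ l)) \<otimes> x [^] (v * int m')"
      using x by (simp only: int_pow_mult)
    also have "x [^] (u * int (p ^ l)) = (z [^] u) [^] (int (p ^ l) * int m')"
      unfolding xz using z(1) by (simp only: int_pow_pow int_pow_closed mult_ac)
    also have "x [^] (v * int m') = (y [^] v) [^] (int (p ^ l) * int m')"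
      unfolding xy using y(1) by (simp only: int_pow_pow int_pow_closed mult_ac)
    also have "(z [^] u) [^] (int (p ^ l) * int m') \<otimes> (y [^] v) [^] (int (p ^ l) * int m')
        = (z [^] u \<otimes> y [^] v) [^] (int (p ^ l) * int m')"
      using y(1) z(1) by (simp only: int_pow_distrib int_pow_closed)
    also have "int (p ^ l) * int m' = int m" using m' l_def by (metis of_nat_mult)
    finally have "x = (z [^] u \<otimes> y [^] v) [^] m" by (simp only: int_pow_int)
    moreover have "z [^] u \<otimes> y [^] v \<in> carrier G" using y(1) z(1) by simp
    ultimately show False using m(2) unfolding D_def by blast
  qed
  then show ?thesis using p(1) by (auto simp: D_def)
qed

section \<open>Homomorphisms that vanish on finitely supported sequences\<close>

definition int_seq_group :: "(nat \<Rightarrow> int) monoid" where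
  "int_seq_group = \<lparr>carrier = UNIV, monoid.mult = (\<lambda>a b n. a n + b n), one = (\<lambda>_. 0)\<rparr>"

lemma comm_group_int_seq_group: "comm_group int_seq_group"
proof (rule comm_groupI)
  fix a :: "nat \<Rightarrow> int"
  show "\<exists>b\<in>carrier int_seq_group. b \<otimes>\<^bsub>int_seq_group\<^esub> a = \<one>\<^bsub>int_seq_group\<^esub>"
    by (rule bexI[of _ "\<lambda>n. - a n"]) (auto simp: int_seq_group_def)
qed (auto simp: int_seq_group_def)

lemma int_seq_group_simps [simp]:
  "carrier int_seq_group = UNIV" "\<one>\<^bsub>int_seq_group\<^esub> = (\<lambda>_. 0)"
  "a \<otimes>\<^bsub>int_seq_group\<^esub> b = (\<lambda>n. a n + b n)"
  by (auto simp: int_seq_group_def)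

lemma int_seq_group_nat_pow: "a [^]\<^bsub>int_seq_group\<^esub> (m::nat) = (\<lambda>n. int m * a n)"
  by (induction m) (auto simp: algebra_simps nat_pow_def)

lemma int_seq_group_inv: "inv\<^bsub>int_seq_group\<^esub> a = (\<lambda>n. - a n)"
  by (rule group.inv_equality[OF comm_group.axioms(2)[OF comm_group_int_seq_group]]) auto

lemma int_seq_group_int_pow: "a [^]\<^bsub>int_seq_group\<^esub> (m::int) = (\<lambda>n. m * a n)"
  by (cases "m < 0") (auto simp: int_pow_def2 int_seq_group_nat_pow int_seq_group_inv)

text \<open>
  Additive maps on integer sequences that depend only on the germ of a sequence at infinity, that is,
  homomorphisms from the group of sequences modulo its subgroup of finitely supported ones.
\<close>

locale limit_hom = comm_group G for G (structure) +
  fixes L :: "(nat \<Rightarrow> int) \<Rightarrow> 'a"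
  assumes hom: "L \<in> hom int_seq_group G"
    and vanish: "(\<forall>\<^sub>F n in sequentially. a n = 0) \<Longrightarrow> L a = \<one>"
begin

sublocale L: group_hom int_seq_group G L
  using hom comm_group_int_seq_group
  by (simp add: group_hom_def group_hom_axioms_def comm_group_def is_group)

lemma closed [simp]: "L a \<in> carrier G"
  using L.hom_closed by simp

lemma add: "L (\<lambda>n. a n + b n) = L a \<otimes> L b"
  using L.hom_mult[of a b] by simp

lemma nat_pow: "L (\<lambda>n. int m * a n) = L a [^] m"
  using L.hom_nat_pow[of a m] by (simp add: int_seq_group_nat_pow)

lemma int_pow: "L (\<lambda>n. m * a n) = L a [^] m"
  using L.hom_int_pow[of a m] by (simp add: int_seq_group_int_pow)

lemma cong:
  assumes "\<forall>\<^sub>F n in sequentially. a n = b n"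
  shows "L a = L b"
proof -
  have "L (\<lambda>n. b n + (a n - b n)) = L b \<otimes> L (\<lambda>n. a n - b n)"
    by (rule add)
  moreover have "L (\<lambda>n. a n - b n) = \<one>"
    using assms by (intro vanish) (auto elim: eventually_mono)
  ultimately show ?thesis by simp
qed

text \<open>
  The finitely many terms that \<^term>\<open>m\<close> does not divide cannot be seen by \<^term>\<open>L\<close>.
\<close>

lemma divisible:
  assumes "\<forall>\<^sub>F n in sequentially. int m dvd a n"
  shows "\<exists>y\<in>carrier G. L a = y [^] m"
proof -
  have "L a = L (\<lambda>n. int m * (a n div int m))"
    using assms by (intro cong) (auto elim: eventually_mono)
  then show ?thesis using nat_pow by auto
qed


lemma infinitely_divisible_eq_one:
  assumes "torsion_free G" "\<nexists>h. h \<in> mon rat_group G"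
    and "\<And>m::nat. 0 < m \<Longrightarrow> \<forall>\<^sub>F n in sequentially. int m dvd a n"
  shows "L a = \<one>"
  using mon_rat_group_if_divisible[OF comm_group_axioms assms(1) closed, of a] divisible assms(2,3)
  by blast

text \<open>
  Let \<open>e\<^sub>n\<close> be \<open>1\<close> modulo \<open>p\<^sup>n\<close> and \<open>0\<close> modulo every \<open>k \<le> n\<close> prime to \<open>p\<close>. Then the sequence
  \<open>p\<^sup>n c\<^sub>n e\<^sub>n\<close> is eventually divisible by every positive integer, whatever \<open>c\<close> is, and hence killed.
  So \<open>z \<mapsto> L(z\<^sub>n e\<^sub>n)\<close> does not see the carries \<open>p\<^sup>n\<close> that arise in adding residues and is a
  homomorphism on the \<open>p\<close>-adic integers. It is not zero: \<open>L(1,1,\<dots>) - L(e)\<close> is divisible by every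
  power of \<open>p\<close>, but \<open>L(1,1,\<dots>)\<close> is not. If it were not injective, it would kill some \<open>d\<close> that is
  \<open>p\<^sup>k\<close> times a unit. For each \<open>N\<close> some integer multiple of \<open>d\<close> agrees with \<open>p\<^sup>k\<close> modulo \<open>p\<^sup>N\<close>,
  so \<open>L(p\<^sup>k e)\<close> would be divisible by all integers, which gives \<open>L(e) = 0\<close>.
\<close>

lemma mon_padic:
  assumes tf: "torsion_free G" and noQ: "\<nexists>h. h \<in> mon rat_group G"
    and p: "prime (p::nat)" and one: "\<nexists>y. y \<in> carrier G \<and> L (\<lambda>_. 1) = y [^] (p ^ l)"
  shows "\<exists>h. h \<in> mon (padic_group p) G"
proof -
  have p0: "int p ^ n > 0" for n using prime_gt_0_nat[OF p] by simp
  define M where "M n = (\<Prod>k\<in>{k\<in>{1..n}. coprime k p}. int k)" for n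
  have "\<exists>e. int p ^ n dvd e - 1 \<and> M n dvd e" for n
  proof -
    have "coprime (int p ^ n) (M n)"
      unfolding M_def by (intro prod_coprime_right) (auto simp: coprime_commute)
    then obtain u v where uv: "u * int p ^ n + v * M n = 1"
      using bezout_int[of "int p ^ n" "M n"] by (auto simp: coprime_iff_gcd_eq_1)
    then have "v * M n - 1 = int p ^ n * (- u)" by (simp add: algebra_simps)
    then show ?thesis by (metis dvd_triv_left dvd_triv_right)
  qed
  then obtain e where e1: "\<And>n. int p ^ n dvd e n - 1" and eM: "\<And>n. M n dvd e n"
    by metis
  have e_dvd: "\<forall>\<^sub>F n in sequentially. int m dvd e n" if "0 < m" "coprime m p" for m
    using eventually_ge_at_top[of m]
  proof eventually_elim
    case (elim n)
    then have "int m dvd M n"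
      unfolding M_def using that by (intro dvd_prodI) auto
    then show ?case using eM dvd_trans by blast
  qed
  have decomp: "\<exists>j m'. m = p ^ j * m' \<and> 0 < m' \<and> coprime m' p" if "0 < m" for m
  proof -
    have "m \<noteq> 0" "\<not> is_unit p" using that p not_prime_unit by auto
    then obtain m' where m': "m = p ^ multiplicity p m * m'" "\<not> p dvd m'"
      using multiplicity_decompose' by blast
    have "0 < m'" using m'(2) by (cases m') auto
    moreover have "coprime m' p"
      using prime_imp_coprime[OF p m'(2)] by (simp add: coprime_commute)
    ultimately show ?thesis using m'(1) by (intro exI conjI)
  qed
  \<comment> \<open>the p-part of m is absorbed by c, the part prime to p by e\<close>
  have pe_dvd: "\<forall>\<^sub>F n in sequentially. int m dvd c n * e n"
    if m0: "0 < m" and c: "\<And>j. \<forall>\<^sub>F n in sequentially. int p ^ j dvd c n" for m c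
  proof -
    obtain j m' where m: "m = p ^ j * m'" "0 < m'" "coprime m' p" using decomp[OF m0] by blast
    show ?thesis
      using c[of j] e_dvd[OF m(2,3)] by eventually_elim (simp add: m mult_dvd_mono)
  qed
  have pn: "\<forall>\<^sub>F n in sequentially. int p ^ j dvd int p ^ n * c n" for j c
    using eventually_ge_at_top[of j] by eventually_elim (simp add: le_imp_power_dvd)
  define \<psi> where "\<psi> z = L (\<lambda>n. z n * e n)" for z :: "nat \<Rightarrow> int"
  have \<psi>_add: "\<psi> (\<lambda>n. (z n + w n) mod int p ^ n) = \<psi> z \<otimes> \<psi> w" for z w
  proof -
    let ?q = "\<lambda>n. int p ^ n * ((z n + w n) div int p ^ n)"
    have "\<psi> z \<otimes> \<psi> w = L (\<lambda>n. z n * e n + w n * e n)"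
      unfolding \<psi>_def by (rule add[symmetric])
    also have "\<dots> = L (\<lambda>n. (z n + w n) mod int p ^ n * e n + ?q n * e n)"
      by (intro arg_cong[of _ _ L] ext) (metis distrib_right mod_mult_div_eq)
    also have "\<dots> = \<psi> (\<lambda>n. (z n + w n) mod int p ^ n) \<otimes> L (\<lambda>n. ?q n * e n)"
      unfolding \<psi>_def by (rule add)
    also have "L (\<lambda>n. ?q n * e n) = \<one>"
      by (rule infinitely_divisible_eq_one[OF tf noQ pe_dvd[OF _ pn]])
    finally show ?thesis by (simp add: \<psi>_def)
  qed
  have Le: "L e \<noteq> \<one>"
  proof
    assume "L e = \<one>"
    then have "L (\<lambda>_. 1) = L (\<lambda>n. 1 - e n)"
      using add[of "\<lambda>n. 1 - e n" e] by simp
    moreover have "\<forall>\<^sub>F n in sequentially. int (p ^ l) dvd 1 - e n"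
      using eventually_ge_at_top[of l]
    proof eventually_elim
      case (elim n)
      then have "int p ^ l dvd e n - 1" using e1 le_imp_power_dvd dvd_trans by blast
      then show ?case by (simp add: dvd_diff_commute)
    qed
    ultimately show False using divisible one by metis
  qed
  let ?Z = "carrier (padic_group p)"
  have Z_dvd: "int p ^ k dvd z n - z k" if "z \<in> ?Z" "k \<le> n" for z k n
    using that(2)
  proof (induction rule: dec_induct)
    case (step n)
    have "z (Suc n) mod int p ^ n = z n" using that(1) by (simp add: padic_group_def)
    then have "int p ^ n dvd z (Suc n) - z n" by (metis dvd_minus_mod)
    then have "int p ^ k dvd z (Suc n) - z n"
      using step(1) le_imp_power_dvd dvd_trans by blast
    from dvd_add[OF this step.IH] show ?case by simp
  qed simp
  have "z = w" if z: "z \<in> ?Z" and w: "w \<in> ?Z" and eq: "\<psi> z = \<psi> w" for z w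
  proof (rule ccontr)
    assume "z \<noteq> w"
    define d where "d n = z n - w n" for n
    have d_dvd: "int p ^ k dvd d n - d k" if "k \<le> n" for k n
      using dvd_diff[OF Z_dvd[OF z that] Z_dvd[OF w that]] by (simp add: d_def algebra_simps)
    have ex_K: "\<exists>n. \<not> int p ^ n dvd d n"
    proof -
      obtain n where "z n \<noteq> w n" using \<open>z \<noteq> w\<close> by blast
      moreover have "z n \<in> {0..<int p ^ n}" "w n \<in> {0..<int p ^ n}"
        using z w by (auto simp: padic_group_def)
      ultimately have "\<not> int p ^ n dvd z n - w n"
        by (metis atLeastLessThan_iff mod_eq_dvd_iff mod_pos_pos_trivial)
      then show ?thesis by (auto simp: d_def)
    qed
    \<comment> \<open>d is p-adically p^k times a unit, where K = k + 1; note that p^0 divides everything\<close>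
    define K where "K = (LEAST n. \<not> int p ^ n dvd d n)"
    have K: "\<not> int p ^ K dvd d K"
      unfolding K_def using ex_K by (rule LeastI_ex)
    then obtain k where k: "K = Suc k" by (cases K) auto
    have "int p ^ k dvd d k"
      using not_less_Least[of k "\<lambda>n. \<not> int p ^ n dvd d n"] k K_def by auto
    have unit: "\<exists>c. int p ^ N dvd int p ^ k - c * d N" if "K \<le> N" for N
    proof -
      have "int p ^ k dvd d N"
        using dvd_add[OF d_dvd[of k N] \<open>int p ^ k dvd d k\<close>] that k by simp
      then obtain u where u: "d N = int p ^ k * u" by blast
      have "\<not> int p dvd u"
      proof
        assume "int p dvd u"
        then have "int p ^ K dvd d N" using u k by (simp add: mult.commute mult_dvd_mono)
        from dvd_diff[OF this d_dvd[OF that]] show False using K by simp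
      qed
      then have "coprime (int p ^ N) u"
        using prime_imp_coprime[of "int p" u] p by auto
      then obtain a c where ac: "a * int p ^ N + c * u = 1"
        using bezout_int[of "int p ^ N" u] by (auto simp: coprime_iff_gcd_eq_1)
      have "int p ^ k - c * d N = int p ^ k * (1 - c * u)"
        by (simp add: u algebra_simps)
      also have "1 - c * u = a * int p ^ N" using ac by simp
      also have "int p ^ k * (a * int p ^ N) = int p ^ N * (int p ^ k * a)" by (simp only: mult_ac)
      finally show ?thesis by (blast intro: dvdI)
    qed
    have \<psi>d: "L (\<lambda>n. d n * e n) = \<one>"
    proof -
      have "\<psi> z = L (\<lambda>n. d n * e n + w n * e n)"
        by (simp add: \<psi>_def d_def algebra_simps)
      also have "\<dots> = L (\<lambda>n. d n * e n) \<otimes> \<psi> w" unfolding \<psi>_def by (rule add)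
      finally show ?thesis using eq by (simp add: \<psi>_def l_cancel_one')
    qed
    have "L (\<lambda>n. int p ^ k * e n) = \<one>"
    proof (rule ccontr)
      assume ne: "L (\<lambda>n. int p ^ k * e n) \<noteq> \<one>"
      have "\<exists>y\<in>carrier G. L (\<lambda>n. int p ^ k * e n) = y [^] m" if m0: "0 < m" for m :: nat
      proof -
        obtain j m' where m: "m = p ^ j * m'" "0 < m'" "coprime m' p" using decomp[OF m0] by blast
        define N where "N = max j K"
        obtain c where c: "int p ^ N dvd int p ^ k - c * d N" using unit[of N] by (auto simp: N_def)
        have "L (\<lambda>n. int p ^ k * e n) = L (\<lambda>n. (int p ^ k - c * d n) * e n + c * (d n * e n))"
          by (intro arg_cong[of _ _ L] ext) (simp add: algebra_simps)
        also have "\<dots> = L (\<lambda>n. (int p ^ k - c * d n) * e n) \<otimes> L (\<lambda>n. c * (d n * e n))"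
          by (rule add)
        also have "L (\<lambda>n. c * (d n * e n)) = \<one>"
          unfolding int_pow \<psi>d by simp
        also have "L (\<lambda>n. (int p ^ k - c * d n) * e n) \<otimes> \<one> = L (\<lambda>n. (int p ^ k - c * d n) * e n)"
          by simp
        finally have "L (\<lambda>n. int p ^ k * e n) = L (\<lambda>n. (int p ^ k - c * d n) * e n)" .
        moreover have "\<forall>\<^sub>F n in sequentially. int m dvd (int p ^ k - c * d n) * e n"
          using e_dvd[OF m(2,3)] eventually_ge_at_top[of N]
        proof eventually_elim
          case (elim n)
          have "int p ^ N dvd (int p ^ k - c * d N) - c * (d n - d N)"
            using c d_dvd[OF elim(2)] by (simp add: dvd_diff)
          then have "int p ^ N dvd int p ^ k - c * d n" by (simp add: algebra_simps)
          then have "int p ^ j dvd int p ^ k - c * d n"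
            using le_imp_power_dvd[of j N] dvd_trans by (auto simp: N_def)
          then show ?case using elim by (simp add: m mult_dvd_mono)
        qed
        ultimately show ?thesis using divisible by metis
      qed
      then show False
        using mon_rat_group_if_divisible[OF comm_group_axioms tf closed ne] noQ by blast
    qed
    then have "L e [^] (int p ^ k) = \<one>" by (simp add: int_pow)
    then show False using torsion_free_int_pow[OF is_group tf closed, of "int p ^ k" e] p0[of k] Le by simp
  qed
  then have "\<psi> \<in> mon (padic_group p) G"
    using \<psi>_add by (auto simp: mon_def hom_def inj_on_def padic_group_def \<psi>_def)
  then show ?thesis by blast
qed

lemma torsion_rat_or_padic:
  assumes "L (\<lambda>_. 1) \<noteq> \<one>"
  shows "(\<exists>x\<in>carrier G. x \<noteq> \<one> \<and> (\<exists>n::nat. 0 < n \<and> x [^] n = \<one>)) \<or>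
    (\<exists>h. h \<in> mon rat_group G) \<or> (\<exists>p::nat. prime p \<and> (\<exists>h. h \<in> mon (padic_group p) G))"
proof (rule ccontr)
  assume neg: "\<not> ?thesis"
  then have tf: "torsion_free G" and noQ: "\<nexists>h. h \<in> mon rat_group G"
    unfolding torsion_free_def by blast+
  obtain m :: nat where "0 < m" "\<nexists>y. y \<in> carrier G \<and> L (\<lambda>_. 1) = y [^] m"
    using mon_rat_group_if_divisible[OF comm_group_axioms tf closed assms] noQ by blast
  then obtain p l where "prime (p::nat)" "\<nexists>y. y \<in> carrier G \<and> L (\<lambda>_. 1) = y [^] (p ^ l)"
    using non_divisible_prime_power[OF closed] by blast
  then show False using mon_padic[OF tf noQ] neg by blast
qed

end

text \<open>
  The pushout \<open>A\<close> of \<open>C\<close> and the group of integer sequences along the eventually constant sequences,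
  where a sequence with eventual value \<open>c\<close> is identified with \<open>x\<^sup>c\<close>, is an overgroup of \<open>C\<close>. Its
  quotient by \<open>C\<close> is the group of sequences modulo the eventually constant ones, which is torsion-free:
  if a nonzero multiple of a sequence is eventually constant, so is the sequence. A retraction of \<open>A\<close>
  onto \<open>C\<close>, restricted to sequences, is the desired map.
\<close>

lemma cotorsion_limit_hom:
  assumes cot: "cotorsion C" and x: "x \<in> carrier C"
  shows "\<exists>L. limit_hom C L \<and> L (\<lambda>_. 1) = x"
proof -
  have Cg: "comm_group C" using cot by (simp add: cotorsion_def)
  interpret C: comm_group C by fact
  interpret Z: comm_group int_seq_group by (rule comm_group_int_seq_group)
  let ?P = "C \<times>\<times> int_seq_group"
  interpret P: group ?P by (rule DirProd_group[OF C.is_group Z.is_group])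
  interpret P: comm_group ?P
    by (rule P.group_comm_groupI) (auto simp: C.m_comm add.commute)
  \<comment> \<open>the antidiagonal copy of the eventually constant sequences\<close>
  define N where "N = {(x [^]\<^bsub>C\<^esub> (- c), s) | (c::int) s. \<forall>\<^sub>F n in sequentially. s n = c}"
  have Pmult: "(a, s) \<otimes>\<^bsub>?P\<^esub> (b, t) = (a \<otimes>\<^bsub>C\<^esub> b, \<lambda>n. s n + t n)" for a b s t
    by simp
  have Pinv: "inv\<^bsub>?P\<^esub> (a, s) = (inv\<^bsub>C\<^esub> a, \<lambda>n. - s n)" if "a \<in> carrier C" for a s
    using that inv_DirProd[OF C.is_group Z.is_group, of a s] by (simp add: int_seq_group_inv)
  have pow: "(a, s) [^]\<^bsub>?P\<^esub> (m::int) = (a [^]\<^bsub>C\<^esub> m, \<lambda>n. m * s n)" if a: "a \<in> carrier C" for a s m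
  proof -
    interpret f: group_hom ?P C fst by unfold_locales (auto simp: hom_def)
    interpret g: group_hom ?P int_seq_group snd by unfold_locales (auto simp: hom_def)
    show ?thesis
      using f.hom_int_pow[of "(a, s)" m] g.hom_int_pow[of "(a, s)" m] a
      by (simp add: prod_eq_iff int_seq_group_int_pow)
  qed
  have NI: "(a, s) \<in> N" if "\<forall>\<^sub>F n in sequentially. s n = c" "a = x [^]\<^bsub>C\<^esub> (- c)" for a s c
    using that unfolding N_def by blast
  have NE: "\<exists>c. (\<forall>\<^sub>F n in sequentially. s n = c) \<and> a = x [^]\<^bsub>C\<^esub> (- c)" if "(a, s) \<in> N" for a s
    using that unfolding N_def by blast
  have N: "subgroup N ?P"
  proof (rule P.subgroupI)
    show "N \<subseteq> carrier ?P" using x by (auto simp: N_def)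
    show "N \<noteq> {}" using NI[of "\<lambda>_. 0" 0] by auto
    fix u v assume "u \<in> N" "v \<in> N"
    then obtain a b s t where uv: "u = (a, s)" "v = (b, t)" "(a, s) \<in> N" "(b, t) \<in> N"
      by (metis surj_pair)
    obtain c where c: "\<forall>\<^sub>F n in sequentially. s n = c" "a = x [^]\<^bsub>C\<^esub> (- c)" using NE uv by blast
    obtain d where d: "\<forall>\<^sub>F n in sequentially. t n = d" "b = x [^]\<^bsub>C\<^esub> (- d)" using NE uv by blast
    have "(inv\<^bsub>C\<^esub> a, \<lambda>n. - s n) \<in> N"
    proof (rule NI)
      show "\<forall>\<^sub>F n in sequentially. - s n = - c" using c(1) by eventually_elim simp
    qed (use c x in \<open>simp add: C.int_pow_neg\<close>)
    then show "inv\<^bsub>?P\<^esub> u \<in> N" using Pinv c x by (simp add: uv)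
    have "(a \<otimes>\<^bsub>C\<^esub> b, \<lambda>n. s n + t n) \<in> N"
    proof (rule NI)
      show "\<forall>\<^sub>F n in sequentially. s n + t n = c + d" using c(1) d(1) by eventually_elim simp
      show "a \<otimes>\<^bsub>C\<^esub> b = x [^]\<^bsub>C\<^esub> (- (c + d))"
        using c d x C.int_pow_mult[OF x, of "- c" "- d"] by simp
    qed
    then show "u \<otimes>\<^bsub>?P\<^esub> v \<in> N" by (simp add: uv)
  qed
  interpret N: normal N ?P using P.normal_iff_subgroup N by blast
  define A where "A = ?P Mod N"
  have A: "comm_group A"
    unfolding A_def by (rule P.abelian_FactGroup[OF N])
  interpret A: comm_group A by fact
  define q where "q = (\<lambda>u. N #>\<^bsub>?P\<^esub> u)"
  have q: "q \<in> hom ?P A" unfolding q_def A_def by (rule N.r_coset_hom_Mod)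
  interpret q: group_hom ?P A q by unfold_locales (rule q)
  have q_eq: "q u = q v \<longleftrightarrow> u \<otimes>\<^bsub>?P\<^esub> inv\<^bsub>?P\<^esub> v \<in> N" if "u \<in> carrier ?P" "v \<in> carrier ?P" for u v
  proof -
    have "q u = q v \<longleftrightarrow> u \<in> N #>\<^bsub>?P\<^esub> v"
      unfolding q_def using that P.repr_independence[OF _ that(2) N] P.rcos_self[OF that(1) N] by auto
    also have "\<dots> \<longleftrightarrow> u \<otimes>\<^bsub>?P\<^esub> inv\<^bsub>?P\<^esub> v \<in> N"
      using N.rcos_module[OF P.is_group that(2,1)] .
    finally show ?thesis .
  qed
  define j where "j a = q (a, \<lambda>_. 0)" for a
  have j: "j \<in> mon C A"
    unfolding mon_def
  proof (intro CollectI conjI homI inj_onI)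
    fix a b assume ab: "a \<in> carrier C" "b \<in> carrier C"
    show "j a \<in> carrier A" using ab by (simp add: j_def)
    show "j (a \<otimes>\<^bsub>C\<^esub> b) = j a \<otimes>\<^bsub>A\<^esub> j b"
      unfolding j_def using ab by (subst q.hom_mult[symmetric]) auto
    assume "j a = j b"
    then have "(a \<otimes>\<^bsub>C\<^esub> inv\<^bsub>C\<^esub> b, \<lambda>_. 0) \<in> N"
      using q_eq[of "(a, \<lambda>_. 0)" "(b, \<lambda>_. 0)"] Pinv ab by (simp add: j_def)
    then have "a \<otimes>\<^bsub>C\<^esub> inv\<^bsub>C\<^esub> b = \<one>\<^bsub>C\<^esub>" using NE by fastforce
    then show "a = b" using ab by (metis C.inv_equality C.inv_inv C.inv_closed)
  qed
  have "torsion_free (A Mod (j ` carrier C))"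
  proof (subst torsion_free_Mod_iff[OF A mon_image_subgroup[OF A Cg j]], intro ballI allI impI)
    fix y and m :: int assume "y \<in> carrier A" and m: "m \<noteq> 0" and ym: "y [^]\<^bsub>A\<^esub> m \<in> j ` carrier C"
    then obtain u where "u \<in> carrier ?P" "y = q u"
      by (auto simp: A_def q_def FactGroup_def RCOSETS_def)
    then obtain a s where as: "a \<in> carrier C" "y = q (a, s)" by auto
    obtain b where b: "b \<in> carrier C" "y [^]\<^bsub>A\<^esub> m = q (b, \<lambda>_. 0)" using ym by (auto simp: j_def)
    have "q (a [^]\<^bsub>C\<^esub> m, \<lambda>n. m * s n) = q (b, \<lambda>_. 0)"
      using q.hom_int_pow[of "(a, s)" m] as b
      by (simp add: pow)
    then have "(a [^]\<^bsub>C\<^esub> m \<otimes>\<^bsub>C\<^esub> inv\<^bsub>C\<^esub> b, \<lambda>n. m * s n) \<in> N"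
      using q_eq[of "(a [^]\<^bsub>C\<^esub> m, \<lambda>n. m * s n)" "(b, \<lambda>_. 0)"] Pinv as b by simp
    then obtain c where c: "\<forall>\<^sub>F n in sequentially. m * s n = c" using NE by blast
    then obtain d where "\<forall>\<^sub>F n in sequentially. s n = d"
    proof -
      obtain n0 where n0: "\<And>n. n \<ge> n0 \<Longrightarrow> m * s n = c"
        using c by (auto simp: eventually_sequentially)
      have "s n = s n0" if "n \<ge> n0" for n using n0[OF that] n0[of n0] m by auto
      then show thesis using that by (auto simp: eventually_sequentially)
    qed
    then have "(x [^]\<^bsub>C\<^esub> (- d), s) \<in> N" by (rule NI) simp
    then have "q (a, s) = q (a \<otimes>\<^bsub>C\<^esub> inv\<^bsub>C\<^esub> (x [^]\<^bsub>C\<^esub> (- d)), \<lambda>_. 0)"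
      using as(1) x Pinv
      by (subst q_eq) (auto simp: C.inv_mult C.m_assoc[symmetric])
    then show "y \<in> j ` carrier C" using as x unfolding j_def by auto
  qed
  then have "direct_summand (j ` carrier C) A" by (rule cotorsion_direct_summand[OF cot A j])
  then obtain r where r: "r \<in> hom A C" "\<And>c. c \<in> carrier C \<Longrightarrow> r (j c) = c"
    using direct_summand_imp_retraction[OF A Cg j] by metis
  interpret r: group_hom A C r by unfold_locales (rule r(1))
  define L where "L s = r (q (\<one>\<^bsub>C\<^esub>, s))" for s
  have L_const: "L s = x [^]\<^bsub>C\<^esub> c" if "\<forall>\<^sub>F n in sequentially. s n = c" for s c
  proof -
    have "(x [^]\<^bsub>C\<^esub> (- c), s) \<in> N" using that by (rule NI) simp
    then have "q (\<one>\<^bsub>C\<^esub>, s) = j (x [^]\<^bsub>C\<^esub> c)"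
      unfolding j_def using x Pinv by (subst q_eq) (auto simp: C.int_pow_neg)
    then show ?thesis unfolding L_def using r(2) x by simp
  qed
  have "limit_hom C L"
  proof
    show "L \<in> hom int_seq_group C"
    proof (rule homI)
      fix s t :: "nat \<Rightarrow> int"
      show "L s \<in> carrier C" by (simp add: L_def)
      have "q (\<one>\<^bsub>C\<^esub>, \<lambda>n. s n + t n) = q (\<one>\<^bsub>C\<^esub>, s) \<otimes>\<^bsub>A\<^esub> q (\<one>\<^bsub>C\<^esub>, t)"
        by (subst q.hom_mult[symmetric]) auto
      then show "L (s \<otimes>\<^bsub>int_seq_group\<^esub> t) = L s \<otimes>\<^bsub>C\<^esub> L t" by (simp add: L_def)
    qed
    show "L s = \<one>\<^bsub>C\<^esub>" if "\<forall>\<^sub>F n in sequentially. s n = 0" for s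
      using L_const[OF that] by simp
  qed
  moreover have "L (\<lambda>_. 1) = x" using L_const[of "\<lambda>_. 1" 1] x by simp
  ultimately show ?thesis by blast
qed

section \<open>Direct complements\<close>

lemma (in comm_group) subgroup_adjoin:
  assumes K: "subgroup K G" and a: "a \<in> carrier G"
  shows "subgroup {k \<otimes> a [^] n | k n. k \<in> K \<and> n \<in> (UNIV :: int set)} G" (is "subgroup ?K G")
proof (rule subgroupI)
  interpret K: subgroup K G by fact
  show "?K \<subseteq> carrier G" using a by auto
  show "?K \<noteq> {}" using K.one_closed by blast
  fix u v assume "u \<in> ?K" "v \<in> ?K"
  then obtain k n l m where u: "k \<in> K" "u = k \<otimes> a [^] (n::int)" and v: "l \<in> K" "v = l \<otimes> a [^] (m::int)"
    by auto
  have "inv u = inv k \<otimes> a [^] (- n)" using u a by (simp add: inv_mult int_pow_neg)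
  then show "inv u \<in> ?K" using u(1) by blast
  have "u \<otimes> v = (k \<otimes> l) \<otimes> a [^] (n + m)"
    using u v a by (simp add: int_pow_mult m_ac)
  then show "u \<otimes> v \<in> ?K" using u(1) v(1) by blast
qed

text \<open>
  All complements below are obtained from this consequence of Zorn's lemma: enlarging a maximal
  \<^term>\<open>K\<close> by an element outside it produces an element of \<^term>\<open>H - P\<close>, so some multiple of
  the new element is congruent to an element of \<^term>\<open>H\<close> modulo \<^term>\<open>K\<close>.
\<close>

lemma (in comm_group) maximal_subgroup_avoiding:
  assumes K0: "subgroup K\<^sub>0 G" "K\<^sub>0 \<inter> H \<subseteq> P"
  shows "\<exists>K. subgroup K G \<and> K\<^sub>0 \<subseteq> K \<and> K \<inter> H \<subseteq> P \<and>
    (\<forall>a\<in>carrier G - K. \<exists>k\<in>K. \<exists>n::int. k \<otimes> a [^] n \<in> H - P)"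
proof -
  let ?F = "{K. subgroup K G \<and> K\<^sub>0 \<subseteq> K \<and> K \<inter> H \<subseteq> P}"
  have "\<exists>K\<in>?F. \<forall>T\<in>?F. K \<subseteq> T \<longrightarrow> T = K"
  proof (rule subset_Zorn_nonempty)
    show "?F \<noteq> {}" using K0 by blast
  next
    fix \<C> assume ne: "\<C> \<noteq> {}" and ch: "subset.chain ?F \<C>"
    have g: "subgroup S G" "K\<^sub>0 \<subseteq> S" "S \<inter> H \<subseteq> P" if "S \<in> \<C>" for S
      using ch that by (auto simp: subset_chain_def)
    have "subgroup (\<Union>\<C>) G"
    proof (rule subgroupI)
      show "\<Union>\<C> \<subseteq> carrier G" using subgroup.subset[OF g(1)] by blast
      obtain S where "S \<in> \<C>" using ne by blast
      then show "\<Union>\<C> \<noteq> {}" using subgroup.one_closed[OF g(1)] by blast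
      show "inv x \<in> \<Union>\<C>" if "x \<in> \<Union>\<C>" for x
        using that subgroup.m_inv_closed[OF g(1)] by blast
      show "x \<otimes> y \<in> \<Union>\<C>" if xy: "x \<in> \<Union>\<C>" "y \<in> \<Union>\<C>" for x y
      proof -
        obtain S where S: "S \<in> \<C>" "x \<in> S" "y \<in> S"
          using xy ch unfolding subset_chain_def by blast
        then show ?thesis using subgroup.m_closed[OF g(1)[OF S(1)]] by blast
      qed
    qed
    then show "\<Union>\<C> \<in> ?F" using g ne by blast
  qed
  then obtain K where K: "subgroup K G" "K\<^sub>0 \<subseteq> K" "K \<inter> H \<subseteq> P"
    and max: "\<And>T. \<lbrakk>subgroup T G; K\<^sub>0 \<subseteq> T; T \<inter> H \<subseteq> P; K \<subseteq> T\<rbrakk> \<Longrightarrow> T = K"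
    by auto
  show ?thesis
  proof (intro exI conjI ballI)
    fix a assume "a \<in> carrier G - K"
    then have a: "a \<in> carrier G" "a \<notin> K" by auto
    let ?T = "{k \<otimes> a [^] n | k n. k \<in> K \<and> n \<in> (UNIV :: int set)}"
    have KT: "K \<subseteq> ?T"
    proof
      fix k assume k: "k \<in> K"
      then have "k = k \<otimes> a [^] (0::int)" using subgroup.mem_carrier[OF K(1)] by simp
      then show "k \<in> ?T" using k by blast
    qed
    have "a = \<one> \<otimes> a [^] (1::int)" using a by simp
    then have "a \<in> ?T" using subgroup.one_closed[OF K(1)] by blast
    then have "\<not> ?T \<inter> H \<subseteq> P"
      using max[OF subgroup_adjoin[OF K(1) a(1)]] K(2) KT a(2) by blast
    then show "\<exists>k\<in>K. \<exists>n::int. k \<otimes> a [^] n \<in> H - P" by blast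
  qed (rule K)+
qed

text \<open>
  A maximal \<^term>\<open>K\<close> that meets \<^term>\<open>H\<close> trivially has a torsion-free quotient, because \<^term>\<open>H\<close> is
  torsion-free. If \<open>a\<^sup>n\<close> agrees with an element of \<^term>\<open>H\<close> modulo \<^term>\<open>K\<close>, then an
  \<^term>\<open>n\<close>th root of that element in \<^term>\<open>H\<close> agrees with \<^term>\<open>a\<close> modulo \<^term>\<open>K\<close>.
\<close>

lemma (in comm_group) divisible_torsion_free_complement:
  assumes H: "subgroup H G"
    and div: "\<And>h n. \<lbrakk>h \<in> H; 0 < n\<rbrakk> \<Longrightarrow> \<exists>y\<in>H. h = y [^] (n::nat)"
    and tf: "\<And>h n. \<lbrakk>h \<in> H; 0 < n; h [^] (n::nat) = \<one>\<rbrakk> \<Longrightarrow> h = \<one>"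
  shows "direct_summand H G"
proof -
  interpret H: subgroup H G by fact
  have div': "\<exists>y\<in>H. h = y [^] n" if hn: "h \<in> H" "n \<noteq> 0" for h and n :: int
  proof (cases "n > 0")
    case True
    then show ?thesis using div[OF hn(1), of "nat n"] int_pow_int[of G _ "nat n"] by auto
  next
    case False
    then obtain y where y: "y \<in> H" "inv h = y [^] nat (- n)"
      using div[of "inv h" "nat (- n)"] hn by auto
    have "h = inv (inv h)" using hn(1) by simp
    also have "\<dots> = inv (y [^] (- n))" using y False hn(2) int_pow_int[of G y "nat (- n)"] by simp
    also have "\<dots> = y [^] n" using y(1) by (simp add: int_pow_neg)
    finally show ?thesis using y(1) by blast
  qed
  have tf': "h = \<one>" if "h \<in> H" "n \<noteq> 0" "h [^] n = \<one>" for h and n :: int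
  proof -
    have "h [^] int (nat \<bar>n\<bar>) = \<one>"
      using that int_pow_neg[of h n] by (auto simp: abs_if)
    then show ?thesis using tf[of h "nat \<bar>n\<bar>"] that by (simp add: int_pow_int)
  qed
  have triv: "subgroup {\<one>} G" by (rule triv_subgroup)
  obtain K where K: "subgroup K G" "K \<inter> H \<subseteq> {\<one>}"
    and max: "\<And>a. \<lbrakk>a \<in> carrier G; a \<notin> K\<rbrakk> \<Longrightarrow> \<exists>k\<in>K. \<exists>n::int. k \<otimes> a [^] n \<in> H - {\<one>}"
    using maximal_subgroup_avoiding[OF triv, of H "{\<one>}"] by auto
  interpret K: subgroup K G by fact
  have pure: "b \<in> K" if b: "b \<in> carrier G" "n \<noteq> 0" "b [^] n \<in> K" for b and n :: int
  proof (rule ccontr)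
    assume "b \<notin> K"
    then obtain k and m :: int where km: "k \<in> K" "k \<otimes> b [^] m \<in> H" "k \<otimes> b [^] m \<noteq> \<one>"
      using max b by blast
    have "(k \<otimes> b [^] m) [^] n = k [^] n \<otimes> (b [^] n) [^] m"
      using b km by (simp add: int_pow_distrib int_pow_pow mult.commute)
    also have "\<dots> \<in> K" using b(3) km(1) subgroup_int_pow_closed[OF K(1)] by simp
    finally have "(k \<otimes> b [^] m) [^] n = \<one>"
      using K(2) subgroup_int_pow_closed[OF H km(2)] by blast
    then show False using tf' km b(2) by blast
  qed
  have split: "a \<in> H <#> K" if a: "a \<in> carrier G" for a
  proof (cases "a \<in> K")
    case True
    then have "a = \<one> \<otimes> a" by simp
    then show ?thesis using True H.one_closed unfolding set_mult_def by blast
  next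
    case False
    then obtain k and n :: int where kn: "k \<in> K" "k \<otimes> a [^] n \<in> H" "k \<otimes> a [^] n \<noteq> \<one>"
      using max a by blast
    have n: "n \<noteq> 0" using kn K(2) by auto
    obtain h where h: "h \<in> H" "k \<otimes> a [^] n = h [^] n" using div' kn n by blast
    have "(inv h \<otimes> a) [^] n = inv (h [^] n) \<otimes> a [^] n"
      using a h(1) by (simp add: int_pow_distrib int_pow_inv)
    also have "\<dots> = inv k"
      unfolding h(2)[symmetric] using a kn(1) by (simp add: inv_mult m_assoc)
    finally have pw: "(inv h \<otimes> a) [^] n \<in> K" using kn(1) by simp
    have "inv h \<otimes> a \<in> K" by (rule pure[OF _ n pw]) (use a h(1) in simp)
    moreover have "a = h \<otimes> (inv h \<otimes> a)" using a h(1) by (simp add: m_assoc[symmetric])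
    ultimately show ?thesis using h(1) unfolding set_mult_def by blast
  qed
  have "H <#> K \<subseteq> carrier G" by (auto simp: set_mult_def)
  then have "H <#> K = carrier G" using split by blast
  moreover have "H \<inter> K = {\<one>}" using K by auto
  ultimately show ?thesis using H K(1) unfolding direct_summand_def by blast
qed

text \<open>
  The case of vector spaces over the field with \<^term>\<open>p\<close> elements: modulo \<^term>\<open>p\<close>th powers, the
  image of \<^term>\<open>H\<close> has a complementary subspace, and \<^term>\<open>K\<close> is its preimage. By purity this image
  is \<^term>\<open>H\<close> modulo its own \<^term>\<open>p\<close>th powers.
\<close>

lemma (in comm_group) complement_mod_prime:
  assumes p: "prime (p::nat)" and H: "subgroup H G"
    and pure: "\<And>x. \<lbrakk>x \<in> carrier G; x [^] p \<in> H\<rbrakk> \<Longrightarrow> x \<in> H"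
  obtains K where "subgroup K G" "K \<inter> H = (\<lambda>x. x [^] p) ` H"
    "\<And>a. a \<in> carrier G \<Longrightarrow> \<exists>h\<in>H. \<exists>k\<in>K. a = h \<otimes> k"
proof -
  interpret H: subgroup H G by fact
  let ?pG = "(\<lambda>x. x [^] p) ` carrier G" and ?pH = "(\<lambda>x. x [^] p) ` H"
  interpret pw: group_hom G G "\<lambda>x. x [^] p"
    by unfold_locales (auto simp: hom_def nat_pow_distrib)
  have pG: "subgroup ?pG G" by (rule pw.img_is_subgroup)
  have pH: "subgroup ?pH G" by (rule pw.subgroup_img_is_subgroup[OF H])
  have "?pG \<inter> H \<subseteq> ?pH" using pure by blast
  from maximal_subgroup_avoiding[OF pG this]
  obtain K where K: "subgroup K G" "?pG \<subseteq> K" "K \<inter> H \<subseteq> ?pH"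
    and max: "\<And>a. \<lbrakk>a \<in> carrier G; a \<notin> K\<rbrakk> \<Longrightarrow> \<exists>k\<in>K. \<exists>n::int. k \<otimes> a [^] n \<in> H - ?pH"
    by auto
  interpret K: subgroup K G by fact
  have pK: "x [^] (m * int p) \<in> K" if "x \<in> carrier G" for x m
  proof -
    have "x [^] (m * int p) = (x [^] m) [^] p"
      using that by (simp only: int_pow_pow[symmetric] int_pow_int)
    then show ?thesis using K(2) that by auto
  qed
  show thesis
  proof (rule that[OF K(1)])
    have "?pH \<subseteq> H"
      using subgroup_int_pow_closed[OF H, of _ "int p"] by (auto simp: int_pow_int)
    then show "K \<inter> H = ?pH" using K(2,3) H.subset by blast
  next
    fix a assume a: "a \<in> carrier G"
    show "\<exists>h\<in>H. \<exists>k\<in>K. a = h \<otimes> k"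
    proof (cases "a \<in> K")
      case True
      then show ?thesis by (intro bexI[of _ \<one>] bexI[of _ a]) auto
    next
      case False
      then obtain k and n :: int where kn: "k \<in> K" "k \<otimes> a [^] n \<in> H" "k \<otimes> a [^] n \<notin> ?pH"
        using max a by blast
      have "\<not> int p dvd n"
      proof
        assume "int p dvd n"
        then obtain m where "n = m * int p" by (metis dvd_def mult.commute)
        then have "k \<otimes> a [^] n \<in> K" using pK a kn(1) by simp
        then show False using K(3) kn by blast
      qed
      then have "coprime (int p) n" using p prime_imp_coprime[of "int p" n] by simp
      then obtain u v where uv: "u * int p + v * n = 1"
        using bezout_int[of "int p" n] by (auto simp: coprime_iff_gcd_eq_1)
      define h where "h = (k \<otimes> a [^] n) [^] v"
      define l where "l = inv (k [^] v) \<otimes> a [^] (u * int p)"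
      have "h \<otimes> l = (k [^] v \<otimes> a [^] (v * n)) \<otimes> (inv (k [^] v) \<otimes> a [^] (u * int p))"
        unfolding h_def l_def using a kn(1) by (simp add: int_pow_distrib int_pow_pow mult.commute)
      also have "\<dots> = a [^] (v * n) \<otimes> a [^] (u * int p)"
      proof -
        have "(x \<otimes> y) \<otimes> (inv x \<otimes> z) = y \<otimes> z" if "x \<in> carrier G" "y \<in> carrier G" "z \<in> carrier G" for x y z
        proof -
          have "x \<otimes> (inv x \<otimes> z) = z" using that by (simp add: m_assoc[symmetric])
          then show ?thesis using that by (simp add: m_comm[of x y] m_assoc)
        qed
        then show ?thesis using a kn(1) by simp
      qed
      also have "\<dots> = a [^] (v * n + u * int p)"
        using a by (simp add: int_pow_mult)
      also have "\<dots> = a" using uv a by (simp add: add.commute)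
      finally have "a = h \<otimes> l" by simp
      moreover have "h \<in> H" unfolding h_def using kn(2) subgroup_int_pow_closed[OF H] by blast
      moreover have "l \<in> K" unfolding l_def
        using kn(1) subgroup_int_pow_closed[OF K(1)] pK[OF a] by blast
      ultimately show ?thesis by blast
    qed
  qed
qed

lemma (in comm_group) subgroup_is_comm_group:
  assumes "subgroup H G"
  shows "comm_group (G\<lparr>carrier := H\<rparr>)"
  by (rule group.group_comm_groupI[OF subgroup_imp_group[OF assms]])
    (use subgroup.mem_carrier[OF assms] in \<open>simp add: m_comm\<close>)

text \<open>
  The \<^term>\<open>p\<close>-adic topology is Hausdorff and sequentially complete. It suffices to consider sequences
  whose consecutive terms differ by a \<^term>\<open>p ^ n\<close>th power at stage \<^term>\<open>n\<close>.
\<close>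

definition padically_complete :: "nat \<Rightarrow> ('c, 'm) monoid_scheme \<Rightarrow> bool" where
  "padically_complete p C \<longleftrightarrow>
    (\<forall>x\<in>carrier C. (\<forall>n. \<exists>y\<in>carrier C. x = y [^]\<^bsub>C\<^esub> (p ^ n)) \<longrightarrow> x = \<one>\<^bsub>C\<^esub>) \<and>
    (\<forall>s. (\<forall>n. s n \<in> carrier C \<and> (\<exists>y\<in>carrier C. s (Suc n) = s n \<otimes>\<^bsub>C\<^esub> y [^]\<^bsub>C\<^esub> (p ^ n))) \<longrightarrow>
      (\<exists>c\<in>carrier C. \<forall>n. \<exists>y\<in>carrier C. c = s n \<otimes>\<^bsub>C\<^esub> y [^]\<^bsub>C\<^esub> (p ^ n)))"

text \<open>
  Applying \<^verbatim>\<open>complement_mod_prime\<close> repeatedly gives a decreasing sequence of subgroups \<open>K\<^sub>n\<close>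
  that meet \<open>H\<close> in its \<open>p\<^sup>n\<close>th powers \<open>E\<^sub>n\<close> and satisfy \<open>K\<^sub>n = E\<^sub>n K\<^sub>n\<^sub>+\<^sub>1\<close>. Their intersection meets
  \<open>H\<close> trivially since \<open>H\<close> is Hausdorff. Splitting off the components of an element \<open>a\<close> in
  \<open>E\<^sub>0, E\<^sub>1, \<dots>\<close> one after the other, one gets a Cauchy sequence in \<open>H\<close>, and \<open>a\<close> differs from its
  limit by an element of the intersection.
\<close>

lemma (in comm_group) padically_complete_complement:
  assumes p: "prime (p::nat)" and H: "subgroup H G" and comp: "padically_complete p (G\<lparr>carrier := H\<rparr>)"
    and pure: "\<And>x. \<lbrakk>x \<in> carrier G; x [^] p \<in> H\<rbrakk> \<Longrightarrow> x \<in> H"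
  shows "direct_summand H G"
proof -
  interpret H: subgroup H G by fact
  define E where "E n = (\<lambda>x. x [^] (p ^ n)) ` H" for n :: nat
  define Q where "Q n K \<longleftrightarrow> subgroup K G \<and> K \<inter> H = E n" for n K
  define S where "S n K K' \<longleftrightarrow> K' \<subseteq> K \<and> (\<forall>a\<in>K. \<exists>h\<in>E n. \<exists>k\<in>K'. a = h \<otimes> k)" for n K K'
  have step: "\<exists>K'. Q (Suc n) K' \<and> S n K K'" if Q: "Q n K" for n K
  proof -
    have K: "subgroup K G" "K \<inter> H = E n" using Q by (auto simp: Q_def)
    interpret GK: comm_group "G\<lparr>carrier := K\<rparr>" by (rule subgroup_is_comm_group[OF K(1)])
    have EK: "subgroup (E n) (G\<lparr>carrier := K\<rparr>)"
    proof -
      have "subgroup (K \<inter> H) G" using subgroups_Inter_pair[OF K(1) H] .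
      then show ?thesis using K by (metis inf_le1 subgroup_incl)
    qed
    show ?thesis
    proof (rule GK.complement_mod_prime[OF p EK])
      fix x assume "x \<in> carrier (G\<lparr>carrier := K\<rparr>)" "x [^]\<^bsub>G\<lparr>carrier := K\<rparr>\<^esub> p \<in> E n"
      then have "x \<in> K" "x [^] p \<in> H"
        using K(2) by (auto simp flip: nat_pow_consistent)
      then show "x \<in> E n" using pure[of x] subgroup.mem_carrier[OF K(1)] K(2) by blast
    next
      fix K' assume K': "subgroup K' (G\<lparr>carrier := K\<rparr>)"
        "K' \<inter> E n = (\<lambda>x. x [^]\<^bsub>G\<lparr>carrier := K\<rparr>\<^esub> p) ` E n"
        and split: "\<And>a. a \<in> carrier (G\<lparr>carrier := K\<rparr>) \<Longrightarrow>
          \<exists>h\<in>E n. \<exists>k\<in>K'. a = h \<otimes>\<^bsub>G\<lparr>carrier := K\<rparr>\<^esub> k"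
    have "K' \<subseteq> K" using subgroup.subset[OF K'(1)] by simp
    moreover have "subgroup K' G" by (rule incl_subgroup[OF K(1) K'(1)])
    moreover have "K' \<inter> H = E (Suc n)"
    proof -
      have "K' \<inter> H = K' \<inter> E n" using \<open>K' \<subseteq> K\<close> K(2) by blast
      also have "\<dots> = (\<lambda>x. x [^] p) ` E n" by (simp add: K'(2) flip: nat_pow_consistent)
      also have "\<dots> = E (Suc n)"
        unfolding E_def image_image
        by (intro image_cong) (auto simp: nat_pow_pow mult.commute)
      finally show ?thesis .
    qed
    ultimately show ?thesis using split by (auto simp: Q_def S_def)
    qed
  qed
  have "Q 0 (carrier G)"
    using subgroup_self H.subset by (force simp: Q_def E_def)
  then obtain K where K0: "K 0 = carrier G" and KQ: "\<And>n. Q n (K n)" and KS: "\<And>n. S n (K n) (K (Suc n))"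
  proof -
    have "\<exists>K. \<forall>n. (Q n (K n) \<and> (n = 0 \<longrightarrow> K n = carrier G)) \<and> S n (K n) (K (Suc n))"
      by (rule dependent_nat_choice) (use step \<open>Q 0 (carrier G)\<close> in auto)
    then show thesis using that by blast
  qed
  have K: "subgroup (K n) G" "K n \<inter> H = E n" for n using KQ by (auto simp: Q_def)
  have Kdec: "K (Suc n) \<subseteq> K n" for n using KS by (simp add: S_def)
  define D where "D = (\<Inter>n. K n)"
  have D: "subgroup D G" unfolding D_def by (rule subgroups_Inter) (use K in auto)
  have comp1: "x = \<one>" if "x \<in> H" "\<And>n. x \<in> E n" for x
    using comp that unfolding padically_complete_def E_def
    by (simp add: image_iff flip: nat_pow_consistent)
  have comp2: "\<exists>c\<in>H. \<forall>n. \<exists>y\<in>E n. c = s n \<otimes> y"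
    if "\<And>n. s n \<in> H" "\<And>n. \<exists>y\<in>E n. s (Suc n) = s n \<otimes> y" for s
    using comp that unfolding padically_complete_def E_def
    by (simp flip: nat_pow_consistent)
  have "H \<inter> D = {\<one>}"
  proof -
    have "x = \<one>" if "x \<in> H" "x \<in> D" for x
      using comp1 that K(2) unfolding D_def by blast
    then show ?thesis using H.one_closed subgroup.one_closed[OF D] by blast
  qed
  moreover have split: "a \<in> H <#> D" if a: "a \<in> carrier G" for a
  proof -
    \<comment> \<open>s approximates the component of a in H up to stage n\<close>
    define T where "T n s \<longleftrightarrow> s \<in> H \<and> (\<exists>k\<in>K n. a = s \<otimes> k)" for n s
    have "\<exists>s. \<forall>n. T n (s n) \<and> (\<exists>y\<in>E n. s (Suc n) = s n \<otimes> y)"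
    proof (rule dependent_nat_choice)
      show "\<exists>s. T 0 s" using a H.one_closed unfolding T_def K0 by (metis l_one)
      fix s n assume "T n s"
      then obtain k where s: "s \<in> H" and k: "k \<in> K n" "a = s \<otimes> k" by (auto simp: T_def)
      obtain h l where hl: "h \<in> E n" "l \<in> K (Suc n)" "k = h \<otimes> l"
        using KS[of n] k(1) unfolding S_def by blast
      have "h \<in> H" using hl(1) K(2) by blast
      moreover have "a = (s \<otimes> h) \<otimes> l"
        using k(2) hl s \<open>h \<in> H\<close> subgroup.mem_carrier[OF K(1) hl(2)] by (simp add: m_assoc)
      ultimately have "T (Suc n) (s \<otimes> h)" using s hl(2) by (auto simp: T_def)
      then show "\<exists>s'. T (Suc n) s' \<and> (\<exists>y\<in>E n. s' = s \<otimes> y)" using hl(1) by blast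
    qed
    then obtain s where s: "\<And>n. T n (s n)" "\<And>n. \<exists>y\<in>E n. s (Suc n) = s n \<otimes> y" by blast
    then obtain c where c: "c \<in> H" "\<And>n. \<exists>y\<in>E n. c = s n \<otimes> y"
      using comp2[of s] by (auto simp: T_def)
    have "inv c \<otimes> a \<in> K n" for n
    proof -
      obtain k where k: "s n \<in> H" "k \<in> K n" "a = s n \<otimes> k" using s(1) by (auto simp: T_def)
      obtain y where y: "y \<in> E n" "c = s n \<otimes> y" using c(2) by blast
      have yK: "y \<in> K n" using y(1) K(2) by blast
      have [simp]: "s n \<in> carrier G" "k \<in> carrier G" "y \<in> carrier G"
        using k yK subgroup.mem_carrier[OF K(1)] by auto
      have "inv c \<otimes> a = (inv y \<otimes> k) \<otimes> (inv (s n) \<otimes> s n)"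
        unfolding y(2) k(3) by (simp add: inv_mult m_ac)
      also have "\<dots> = inv y \<otimes> k" by simp
      finally show ?thesis
        using k(2) yK subgroup.m_closed[OF K(1)] subgroup.m_inv_closed[OF K(1)] by simp
    qed
    then have "inv c \<otimes> a \<in> D" by (simp add: D_def)
    moreover have "a = c \<otimes> (inv c \<otimes> a)" using a c(1) by (simp add: m_assoc[symmetric])
    ultimately show ?thesis using c(1) unfolding set_mult_def by blast
  qed
  moreover have "H <#> D \<subseteq> carrier G"
    using subgroup.subset[OF D] by (auto simp: set_mult_def)
  then have "H <#> D = carrier G" using split by blast
  ultimately show ?thesis using H D unfolding direct_summand_def by blast
qed

section \<open>The \<open>p\<close>-adic integers are \<open>p\<close>-adically complete\<close>

lemma padic_group_simps [simp]:
  "\<one>\<^bsub>padic_group p\<^esub> = (\<lambda>_. 0)"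
  "x \<otimes>\<^bsub>padic_group p\<^esub> y = (\<lambda>n. (x n + y n) mod int p ^ n)"
  by (auto simp: padic_group_def)

lemma padic_group_carrier_iff:
  "x \<in> carrier (padic_group p) \<longleftrightarrow>
    (\<forall>n. 0 \<le> x n \<and> x n < int p ^ n \<and> x (Suc n) mod int p ^ n = x n)"
  by (auto simp: padic_group_def)

lemma padic_group_residue:
  assumes x: "x \<in> carrier (padic_group p)" and "k \<le> n"
  shows "x n mod int p ^ k = x k"
  using assms(2)
proof (induction rule: dec_induct)
  case base
  then show ?case using x by (simp add: padic_group_carrier_iff)
next
  case (step n)
  have "x (Suc n) mod int p ^ k = x (Suc n) mod int p ^ n mod int p ^ k"
    using step(1) by (simp add: mod_mod_cancel le_imp_power_dvd)
  also have "\<dots> = x k" using step x by (simp add: padic_group_carrier_iff)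
  finally show ?case .
qed

lemma padic_group_reduce:
  assumes "0 < p" and s: "\<And>n. s (Suc n) mod int p ^ n = s n mod int p ^ n"
  shows "(\<lambda>n. s n mod int p ^ n) \<in> carrier (padic_group p)"
  unfolding padic_group_carrier_iff
  using assms(1) by (auto simp: mod_mod_cancel le_imp_power_dvd s)

lemma comm_group_padic_group:
  assumes p: "0 < p"
  shows "comm_group (padic_group p)"
proof (rule comm_groupI)
  have S: "x (Suc n) mod int p ^ n = x n" if "x \<in> carrier (padic_group p)" for x n
    using that by (simp add: padic_group_carrier_iff)
  fix x assume x: "x \<in> carrier (padic_group p)"
  have xm: "x n mod int p ^ n = x n" for n using padic_group_residue[OF x] by simp
  show "\<one>\<^bsub>padic_group p\<^esub> \<otimes>\<^bsub>padic_group p\<^esub> x = x" by (simp add: xm)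
  show "\<exists>y\<in>carrier (padic_group p). y \<otimes>\<^bsub>padic_group p\<^esub> x = \<one>\<^bsub>padic_group p\<^esub>"
  proof (rule bexI[of _ "\<lambda>n. (- x n) mod int p ^ n"])
    have "(- x (Suc n)) mod int p ^ n = (- x n) mod int p ^ n" for n
      using S[OF x, of n] xm[of n] by (metis mod_minus_eq)
    then show "(\<lambda>n. (- x n) mod int p ^ n) \<in> carrier (padic_group p)"
      by (rule padic_group_reduce[OF p])
  qed (auto simp: mod_simps)
  fix y assume y: "y \<in> carrier (padic_group p)"
  have "(x (Suc n) + y (Suc n)) mod int p ^ n = (x n + y n) mod int p ^ n" for n
    using S[OF x, of n] S[OF y, of n] by (metis mod_add_eq)
  from padic_group_reduce[OF p, of "\<lambda>n. x n + y n", OF this]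
  show "x \<otimes>\<^bsub>padic_group p\<^esub> y \<in> carrier (padic_group p)" by simp
  show "x \<otimes>\<^bsub>padic_group p\<^esub> y = y \<otimes>\<^bsub>padic_group p\<^esub> x" by (simp add: add.commute)
  fix z
  show "x \<otimes>\<^bsub>padic_group p\<^esub> y \<otimes>\<^bsub>padic_group p\<^esub> z = x \<otimes>\<^bsub>padic_group p\<^esub> (y \<otimes>\<^bsub>padic_group p\<^esub> z)"
    by (simp add: mod_simps add.assoc)
qed (use p in \<open>simp add: padic_group_carrier_iff\<close>)

lemma padic_group_nat_pow:
  "x [^]\<^bsub>padic_group p\<^esub> (m::nat) = (\<lambda>n. (int m * x n) mod int p ^ n)"
  by (induction m) (auto simp: nat_pow_def mod_simps algebra_simps)

text \<open>
  The quotient by \<^term>\<open>p ^ n\<close> has to be read off \<^term>\<open>n\<close> places further on, since division costs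
  \<^term>\<open>n\<close> digits of precision.
\<close>

lemma padic_group_divide:
  assumes p: "0 < p" and d: "d \<in> carrier (padic_group p)" and n: "d n = 0"
  shows "\<exists>y\<in>carrier (padic_group p). d = y [^]\<^bsub>padic_group p\<^esub> (p ^ n)"
proof -
  define y where "y m = d (m + n) div int p ^ n" for m
  have p0: "int p ^ k > 0" for k using p by simp
  have dvd: "int p ^ n * y m = d (m + n)" for m
    using padic_group_residue[OF d, of n "m + n"] n by (auto simp: y_def)
  have "y \<in> carrier (padic_group p)"
    unfolding padic_group_carrier_iff
  proof (intro allI conjI)
    fix m
    have b: "0 \<le> d (m + n)" "d (m + n) < int p ^ (m + n)"
      using d by (auto simp: padic_group_carrier_iff)
    show "0 \<le> y m" using b p0 by (simp add: y_def pos_imp_zdiv_nonneg_iff)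
    have "int p ^ n * y m < int p ^ n * int p ^ m"
      using b(2) unfolding dvd by (simp add: power_add mult.commute)
    then show "y m < int p ^ m" using p0[of n] by simp
    have "int p ^ n * (y (Suc m) mod int p ^ m) = d (Suc (m + n)) mod int p ^ (m + n)"
      using dvd[of "Suc m"] by (simp add: mult_mod_right power_add mult.commute)
    also have "\<dots> = d (m + n)" using d by (simp add: padic_group_carrier_iff)
    also have "\<dots> = int p ^ n * y m" by (simp add: dvd)
    finally show "y (Suc m) mod int p ^ m = y m" using p by simp
  qed
  moreover have "d = y [^]\<^bsub>padic_group p\<^esub> (p ^ n)"
    using padic_group_residue[OF d, of m "m + n" for m] by (auto simp: padic_group_nat_pow dvd)
  ultimately show ?thesis by blast
qed

text \<open>
  In a Cauchy sequence the residue modulo \<^term>\<open>p ^ n\<close> does not change after stage \<^term>\<open>n\<close>, so the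
  diagonal of residues is the limit.
\<close>

lemma padically_complete_padic_group:
  assumes p: "0 < p"
  shows "padically_complete p (padic_group p)"
  unfolding padically_complete_def
proof (intro conjI ballI allI impI)
  fix x assume "x \<in> carrier (padic_group p)"
    "\<forall>n. \<exists>y\<in>carrier (padic_group p). x = y [^]\<^bsub>padic_group p\<^esub> (p ^ n)"
  then have "x n = 0" for n
    by (metis (no_types, lifting) mod_mult_self1_is_0 of_nat_power padic_group_nat_pow)
  then show "x = \<one>\<^bsub>padic_group p\<^esub>" by auto
next
  let ?Z = "carrier (padic_group p)"
  interpret Z: comm_group "padic_group p" by (rule comm_group_padic_group[OF p])
  fix s
  assume s: "\<forall>n. s n \<in> ?Z \<and>
    (\<exists>y\<in>?Z. s (Suc n) = s n \<otimes>\<^bsub>padic_group p\<^esub> y [^]\<^bsub>padic_group p\<^esub> (p ^ n))"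
  have sZ: "s n \<in> ?Z" for n using s by blast
  have Suc: "s (Suc n) m = s n m" if "m \<le> n" for m n
  proof -
    obtain y where "s (Suc n) = s n \<otimes>\<^bsub>padic_group p\<^esub> y [^]\<^bsub>padic_group p\<^esub> (p ^ n)"
      using s by blast
    then have "s (Suc n) m = (s n m + int p ^ n * y m) mod int p ^ m"
      by (simp add: padic_group_nat_pow mod_simps)
    also have "\<dots> = s n m mod int p ^ m"
      using that by (simp add: mod_eq_dvd_iff le_imp_power_dvd)
    also have "\<dots> = s n m" using padic_group_residue[OF sZ] by simp
    finally show ?thesis .
  qed
  have stable: "s n m = s m m" if "m \<le> n" for m n
    using that by (induction rule: dec_induct) (auto simp: Suc)
  define c where "c n = s n n" for n
  have c: "c \<in> ?Z"
    unfolding padic_group_carrier_iff c_def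
  proof (intro allI conjI)
    fix n
    show "0 \<le> s n n" "s n n < int p ^ n" using sZ[of n] by (auto simp: padic_group_carrier_iff)
    have "s (Suc n) (Suc n) mod int p ^ n = s (Suc n) n" by (rule padic_group_residue[OF sZ]) simp
    also have "\<dots> = s n n" by (rule Suc) simp
    finally show "s (Suc n) (Suc n) mod int p ^ n = s n n" .
  qed
  show "\<exists>c\<in>?Z. \<forall>n. \<exists>y\<in>?Z. c = s n \<otimes>\<^bsub>padic_group p\<^esub> y [^]\<^bsub>padic_group p\<^esub> (p ^ n)"
  proof (rule bexI[OF _ c], rule allI)
    fix n
    define d where "d = inv\<^bsub>padic_group p\<^esub> (s n) \<otimes>\<^bsub>padic_group p\<^esub> c"
    have d: "d \<in> ?Z" unfolding d_def using sZ c by (intro Z.m_closed Z.inv_closed)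
    have cd: "c = s n \<otimes>\<^bsub>padic_group p\<^esub> d"
      unfolding d_def using sZ[of n] c
      by (metis Z.inv_closed Z.l_one Z.m_assoc Z.r_inv)
    have "s n n = (s n n + d n) mod int p ^ n"
      using fun_cong[OF cd, of n] by (simp add: c_def)
    then have "d n mod int p ^ n = 0"
      by (metis add_diff_cancel_left' dvd_eq_mod_eq_0 dvd_minus_mod dvd_minus_iff minus_diff_eq)
    then have "d n = 0" using padic_group_residue[OF d, of n n] by simp
    then show "\<exists>y\<in>?Z. c = s n \<otimes>\<^bsub>padic_group p\<^esub> y [^]\<^bsub>padic_group p\<^esub> (p ^ n)"
      using padic_group_divide[OF p d] cd by blast
  qed
qed

section \<open>Groups with a nonzero cotorsion subgroup\<close>

lemma padically_complete_image:
  assumes P: "group P" and G: "group G" and h: "h \<in> mon P G" and comp: "padically_complete p P"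
  shows "padically_complete p (G\<lparr>carrier := h ` carrier P\<rparr>)"
proof -
  interpret P: group P by fact
  interpret G: group G by fact
  interpret h: group_hom P G h using h by unfold_locales (simp add: mon_def)
  have inj: "h x = h y \<longleftrightarrow> x = y" if "x \<in> carrier P" "y \<in> carrier P" for x y
    using h that by (auto simp: mon_def inj_on_def)
  have pow: "h y [^]\<^bsub>G\<^esub> (m::nat) = h (y [^]\<^bsub>P\<^esub> m)" if "y \<in> carrier P" for y m
    using that by (simp add: h.hom_nat_pow)
  show ?thesis
    unfolding padically_complete_def
  proof (intro conjI ballI allI impI)
    fix x assume "x \<in> carrier (G\<lparr>carrier := h ` carrier P\<rparr>)"
      and div: "\<forall>n. \<exists>y\<in>carrier (G\<lparr>carrier := h ` carrier P\<rparr>).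
        x = y [^]\<^bsub>G\<lparr>carrier := h ` carrier P\<rparr>\<^esub> (p ^ n)"
    then obtain u where u: "u \<in> carrier P" "x = h u" by auto
    have "\<exists>y\<in>carrier P. u = y [^]\<^bsub>P\<^esub> (p ^ n)" for n
      using div u by (auto simp: pow inj simp flip: G.nat_pow_consistent)
    then show "x = \<one>\<^bsub>G\<lparr>carrier := h ` carrier P\<rparr>\<^esub>"
      using comp u unfolding padically_complete_def by auto
  next
    fix s
    assume s: "\<forall>n. s n \<in> carrier (G\<lparr>carrier := h ` carrier P\<rparr>) \<and>
      (\<exists>y\<in>carrier (G\<lparr>carrier := h ` carrier P\<rparr>). s (Suc n) =
        s n \<otimes>\<^bsub>G\<lparr>carrier := h ` carrier P\<rparr>\<^esub> y [^]\<^bsub>G\<lparr>carrier := h ` carrier P\<rparr>\<^esub> (p ^ n))"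
    then have "\<forall>n. \<exists>t. t \<in> carrier P \<and> s n = h t" by auto
    then obtain t where t: "\<And>n. t n \<in> carrier P" "\<And>n. s n = h (t n)" by metis
    have "\<exists>y\<in>carrier P. t (Suc n) = t n \<otimes>\<^bsub>P\<^esub> y [^]\<^bsub>P\<^esub> (p ^ n)" for n
    proof -
      obtain y where "y \<in> carrier P" "h (t (Suc n)) = h (t n) \<otimes>\<^bsub>G\<^esub> h y [^]\<^bsub>G\<^esub> (p ^ n)"
        using s t(2) by (auto simp flip: G.nat_pow_consistent)
      then show ?thesis using t(1) inj pow by (metis P.m_closed P.nat_pow_closed h.hom_mult)
    qed
    then obtain c where c: "c \<in> carrier P" "\<And>n. \<exists>y\<in>carrier P. c = t n \<otimes>\<^bsub>P\<^esub> y [^]\<^bsub>P\<^esub> (p ^ n)"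
      using comp t(1) unfolding padically_complete_def by metis
    show "\<exists>c\<in>carrier (G\<lparr>carrier := h ` carrier P\<rparr>). \<forall>n. \<exists>y\<in>carrier (G\<lparr>carrier := h ` carrier P\<rparr>).
      c = s n \<otimes>\<^bsub>G\<lparr>carrier := h ` carrier P\<rparr>\<^esub> y [^]\<^bsub>G\<lparr>carrier := h ` carrier P\<rparr>\<^esub> (p ^ n)"
    proof (rule bexI[of _ "h c"], rule allI)
      fix n
      obtain y where "y \<in> carrier P" "c = t n \<otimes>\<^bsub>P\<^esub> y [^]\<^bsub>P\<^esub> (p ^ n)" using c(2) by blast
      then show "\<exists>y\<in>carrier (G\<lparr>carrier := h ` carrier P\<rparr>).
        h c = s n \<otimes>\<^bsub>G\<lparr>carrier := h ` carrier P\<rparr>\<^esub> y [^]\<^bsub>G\<lparr>carrier := h ` carrier P\<rparr>\<^esub> (p ^ n)"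
        using t by (auto simp: pow simp flip: G.nat_pow_consistent)
    qed (use c(1) in auto)
  qed
qed

lemma mon_composeD:
  assumes "h \<in> mon P G" "j \<in> mon (G\<lparr>carrier := h ` carrier P\<rparr>) A"
  shows "j \<circ> h \<in> mon P A"
  using assms by (auto simp: mon_def hom_def inj_on_def Pi_iff)

text \<open>
  The cotorsion property refers to overgroups on a type that depends on the type of the group. It is
  therefore stated for the image of the complete group in \<^term>\<open>G\<close>, not transferred along an
  isomorphism.
\<close>

lemma cotorsion_padically_complete:
  fixes G :: "('c, 'm) monoid_scheme"
  assumes P: "comm_group P" and G: "comm_group G" and h: "h \<in> mon P G"
    and p: "prime (p::nat)" and comp: "padically_complete p P"
  shows "cotorsion (G\<lparr>carrier := h ` carrier P\<rparr>)"
  unfolding cotorsion_def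
proof (intro conjI allI impI)
  interpret P: comm_group P by fact
  interpret G: comm_group G by fact
  show C: "comm_group (G\<lparr>carrier := h ` carrier P\<rparr>)"
    by (rule G.subgroup_is_comm_group[OF mon_image_subgroup[OF G P h]])
  fix A :: "('c \<times> rat) monoid" and j
  assume "comm_group A \<and> j \<in> mon (G\<lparr>carrier := h ` carrier P\<rparr>) A \<and>
    torsion_free (A Mod (j ` carrier (G\<lparr>carrier := h ` carrier P\<rparr>)))"
  then have A: "comm_group A" and j: "j \<circ> h \<in> mon P A"
    and tf: "torsion_free (A Mod ((j \<circ> h) ` carrier P))"
    using mon_composeD[OF h, of j A] by (auto simp: image_comp)
  interpret A: comm_group A by fact
  have H: "subgroup ((j \<circ> h) ` carrier P) A" by (rule mon_image_subgroup[OF A P j])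
  have "direct_summand ((j \<circ> h) ` carrier P) A"
  proof (rule A.padically_complete_complement[OF p H])
    show "padically_complete p (A\<lparr>carrier := (j \<circ> h) ` carrier P\<rparr>)"
      by (rule padically_complete_image[OF P.is_group A.is_group j comp])
    fix x assume x: "x \<in> carrier A" "x [^]\<^bsub>A\<^esub> p \<in> (j \<circ> h) ` carrier P"
    then show "x \<in> (j \<circ> h) ` carrier P"
      using tf[unfolded torsion_free_Mod_iff[OF A H], rule_format, of x "int p"] prime_gt_0_nat[OF p]
      by (simp add: int_pow_int)
  qed
  then show "direct_summand (j ` carrier (G\<lparr>carrier := h ` carrier P\<rparr>)) A"
    by (simp add: image_comp)
qed

lemma cotorsion_divisible_torsion_free:
  fixes G :: "('c, 'm) monoid_scheme"
  assumes P: "comm_group P" and G: "comm_group G" and h: "h \<in> mon P G"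
    and div: "\<And>x n. \<lbrakk>x \<in> carrier P; 0 < n\<rbrakk> \<Longrightarrow> \<exists>y\<in>carrier P. x = y [^]\<^bsub>P\<^esub> (n::nat)"
    and tfP: "torsion_free P"
  shows "cotorsion (G\<lparr>carrier := h ` carrier P\<rparr>)"
  unfolding cotorsion_def
proof (intro conjI allI impI)
  interpret P: comm_group P by fact
  interpret G: comm_group G by fact
  show C: "comm_group (G\<lparr>carrier := h ` carrier P\<rparr>)"
    by (rule G.subgroup_is_comm_group[OF mon_image_subgroup[OF G P h]])
  fix A :: "('c \<times> rat) monoid" and j
  assume "comm_group A \<and> j \<in> mon (G\<lparr>carrier := h ` carrier P\<rparr>) A \<and>
    torsion_free (A Mod (j ` carrier (G\<lparr>carrier := h ` carrier P\<rparr>)))"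
  then have A: "comm_group A" and j: "j \<circ> h \<in> mon P A"
    using mon_composeD[OF h, of j A] by auto
  define i where "i = j \<circ> h"
  interpret A: comm_group A by fact
  interpret i: group_hom P A i using j by unfold_locales (simp add: mon_def i_def)
  have H: "subgroup (i ` carrier P) A" using mon_image_subgroup[OF A P j] by (simp add: i_def)
  have "direct_summand (i ` carrier P) A"
  proof (rule A.divisible_torsion_free_complement[OF H])
    fix x and n :: nat assume "x \<in> i ` carrier P" "0 < n"
    then obtain y where "y \<in> carrier P" "x = i (y [^]\<^bsub>P\<^esub> n)" using div by blast
    then show "\<exists>y\<in>i ` carrier P. x = y [^]\<^bsub>A\<^esub> n" by (auto simp: i.hom_nat_pow)
  next
    fix x and n :: nat assume "x \<in> i ` carrier P" "0 < n" and e: "x [^]\<^bsub>A\<^esub> n = \<one>\<^bsub>A\<^esub>"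
    then obtain u where u: "u \<in> carrier P" "x = i u" by blast
    have "i (u [^]\<^bsub>P\<^esub> n) = i \<one>\<^bsub>P\<^esub>" using e u by (simp add: i.hom_nat_pow)
    then have "u [^]\<^bsub>P\<^esub> n = \<one>\<^bsub>P\<^esub>" using j u(1) by (auto simp: mon_def i_def inj_on_def)
    then have "u = \<one>\<^bsub>P\<^esub>" using tfP u(1) \<open>0 < n\<close> by (auto simp: torsion_free_def)
    then show "x = \<one>\<^bsub>A\<^esub>" using u by simp
  qed
  then show "direct_summand (j ` carrier (G\<lparr>carrier := h ` carrier P\<rparr>)) A"
    by (simp add: image_comp i_def)
qed

lemma comm_group_rat_group: "comm_group rat_group"
proof (rule comm_groupI)
  fix x :: rat
  show "\<exists>y\<in>carrier rat_group. y \<otimes>\<^bsub>rat_group\<^esub> x = \<one>\<^bsub>rat_group\<^esub>"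
    by (rule bexI[of _ "- x"]) (auto simp: rat_group_def)
qed (auto simp: rat_group_def)

lemma rat_group_nat_pow: "x [^]\<^bsub>rat_group\<^esub> (n::nat) = of_nat n * x"
  by (induction n) (auto simp: nat_pow_def rat_group_def algebra_simps)

lemma torsion_element_prime_order:
  assumes G: "comm_group G" and x: "x \<in> carrier G" "x \<noteq> \<one>\<^bsub>G\<^esub>" "0 < n" "x [^]\<^bsub>G\<^esub> (n::nat) = \<one>\<^bsub>G\<^esub>"
  shows "\<exists>p y. prime (p::nat) \<and> y \<in> carrier G \<and> y \<noteq> \<one>\<^bsub>G\<^esub> \<and> y [^]\<^bsub>G\<^esub> p = \<one>\<^bsub>G\<^esub>"
  using x(3,4)
proof (induction n rule: less_induct)
  case (less n)
  interpret comm_group G by fact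
  have "n \<noteq> 1" using less.prems x by auto
  then obtain p where p: "prime p" "p dvd n" using prime_factor_nat by blast
  then obtain m where m: "n = m * p" by (metis dvd_def mult.commute)
  show ?case
  proof (cases "x [^]\<^bsub>G\<^esub> m = \<one>\<^bsub>G\<^esub>")
    case True
    moreover have "m < n" "0 < m" using m less.prems(1) prime_gt_1_nat[OF p(1)] by auto
    ultimately show ?thesis using less.IH by blast
  next
    case False
    moreover have "(x [^]\<^bsub>G\<^esub> m) [^]\<^bsub>G\<^esub> p = \<one>\<^bsub>G\<^esub>" using less.prems x m by (simp add: nat_pow_pow)
    ultimately show ?thesis using p(1) x(1) by (metis nat_pow_closed)
  qed
qed

text \<open>
  In a group of exponent \<^term>\<open>p\<close> all powers with exponent \<^term>\<open>p ^ n\<close> are trivial for positive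
  \<^term>\<open>n\<close>, so the \<^term>\<open>p\<close>-adic topology is discrete and Cauchy sequences are constant from
  index \<^term>\<open>1::nat\<close> on.
\<close>

lemma cotorsion_prime_torsion:
  assumes G: "comm_group G" and p: "prime (p::nat)"
  defines "T \<equiv> {x \<in> carrier G. x [^]\<^bsub>G\<^esub> p = \<one>\<^bsub>G\<^esub>}"
  shows "subgroup T G" "cotorsion (G\<lparr>carrier := T\<rparr>)"
proof -
  interpret comm_group G by fact
  show T: "subgroup T G"
  proof (rule subgroupI)
    show "T \<noteq> {}" using one_closed by (auto simp: T_def)
  qed (auto simp: T_def nat_pow_distrib nat_pow_inv)
  interpret T: subgroup T G by fact
  have pow: "y [^]\<^bsub>G\<^esub> (p ^ n) = \<one>\<^bsub>G\<^esub>" if y: "y \<in> T" and n: "0 < n" for y n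
  proof -
    obtain m where "n = Suc m" using n by (cases n) auto
    then have "y [^]\<^bsub>G\<^esub> (p ^ n) = (y [^]\<^bsub>G\<^esub> p) [^]\<^bsub>G\<^esub> (p ^ m)"
      using T.mem_carrier[OF y] by (simp add: nat_pow_pow)
    also have "y [^]\<^bsub>G\<^esub> p = \<one>\<^bsub>G\<^esub>" using y unfolding T_def by blast
    finally show ?thesis by simp
  qed
  have "padically_complete p (G\<lparr>carrier := T\<rparr>)"
    unfolding padically_complete_def
  proof (intro conjI ballI allI impI)
    fix x assume "\<forall>n. \<exists>y\<in>carrier (G\<lparr>carrier := T\<rparr>). x = y [^]\<^bsub>G\<lparr>carrier := T\<rparr>\<^esub> (p ^ n)"
    from this[rule_format, of 1] obtain y where "y \<in> T" "x = y [^]\<^bsub>G\<^esub> (p ^ 1)"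
      by (auto simp flip: nat_pow_consistent)
    then show "x = \<one>\<^bsub>G\<lparr>carrier := T\<rparr>\<^esub>" using pow[of y 1] by simp
  next
    fix s
    assume s: "\<forall>n. s n \<in> carrier (G\<lparr>carrier := T\<rparr>) \<and> (\<exists>y\<in>carrier (G\<lparr>carrier := T\<rparr>).
      s (Suc n) = s n \<otimes>\<^bsub>G\<lparr>carrier := T\<rparr>\<^esub> y [^]\<^bsub>G\<lparr>carrier := T\<rparr>\<^esub> (p ^ n))"
    have sT: "s n \<in> T" for n using s by simp
    have "s (Suc n) = s n" if "0 < n" for n
    proof -
      obtain y where "y \<in> T" "s (Suc n) = s n \<otimes>\<^bsub>G\<^esub> y [^]\<^bsub>G\<^esub> (p ^ n)"
        using s by (auto simp flip: nat_pow_consistent)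
      then show ?thesis using pow[OF _ that] sT[of n] T.mem_carrier by simp
    qed
    then have const: "s (Suc n) = s 1" for n by (induction n) auto
    show "\<exists>c\<in>carrier (G\<lparr>carrier := T\<rparr>). \<forall>n. \<exists>y\<in>carrier (G\<lparr>carrier := T\<rparr>).
      c = s n \<otimes>\<^bsub>G\<lparr>carrier := T\<rparr>\<^esub> y [^]\<^bsub>G\<lparr>carrier := T\<rparr>\<^esub> (p ^ n)"
    proof (rule bexI[of _ "s 1"], rule allI)
      fix n
      show "\<exists>y\<in>carrier (G\<lparr>carrier := T\<rparr>).
        s 1 = s n \<otimes>\<^bsub>G\<lparr>carrier := T\<rparr>\<^esub> y [^]\<^bsub>G\<lparr>carrier := T\<rparr>\<^esub> (p ^ n)"
      proof (cases n)
        case 0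
        then show ?thesis
          using sT T.mem_carrier by (intro bexI[of _ "inv\<^bsub>G\<^esub> s 0 \<otimes>\<^bsub>G\<^esub> s 1"])
            (auto simp: m_assoc[symmetric] simp flip: nat_pow_consistent)
      next
        case (Suc m)
        then show ?thesis
          using const[of m] sT T.mem_carrier by (intro bexI[of _ "\<one>\<^bsub>G\<^esub>"])
            (auto simp flip: nat_pow_consistent)
      qed
    qed (use sT in simp)
  qed
  moreover have "(\<lambda>x. x) \<in> mon (G\<lparr>carrier := T\<rparr>) G"
    using T.mem_carrier by (auto simp: mon_def hom_def)
  ultimately have "cotorsion (G\<lparr>carrier := (\<lambda>x. x) ` carrier (G\<lparr>carrier := T\<rparr>)\<rparr>)"
    by (intro cotorsion_padically_complete[OF subgroup_is_comm_group[OF T] G _ p])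
  then show "cotorsion (G\<lparr>carrier := T\<rparr>)" by simp
qed

text \<open>
  From left to right, a limit homomorphism into the cotorsion subgroup is also one into
  \<^term>\<open>G\<close>; from right to left, each of the three alternatives exhibits a cotorsion subgroup.
\<close>

theorem nonzero_cotorsion_subgroup_iff:
  assumes G: "comm_group G"
  shows "has_nonzero_cotorsion_subgroup G \<longleftrightarrow>
    (\<exists>x\<in>carrier G. x \<noteq> \<one>\<^bsub>G\<^esub> \<and> (\<exists>n::nat. 0 < n \<and> x [^]\<^bsub>G\<^esub> n = \<one>\<^bsub>G\<^esub>)) \<or>
    (\<exists>h. h \<in> mon rat_group G) \<or>
    (\<exists>p::nat. prime p \<and> (\<exists>h. h \<in> mon (padic_group p) G))" (is "?C \<longleftrightarrow> ?T \<or> ?Q \<or> ?P")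
proof
  interpret comm_group G by fact
  assume ?C
  then obtain H where H: "subgroup H G" "H \<noteq> {\<one>\<^bsub>G\<^esub>}" "cotorsion (G\<lparr>carrier := H\<rparr>)"
    by (auto simp: has_nonzero_cotorsion_subgroup_def)
  interpret H: subgroup H G by fact
  obtain x where x: "x \<in> H" "x \<noteq> \<one>\<^bsub>G\<^esub>" using H.one_closed H(2) by blast
  then obtain L where L: "limit_hom (G\<lparr>carrier := H\<rparr>) L" "L (\<lambda>_. 1) = x"
    using cotorsion_limit_hom[OF H(3), of x] by auto
  have "limit_hom G L"
  proof
    show "L \<in> hom int_seq_group G"
      using limit_hom.hom[OF L(1)] by (auto simp: hom_def intro: H.mem_carrier)
    show "L a = \<one>\<^bsub>G\<^esub>" if "\<forall>\<^sub>F n in sequentially. a n = 0" for a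
      using limit_hom.vanish[OF L(1) that] by simp
  qed
  then show "?T \<or> ?Q \<or> ?P"
    using limit_hom.torsion_rat_or_padic[of G L] L(2) x(2) by blast
next
  interpret comm_group G by fact
  have nonzero: ?C if P: "comm_group P" and h: "h \<in> mon P G" and x: "x \<in> carrier P" "x \<noteq> \<one>\<^bsub>P\<^esub>"
    and cot: "cotorsion (G\<lparr>carrier := h ` carrier P\<rparr>)" for P :: "('d, 'e) monoid_scheme" and h x
  proof -
    interpret P: comm_group P by fact
    interpret h: group_hom P G h using h by unfold_locales (simp add: mon_def)
    have "h x \<noteq> h \<one>\<^bsub>P\<^esub>" using h x by (auto simp: mon_def inj_on_def)
    then have "h ` carrier P \<noteq> {\<one>\<^bsub>G\<^esub>}" using x(1) by auto
    then show ?thesis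
      unfolding has_nonzero_cotorsion_subgroup_def using cot mon_image_subgroup[OF G P h] by blast
  qed
  assume "?T \<or> ?Q \<or> ?P"
  then consider ?T | ?Q | ?P by blast
  then show ?C
  proof cases
    case 1
    then obtain p y where p: "prime (p::nat)" and y: "y \<in> carrier G" "y \<noteq> \<one>\<^bsub>G\<^esub>" "y [^]\<^bsub>G\<^esub> p = \<one>\<^bsub>G\<^esub>"
      using torsion_element_prime_order[OF G] by metis
    then have "{x \<in> carrier G. x [^]\<^bsub>G\<^esub> p = \<one>\<^bsub>G\<^esub>} \<noteq> {\<one>\<^bsub>G\<^esub>}" by blast
    then show ?thesis
      unfolding has_nonzero_cotorsion_subgroup_def using cotorsion_prime_torsion[OF G p] by blast
  next
    case 2
    then obtain h where h: "h \<in> mon rat_group G" by blast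
    show ?thesis
    proof (rule nonzero[OF comm_group_rat_group h, of 1])
      show "cotorsion (G\<lparr>carrier := h ` carrier rat_group\<rparr>)"
      proof (rule cotorsion_divisible_torsion_free[OF comm_group_rat_group G h])
        fix x and n :: nat assume "0 < n"
        then show "\<exists>y\<in>carrier rat_group. x = y [^]\<^bsub>rat_group\<^esub> n"
          unfolding rat_group_nat_pow by (intro bexI[of _ "x / of_nat n"]) (auto simp: rat_group_def)
      next
        show "torsion_free rat_group"
          unfolding torsion_free_def rat_group_nat_pow by (auto simp: rat_group_def)
      qed
    qed (auto simp: rat_group_def)
  next
    case 3
    then obtain p h where p: "prime (p::nat)" and h: "h \<in> mon (padic_group p) G" by blast
    have p1: "1 < p" using prime_gt_1_nat[OF p] .
    then have p0: "0 < p" by simp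
    show ?thesis
    proof (rule nonzero[OF comm_group_padic_group[OF p0] h])
      show "(\<lambda>n. 1 mod int p ^ n) \<in> carrier (padic_group p)" by (rule padic_group_reduce[OF p0]) simp
      have "1 mod int p ^ 1 \<noteq> 0" using p1 by simp
      then show "(\<lambda>n. 1 mod int p ^ n) \<noteq> \<one>\<^bsub>padic_group p\<^esub>" by (metis padic_group_simps(1))
      show "cotorsion (G\<lparr>carrier := h ` carrier (padic_group p)\<rparr>)"
        by (rule cotorsion_padically_complete[OF comm_group_padic_group[OF p0] G h p
              padically_complete_padic_group[OF p0]])
    qed
  qed
qed

section \<open>Quotients and products of nonassociative rings\<close>

context na_ring
begin

lemma l_null: "x \<in> carrier R \<Longrightarrow> \<zero> \<otimes> x = \<zero>"
  using l_distr[of \<zero> \<zero> x] m_closed[of \<zero> x] add.r_cancel_one' by auto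

lemma r_null: "x \<in> carrier R \<Longrightarrow> x \<otimes> \<zero> = \<zero>"
  using r_distr[of \<zero> \<zero> x] m_closed[of x \<zero>] add.r_cancel_one' by auto

lemma add_monoid_Quot: "add_monoid (R Quot N) = add_monoid R Mod N"
  by (simp add: FactRing_def FactGroup_def A_RCOSETS_def set_add_def)

lemma carrier_Quot: "carrier (R Quot N) = (\<lambda>x. N +> x) ` carrier R"
  by (auto simp: FactRing_def A_RCOSETS_def RCOSETS_def a_r_coset_def)

lemma comm_group_Quot:
  assumes "subgroup N (add_monoid R)"
  shows "comm_group (add_monoid (R Quot N))"
  unfolding add_monoid_Quot by (rule comm_group.abelian_FactGroup[OF a_comm_group assms])

lemma Quot_map_hom:
  assumes N: "subgroup N (add_monoid R)"
    and ideal: "\<And>n x. \<lbrakk>n \<in> N; x \<in> carrier R\<rbrakk> \<Longrightarrow> n \<otimes> x \<in> N \<and> x \<otimes> n \<in> N"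
  shows "(\<lambda>x. N +> x) \<in> na_hom R (R Quot N)"
proof -
  interpret N: subgroup N "add_monoid R" by fact
  interpret N: normal N "add_monoid R"
    using comm_group.normal_iff_subgroup[OF a_comm_group] N by blast
  have Nc: "n \<in> carrier R" if "n \<in> N" for n using N.mem_carrier that by simp
  have coset_iff: "N +> u = N +> x" if "u \<in> N +> x" "x \<in> carrier R" for u x
    using group.repr_independence[OF comm_group.axioms(2)[OF a_comm_group] _ _ N, of u x] that by (simp add: a_r_coset_def)
  have cosetI: "n \<oplus> x \<in> N +> x" if "n \<in> N" for n x
    using that by (auto simp: a_r_coset_def r_coset_def)
  have cosetE: "\<exists>n\<in>N. u = n \<oplus> x" if "u \<in> N +> x" for u x
    using that by (auto simp: a_r_coset_def r_coset_def)
  have mult: "rcoset_mult R N (N +> x) (N +> y) = N +> (x \<otimes> y)"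
    if x: "x \<in> carrier R" and y: "y \<in> carrier R" for x y
  proof -
    have eq: "N +> (u \<otimes> v) = N +> (x \<otimes> y)" if uv: "u \<in> N +> x" "v \<in> N +> y" for u v
    proof (rule coset_iff)
      obtain n m where nm: "n \<in> N" "u = n \<oplus> x" "m \<in> N" "v = m \<oplus> y"
        using cosetE[OF uv(1)] cosetE[OF uv(2)] by blast
      have c: "n \<in> carrier R" "m \<in> carrier R" using nm Nc by auto
      have "u \<otimes> v = n \<otimes> (m \<oplus> y) \<oplus> x \<otimes> (m \<oplus> y)"
        using nm c x y by (simp add: l_distr)
      also have "\<dots> = (n \<otimes> (m \<oplus> y) \<oplus> x \<otimes> m) \<oplus> x \<otimes> y"
        using c x y by (simp add: r_distr m_closed a_assoc)
      also have "\<dots> \<in> N +> (x \<otimes> y)"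
      proof (rule cosetI)
        have "n \<otimes> (m \<oplus> y) \<in> N" "x \<otimes> m \<in> N" using ideal nm c x y by auto
        then show "n \<otimes> (m \<oplus> y) \<oplus> x \<otimes> m \<in> N" using N.m_closed by simp
      qed
      finally show "u \<otimes> v \<in> N +> (x \<otimes> y)" .
    qed (use x y in \<open>simp add: m_closed\<close>)
    have "\<zero> \<in> N" using N.one_closed by simp
    then have "x \<in> N +> x" "y \<in> N +> y" using cosetI[of \<zero> x] cosetI[of \<zero> y] x y by auto
    then show ?thesis unfolding rcoset_mult_def using eq by blast
  qed
  have "(\<lambda>x. N +> x) \<in> hom R (R Quot N)"
  proof (rule homI)
    fix x y assume "x \<in> carrier R" "y \<in> carrier R"
    then show "N +> (x \<otimes> y) = (N +> x) \<otimes>\<^bsub>R Quot N\<^esub> (N +> y)"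
      using mult by (simp add: FactRing_def)
  qed (simp add: carrier_Quot)
  moreover have "(\<lambda>x. N +> x) \<in> hom (add_monoid R) (add_monoid (R Quot N))"
    unfolding add_monoid_Quot a_r_coset_def by (rule N.r_coset_hom_Mod)
  ultimately show ?thesis by (simp add: na_hom_def)
qed

end

lemma na_hom_iff:
  "h \<in> na_hom A S \<longleftrightarrow> (\<forall>x\<in>carrier A. h x \<in> carrier S) \<and>
    (\<forall>x\<in>carrier A. \<forall>y\<in>carrier A. h (x \<otimes>\<^bsub>A\<^esub> y) = h x \<otimes>\<^bsub>S\<^esub> h y \<and> h (x \<oplus>\<^bsub>A\<^esub> y) = h x \<oplus>\<^bsub>S\<^esub> h y)"
  by (auto simp: na_hom_def hom_def)

lemma na_hom_comp: "f \<in> na_hom A B \<Longrightarrow> g \<in> na_hom B C \<Longrightarrow> g \<circ> f \<in> na_hom A C"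
  by (auto simp: na_hom_iff)

lemma (in na_ring) subgroup_annihilator: "subgroup (annihilator R) (add_monoid R)"
proof (rule group.subgroupI[OF comm_group.axioms(2)[OF a_comm_group]])
  show "annihilator R \<subseteq> carrier (add_monoid R)" by (auto simp: annihilator_def)
  have "\<zero> \<in> annihilator R" using l_null r_null by (simp add: annihilator_def)
  then show "annihilator R \<noteq> {}" by blast
next
  fix a assume a: "a \<in> annihilator R"
  then have ac: "a \<in> carrier R" by (simp add: annihilator_def)
  have "\<ominus> a \<otimes> x = \<zero> \<and> x \<otimes> \<ominus> a = \<zero>" if x: "x \<in> carrier R" for x
  proof
    have ax: "a \<otimes> x = \<zero>" "x \<otimes> a = \<zero>" using a x by (auto simp: annihilator_def)
    have c: "\<ominus> a \<otimes> x \<in> carrier R" "x \<otimes> \<ominus> a \<in> carrier R" using ac x m_closed by auto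
    have "\<ominus> a \<otimes> x = \<ominus> a \<otimes> x \<oplus> a \<otimes> x" using ax c by simp
    also have "\<dots> = \<zero>" using l_distr[of "\<ominus> a" a x] ac x l_null by (simp add: l_neg)
    finally show "\<ominus> a \<otimes> x = \<zero>" .
    have "x \<otimes> \<ominus> a = x \<otimes> \<ominus> a \<oplus> x \<otimes> a" using ax c by simp
    also have "\<dots> = \<zero>" using r_distr[of "\<ominus> a" a x] ac x r_null by (simp add: l_neg)
    finally show "x \<otimes> \<ominus> a = \<zero>" .
  qed
  then show "inv\<^bsub>add_monoid R\<^esub> a \<in> annihilator R"
    using ac by (simp add: annihilator_def flip: a_inv_def)
next
  fix a b assume "a \<in> annihilator R" "b \<in> annihilator R"
  then show "a \<otimes>\<^bsub>add_monoid R\<^esub> b \<in> annihilator R"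
    by (auto simp: annihilator_def l_distr r_distr)
qed

lemma (in na_ring) ann_proj_hom: "ann_proj R \<in> na_hom R (ann_quotient R)"
  unfolding ann_proj_def[abs_def] ann_quotient_def
proof (rule Quot_map_hom[OF subgroup_annihilator])
  fix n x assume n: "n \<in> annihilator R" and x: "x \<in> carrier R"
  then have "n \<otimes> x = \<zero>" "x \<otimes> n = \<zero>" by (auto simp: annihilator_def)
  then show "n \<otimes> x \<in> annihilator R \<and> x \<otimes> n \<in> annihilator R"
    using subgroup.one_closed[OF subgroup_annihilator] by simp
qed

lemma na_hom_factor_surj:
  assumes q: "q \<in> na_hom A T" "q ` carrier A = carrier T" and h: "h \<in> na_hom A S"
    and closed: "\<And>x y. \<lbrakk>x \<in> carrier A; y \<in> carrier A\<rbrakk> \<Longrightarrow> x \<otimes>\<^bsub>A\<^esub> y \<in> carrier A \<and> x \<oplus>\<^bsub>A\<^esub> y \<in> carrier A"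
    and fibre: "\<And>x y. \<lbrakk>x \<in> carrier A; y \<in> carrier A; q x = q y\<rbrakk> \<Longrightarrow> h x = h y"
  shows "\<exists>g\<in>na_hom T S. \<forall>x\<in>carrier A. h x = g (q x)"
proof -
  define g where "g c = h (inv_into (carrier A) q c)" for c
  have g: "g (q x) = h x" if "x \<in> carrier A" for x
    unfolding g_def using that by (intro fibre) (auto simp: inv_into_into f_inv_into_f)
  have "g \<in> na_hom T S"
    unfolding na_hom_iff q(2)[symmetric] ball_simps
    using q(1) h closed by (auto simp: na_hom_iff g simp flip: g)
  then show ?thesis using g by metis
qed

lemma prod_ring_simps [simp]:
  "carrier (prod_ring I R) = (\<Pi>\<^sub>E i\<in>I. carrier (R i))"
  "x \<otimes>\<^bsub>prod_ring I R\<^esub> y = (\<lambda>i\<in>I. x i \<otimes>\<^bsub>R i\<^esub> y i)"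
  "x \<oplus>\<^bsub>prod_ring I R\<^esub> y = (\<lambda>i\<in>I. x i \<oplus>\<^bsub>R i\<^esub> y i)"
  "\<zero>\<^bsub>prod_ring I R\<^esub> = (\<lambda>i\<in>I. \<zero>\<^bsub>R i\<^esub>)"
  by (simp_all add: prod_ring_def)

lemma na_ring_abelian: "na_ring R \<Longrightarrow> abelian_group R"
  by (rule na_ring.axioms)

lemma na_ring_prod_ring:
  assumes R: "\<And>i. i \<in> I \<Longrightarrow> na_ring (R i)"
  shows "na_ring (prod_ring I R)"
proof -
  note ab = na_ring_abelian[OF R]
  note mon = abelian_group.axioms(1)[OF ab]
  have "abelian_group (prod_ring I R)"
  proof (rule abelian_groupI)
    fix x assume x: "x \<in> carrier (prod_ring I R)"
    show "\<exists>y\<in>carrier (prod_ring I R). y \<oplus>\<^bsub>prod_ring I R\<^esub> x = \<zero>\<^bsub>prod_ring I R\<^esub>"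
      using x by (intro bexI[of _ "\<lambda>i\<in>I. \<ominus>\<^bsub>R i\<^esub> x i"])
        (auto simp: PiE_iff fun_eq_iff restrict_def extensional_def intro: abelian_group.a_inv_closed[OF ab] abelian_group.l_neg[OF ab])
  qed (auto simp: PiE_iff fun_eq_iff restrict_def extensional_def intro: abelian_monoid.a_closed[OF mon]
      abelian_monoid.zero_closed[OF mon] abelian_monoid.a_assoc[OF mon] abelian_monoid.a_comm[OF mon]
      abelian_monoid.l_zero[OF mon])
  then show ?thesis
  proof (intro na_ring.intro na_ring_axioms.intro)
    fix x y assume x: "x \<in> carrier (prod_ring I R)" and y: "y \<in> carrier (prod_ring I R)"
    show "x \<otimes>\<^bsub>prod_ring I R\<^esub> y \<in> carrier (prod_ring I R)"
      using x y by (auto simp: PiE_iff na_ring.m_closed[OF R])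
    fix z assume z: "z \<in> carrier (prod_ring I R)"
    show "(x \<oplus>\<^bsub>prod_ring I R\<^esub> y) \<otimes>\<^bsub>prod_ring I R\<^esub> z
        = x \<otimes>\<^bsub>prod_ring I R\<^esub> z \<oplus>\<^bsub>prod_ring I R\<^esub> y \<otimes>\<^bsub>prod_ring I R\<^esub> z"
      using x y z by (auto simp: PiE_iff fun_eq_iff na_ring.l_distr[OF R])
    show "z \<otimes>\<^bsub>prod_ring I R\<^esub> (x \<oplus>\<^bsub>prod_ring I R\<^esub> y)
        = z \<otimes>\<^bsub>prod_ring I R\<^esub> x \<oplus>\<^bsub>prod_ring I R\<^esub> z \<otimes>\<^bsub>prod_ring I R\<^esub> y"
      using x y z by (auto simp: PiE_iff fun_eq_iff na_ring.r_distr[OF R])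
  qed
qed

section \<open>Factorization through ultraproducts\<close>

lemma ultra_map_hom:
  assumes R: "\<And>i. i \<in> I \<Longrightarrow> na_ring (R i)" and F: "ultrafilter_on I F"
  shows "ultra_map I R F \<in> na_hom (prod_ring I R) (ultraproduct I R F)"
proof -
  interpret P: na_ring "prod_ring I R" by (rule na_ring_prod_ring[OF R])
  have FI: "F \<le> principal I" using F by (simp add: ultrafilter_on_def)
  have inI: "\<forall>\<^sub>F i in F. i \<in> I" using FI by (simp add: le_principal)
  have "(\<lambda>x. null_ideal I R F +>\<^bsub>prod_ring I R\<^esub> x)
      \<in> na_hom (prod_ring I R) (prod_ring I R Quot null_ideal I R F)"
  proof (rule P.Quot_map_hom[OF subgroup_null_ideal[OF R FI]])
    fix n x assume n: "n \<in> null_ideal I R F" and x: "x \<in> carrier (prod_ring I R)"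
    have nc: "n \<in> carrier (prod_ring I R)" and n0: "\<forall>\<^sub>F i in F. n i = \<zero>\<^bsub>R i\<^esub>"
      using n by (auto simp: null_ideal_def)
    have "\<forall>\<^sub>F i in F. (n \<otimes>\<^bsub>prod_ring I R\<^esub> x) i = \<zero>\<^bsub>R i\<^esub> \<and> (x \<otimes>\<^bsub>prod_ring I R\<^esub> n) i = \<zero>\<^bsub>R i\<^esub>"
      using n0 inI
    proof eventually_elim
      case (elim i)
      then have "x i \<in> carrier (R i)" using x by (auto simp: PiE_iff)
      then show ?case
        using elim na_ring.l_null[OF R[OF elim(2)]] na_ring.r_null[OF R[OF elim(2)]] by simp
    qed
    then show "n \<otimes>\<^bsub>prod_ring I R\<^esub> x \<in> null_ideal I R F \<and> x \<otimes>\<^bsub>prod_ring I R\<^esub> n \<in> null_ideal I R F"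
      using P.m_closed[OF nc x] P.m_closed[OF x nc]
      by (auto simp: null_ideal_def elim: eventually_mono simp del: prod_ring_simps)
  qed
  then show ?thesis by (simp add: ultra_map_def[abs_def] ultraproduct_def)
qed

lemma carrier_ultraproduct:
  assumes R: "\<And>i. i \<in> I \<Longrightarrow> na_ring (R i)"
  shows "carrier (ultraproduct I R F) = ultra_map I R F ` carrier (prod_ring I R)"
proof -
  interpret P: na_ring "prod_ring I R" by (rule na_ring_prod_ring[OF R])
  show ?thesis unfolding ultraproduct_def ultra_map_def by (rule P.carrier_Quot)
qed

lemma ultrafilter_on_not:
  "ultrafilter_on I F \<Longrightarrow> \<not> eventually P F \<Longrightarrow> \<forall>\<^sub>F i in F. \<not> P i"
  by (auto simp: ultrafilter_on_def)

text \<open>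
  For two distinct ultrafilters some predicate is eventually true for one and eventually false for
  the other. The predicate for \<^term>\<open>F\<close> is the conjunction of the finitely many conditions that
  tell \<^term>\<open>F\<close> from the other members, in both directions to make it exclude theirs.
\<close>

lemma ultrafilters_separated:
  assumes fin: "finite \<U>" and uf: "\<And>F. F \<in> \<U> \<Longrightarrow> ultrafilter_on I F"
  obtains Q where "\<And>F. F \<in> \<U> \<Longrightarrow> eventually (Q F) F"
    "\<And>F F' i. \<lbrakk>F \<in> \<U>; F' \<in> \<U>; Q F i; Q F' i\<rbrakk> \<Longrightarrow> F = F'"
proof -
  have "\<exists>P. eventually P F \<and> (\<forall>\<^sub>F i in F'. \<not> P i)" if FF: "F \<in> \<U>" "F' \<in> \<U>" "F \<noteq> F'" for F F'
  proof -
    obtain P where "eventually P F \<noteq> eventually P F'" using FF(3) by (auto simp: filter_eq_iff)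
    then consider "eventually P F" "\<not> eventually P F'" | "\<not> eventually P F" "eventually P F'" by blast
    then show ?thesis
    proof cases
      case 1
      then show ?thesis using ultrafilter_on_not[OF uf[OF FF(2)]] by blast
    next
      case 2
      then show ?thesis using ultrafilter_on_not[OF uf[OF FF(1)]] by (intro exI[of _ "\<lambda>i. \<not> P i"]) auto
    qed
  qed
  then obtain P where P: "\<And>F F'. \<lbrakk>F \<in> \<U>; F' \<in> \<U>; F \<noteq> F'\<rbrakk> \<Longrightarrow>
      eventually (P F F') F \<and> (\<forall>\<^sub>F i in F'. \<not> P F F' i)"
    by metis
  define Q where "Q F i \<longleftrightarrow> (\<forall>F'\<in>\<U> - {F}. P F F' i \<and> \<not> P F' F i)" for F i
  show thesis
  proof
    show "eventually (Q F) F" if "F \<in> \<U>" for F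
      unfolding Q_def using fin P that
      by (intro eventually_ball_finite ballI eventually_conj) auto
    show "F = F'" if "F \<in> \<U>" "F' \<in> \<U>" "Q F i" "Q F' i" for F F' i
      using that by (auto simp: Q_def)
  qed
qed

text \<open>
  The value of \<^term>\<open>h\<close> at \<^term>\<open>x\<close> depends only on the images of \<^term>\<open>x\<close> in the ultraproducts with
  respect to the members of \<^term>\<open>\<U>\<close>.
\<close>

definition determined_by :: "'i set \<Rightarrow> ('i \<Rightarrow> 'a ring) \<Rightarrow> (('i \<Rightarrow> 'a) \<Rightarrow> 'c) \<Rightarrow> 'i filter set \<Rightarrow> bool" where
  "determined_by I R h \<U> \<longleftrightarrow> (\<forall>x\<in>carrier (prod_ring I R). \<forall>y\<in>carrier (prod_ring I R).
    (\<forall>F\<in>\<U>. \<forall>\<^sub>F i in F. x i = y i) \<longrightarrow> h x = h y)"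

text \<open>
  The ultrafilters are enumerated without repetition. Only then is the map to the product of the
  ultraproducts surjective, which is what makes the induced map on it a homomorphism defined
  everywhere: a preimage is pieced together along separating predicates.
\<close>

lemma factors_through_ultraproductsI:
  assumes R: "\<And>i. i \<in> I \<Longrightarrow> na_ring (R i)" and h: "h \<in> na_hom (prod_ring I R) S"
    and \<U>: "finite \<U>" "\<And>F. F \<in> \<U> \<Longrightarrow> ultrafilter_on I F \<and> \<Phi> F"
    and det: "determined_by I R h \<U>"
  shows "factors_through_ultraproducts \<Phi> I R S h"
proof -
  interpret P: na_ring "prod_ring I R" by (rule na_ring_prod_ring[OF R])
  obtain U where "bij_betw U {0..<card \<U>} \<U>" using ex_bij_betw_nat_finite[OF \<U>(1)] by blast
  then obtain n where U: "bij_betw U {..<n} \<U>" by (metis atLeast0LessThan)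
  then have inj: "inj_on U {..<n}" and Uim: "U ` {..<n} = \<U>" by (auto simp: bij_betw_def)
  have uf: "ultrafilter_on I (U k)" if "k < n" for k using that Uim \<U>(2) by auto
  let ?T = "prod_ring {..<n} (\<lambda>k. ultraproduct I R (U k))"
  define q where "q x = (\<lambda>k\<in>{..<n}. ultra_map I R (U k) x)" for x
  have q: "q \<in> na_hom (prod_ring I R) ?T"
    unfolding na_hom_iff
  proof (intro conjI ballI)
    have hom: "ultra_map I R (U k) \<in> na_hom (prod_ring I R) (ultraproduct I R (U k))" if "k < n" for k
      by (rule ultra_map_hom[OF R uf[OF that]])
    note hom = hom[unfolded na_hom_iff]
    fix x assume x: "x \<in> carrier (prod_ring I R)"
    have "ultra_map I R (U k) x \<in> carrier (ultraproduct I R (U k))" if "k < n" for k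
      using hom[OF that] x by blast
    then show "q x \<in> carrier ?T" by (simp add: q_def)
    fix y assume y: "y \<in> carrier (prod_ring I R)"
    show "q (x \<otimes>\<^bsub>prod_ring I R\<^esub> y) = q x \<otimes>\<^bsub>?T\<^esub> q y"
      unfolding q_def prod_ring_simps(2)[of "{..<n}"]
      by (intro restrict_ext) (use hom x y in \<open>simp del: prod_ring_simps\<close>)
    show "q (x \<oplus>\<^bsub>prod_ring I R\<^esub> y) = q x \<oplus>\<^bsub>?T\<^esub> q y"
      unfolding q_def prod_ring_simps(3)[of "{..<n}"]
      by (intro restrict_ext) (use hom x y in \<open>simp del: prod_ring_simps\<close>)
  qed
  have "c \<in> q ` carrier (prod_ring I R)" if c: "c \<in> carrier ?T" for c
  proof -
    have "\<forall>k\<in>{..<n}. \<exists>x. x \<in> carrier (prod_ring I R) \<and> ultra_map I R (U k) x = c k"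
    proof
      fix k assume "k \<in> {..<n}"
      then have "c k \<in> carrier (ultraproduct I R (U k))" using c by auto
      also have "\<dots> = ultra_map I R (U k) ` carrier (prod_ring I R)"
        by (rule carrier_ultraproduct[OF R])
      finally show "\<exists>x. x \<in> carrier (prod_ring I R) \<and> ultra_map I R (U k) x = c k"
        by (blast intro: sym)
    qed
    then obtain x where x: "\<And>k. k < n \<Longrightarrow> x k \<in> carrier (prod_ring I R)"
      "\<And>k. k < n \<Longrightarrow> ultra_map I R (U k) (x k) = c k"
      by (metis lessThan_iff)
    obtain Q where Q: "\<And>F. F \<in> \<U> \<Longrightarrow> eventually (Q F) F"
      "\<And>F F' i. \<lbrakk>F \<in> \<U>; F' \<in> \<U>; Q F i; Q F' i\<rbrakk> \<Longrightarrow> F = F'"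
      using ultrafilters_separated[of \<U> I] \<U> by blast
    have uniq: "k = l" if "k < n" "l < n" "Q (U k) i" "Q (U l) i" for k l i
      using Q(2)[of "U k" "U l" i] that Uim inj_onD[OF inj, of k l] by auto
    define z where "z = (\<lambda>i\<in>I. if \<exists>k<n. Q (U k) i then x (THE k. k < n \<and> Q (U k) i) i else \<zero>\<^bsub>R i\<^esub>)"
    have z_eq: "z i = x k i" if "i \<in> I" "k < n" "Q (U k) i" for i k
    proof -
      have "(THE k. k < n \<and> Q (U k) i) = k" using uniq that by blast
      then show ?thesis using that by (auto simp: z_def)
    qed
    have z: "z \<in> carrier (prod_ring I R)"
    proof -
      have "z i \<in> carrier (R i)" if "i \<in> I" for i
      proof (cases "\<exists>k<n. Q (U k) i")
        case True
        then show ?thesis using z_eq[OF that] x(1) that by (auto simp: PiE_iff)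
      next
        case False
        then have "z i = \<zero>\<^bsub>R i\<^esub>" using that unfolding z_def by auto
        then show ?thesis
          using abelian_monoid.zero_closed[OF abelian_group.axioms(1)[OF na_ring_abelian[OF R[OF that]]]]
          by simp
      qed
      then show ?thesis by (auto simp: z_def)
    qed
    have "ultra_map I R (U k) z = c k" if k: "k < n" for k
    proof -
      have "\<forall>\<^sub>F i in U k. i \<in> I" using uf[OF k] by (simp add: ultrafilter_on_def le_principal)
      moreover have "eventually (Q (U k)) (U k)" using Q(1) k Uim by blast
      ultimately have "\<forall>\<^sub>F i in U k. z i = x k i" by eventually_elim (use z_eq k in auto)
      then show ?thesis using ultra_map_eq_iff[OF R uf[OF k] z x(1)[OF k]] x(2)[OF k] by simp
    qed
    then have "c = q z" using c by (auto simp: q_def fun_eq_iff PiE_iff extensional_def)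
    then show ?thesis using z by blast
  qed
  then have surj: "q ` carrier (prod_ring I R) = carrier ?T"
    using q by (auto simp: na_hom_iff simp del: prod_ring_simps)
  have fibre: "h x = h y"
    if xy: "x \<in> carrier (prod_ring I R)" "y \<in> carrier (prod_ring I R)" "q x = q y" for x y
  proof -
    have "\<forall>\<^sub>F i in F. x i = y i" if F: "F \<in> \<U>" for F
    proof -
      obtain k where k: "k < n" "F = U k" using F Uim by auto
      have "ultra_map I R F x = ultra_map I R F y" using fun_cong[OF xy(3), of k] k by (simp add: q_def)
      then show ?thesis using ultra_map_eq_iff[OF R uf[OF k(1)] xy(1,2)] k(2) by simp
    qed
    then show ?thesis using det xy unfolding determined_by_def by blast
  qed
  have "\<exists>g\<in>na_hom ?T S. \<forall>x\<in>carrier (prod_ring I R). h x = g (q x)"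
    by (rule na_hom_factor_surj[OF q surj h conjI[OF P.m_closed P.a_closed] fibre])
  moreover have "\<forall>k<n. ultrafilter_on I (U k) \<and> \<Phi> (U k)" using \<U>(2) Uim by blast
  ultimately show ?thesis
    unfolding factors_through_ultraproducts_def q_def by blast
qed

lemma factors_through_ultraproducts_iff:
  assumes rings: "\<forall>i\<in>I. na_ring (R i)" and h: "h \<in> na_hom (prod_ring I R) S"
  shows "factors_through_ultraproducts \<Phi> I R S h \<longleftrightarrow>
    (\<exists>\<U>. finite \<U> \<and> (\<forall>F\<in>\<U>. ultrafilter_on I F \<and> \<Phi> F) \<and> determined_by I R h \<U>)"
    (is "?L \<longleftrightarrow> ?R")
proof
  note R = rings[rule_format]
  assume ?L
  then obtain n :: nat and U g where U: "\<And>k. k < n \<Longrightarrow> ultrafilter_on I (U k) \<and> \<Phi> (U k)"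
    and g: "\<And>x. x \<in> carrier (prod_ring I R) \<Longrightarrow> h x = g (\<lambda>k\<in>{..<n}. ultra_map I R (U k) x)"
    unfolding factors_through_ultraproducts_def by blast
  have "determined_by I R h (U ` {..<n})"
    unfolding determined_by_def
  proof (intro ballI impI)
    fix x y assume xy: "x \<in> carrier (prod_ring I R)" "y \<in> carrier (prod_ring I R)"
      and eq: "\<forall>F\<in>U ` {..<n}. \<forall>\<^sub>F i in F. x i = y i"
    have "ultra_map I R (U k) x = ultra_map I R (U k) y" if "k < n" for k
      using ultra_map_eq_iff[OF R _ xy, of "U k"] U[OF that] eq that by auto
    then have "(\<lambda>k\<in>{..<n}. ultra_map I R (U k) x) = (\<lambda>k\<in>{..<n}. ultra_map I R (U k) y)"
      by (intro restrict_ext) simp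
    then show "h x = h y" using g[OF xy(1)] g[OF xy(2)] by simp
  qed
  then show ?R using U by (intro exI[of _ "U ` {..<n}"]) auto
next
  note R = rings[rule_format]
  assume ?R
  then show ?L using factors_through_ultraproductsI[where I = I and R = R, OF _ h] R by blast
qed

section \<open>Limit homomorphisms from ultrafilters that are not countably complete\<close>

text \<open>
  Choose \<open>z\<close> that vanishes modulo the other ultrafilters and has \<open>h(z) \<noteq> 0\<close>, and predicates \<open>A\<^sub>n\<close>
  that hold eventually but not jointly. Let \<open>N(i)\<close> be the first \<open>n\<close> for which \<open>A\<^sub>n(i)\<close> fails. Multiplying
  \<open>z(i)\<close> by \<open>a(N(i))\<close> before applying \<open>h\<close> is additive in \<open>a\<close>. If \<open>a\<close> has finite support, the resulting
  element vanishes where \<open>A\<^sub>n\<close> holds for all \<open>n\<close> in the support, hence modulo \<open>F\<close>. For \<open>a = 1\<close> it agrees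
  with \<open>z\<close> wherever some \<open>A\<^sub>n\<close> fails, hence modulo \<open>F\<close>.
\<close>

lemma limit_hom_if_not_countably_complete:
  assumes R: "\<And>i. i \<in> I \<Longrightarrow> na_ring (R i)" and S: "comm_group (add_monoid S)"
    and h: "h \<in> na_hom (prod_ring I R) S"
    and F: "ultrafilter_on I F" "\<not> countably_complete F"
    and det: "determined_by I R h \<U>" and ndet: "\<not> determined_by I R h (\<U> - {F})"
  shows "\<exists>L. limit_hom (add_monoid S) L \<and> L (\<lambda>_. 1) \<noteq> \<zero>\<^bsub>S\<^esub>"
proof -
  let ?P = "prod_ring I R" and ?G = "\<lambda>i. add_monoid (R i)"
  interpret P: na_ring ?P by (rule na_ring_prod_ring[OF R])
  interpret S: comm_group "add_monoid S" by (rule S)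
  interpret h: group_hom "add_monoid ?P" "add_monoid S" h
    using h P.a_comm_group S by (simp add: na_hom_def group_hom_def group_hom_axioms_def comm_group_def)
  have G: "comm_group (?G i)" if "i \<in> I" for i
    using na_ring_abelian[OF R[OF that]] by (rule abelian_group.a_comm_group)
  note Gg = comm_group.axioms(2)[OF G]
  obtain x y where x: "x \<in> carrier ?P" and y: "y \<in> carrier ?P" and hxy: "h x \<noteq> h y"
    and xy: "\<And>F'. F' \<in> \<U> - {F} \<Longrightarrow> \<forall>\<^sub>F i in F'. x i = y i"
    using ndet unfolding determined_by_def by blast
  define z where "z = x \<ominus>\<^bsub>?P\<^esub> y"
  have z: "z \<in> carrier ?P" unfolding z_def using x y by (rule P.minus_closed)
  have zc: "z i \<in> carrier (R i)" if "i \<in> I" for i using z that by (simp add: PiE_iff)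
  have zy: "z \<oplus>\<^bsub>?P\<^esub> y = x" unfolding z_def using x y
    by (simp add: P.minus_eq P.a_assoc P.l_neg del: prod_ring_simps)
  have hz: "h z \<noteq> \<zero>\<^bsub>S\<^esub>"
  proof
    assume "h z = \<zero>\<^bsub>S\<^esub>"
    then have "h x = h y" using h.hom_mult[of z y] z y zy h.hom_closed[of y] S.l_one by simp
    then show False using hxy by simp
  qed
  have z0: "\<forall>\<^sub>F i in F'. i \<in> I \<longrightarrow> z i = \<zero>\<^bsub>R i\<^esub>" if "F' \<in> \<U> - {F}" for F'
    using xy[OF that]
  proof eventually_elim
    case (elim i)
    show ?case
    proof
      assume i: "i \<in> I"
      have "z i \<oplus>\<^bsub>R i\<^esub> y i = y i" using fun_cong[OF zy, of i] i elim by simp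
      then show "z i = \<zero>\<^bsub>R i\<^esub>"
        using group.r_cancel_one[OF Gg[OF i], of "y i" "z i"] zc[OF i] y i by (auto simp: PiE_iff)
    qed
  qed
  obtain A where A: "\<And>n::nat. eventually (A n) F" and "\<not> (\<forall>\<^sub>F i in F. \<forall>n. A n i)"
    using F(2) unfolding countably_complete_def by blast
  then have ex: "\<forall>\<^sub>F i in F. \<exists>n. \<not> A n i" using ultrafilter_on_not[OF F(1)] by fastforce
  have inI: "\<forall>\<^sub>F i in F. i \<in> I" using F(1) by (simp add: ultrafilter_on_def le_principal)
  define N where "N i = (LEAST n. \<not> A n i)" for i
  define m where "m a = (\<lambda>i\<in>I. if \<exists>n. \<not> A n i then z i [^]\<^bsub>?G i\<^esub> (a (N i) :: int) else \<zero>\<^bsub>R i\<^esub>)" for a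
  have mc: "m a \<in> carrier ?P" for a
    using zc group.int_pow_closed[OF Gg] monoid.one_closed[OF group.is_monoid[OF Gg]]
    by (auto simp: m_def)
  have m_add: "m (\<lambda>n. a n + b n) = m a \<oplus>\<^bsub>?P\<^esub> m b" for a b
  proof -
    have "\<zero>\<^bsub>R i\<^esub> = \<zero>\<^bsub>R i\<^esub> \<oplus>\<^bsub>R i\<^esub> \<zero>\<^bsub>R i\<^esub>" if "i \<in> I" for i
      using monoid.l_one[OF group.is_monoid[OF Gg[OF that]] monoid.one_closed[OF group.is_monoid[OF Gg[OF that]]]] by simp
    moreover have "z i [^]\<^bsub>?G i\<^esub> (k + l :: int) = z i [^]\<^bsub>?G i\<^esub> k \<oplus>\<^bsub>R i\<^esub> z i [^]\<^bsub>?G i\<^esub> l" if "i \<in> I" for i k l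
      using group.int_pow_mult[OF Gg[OF that], of "z i" k l] zc[OF that] by simp
    ultimately show ?thesis by (auto simp: m_def fun_eq_iff)
  qed
  have m_zero: "\<forall>\<^sub>F i in F'. i \<in> I \<longrightarrow> m a i = \<zero>\<^bsub>R i\<^esub>" if "F' \<in> \<U> - {F}" for F' a
    using z0[OF that]
  proof eventually_elim
    case (elim i)
    then show ?case using group.int_pow_one[OF Gg, of i] by (auto simp: m_def)
  qed
  define L where "L a = h (m a)" for a
  have "limit_hom (add_monoid S) L"
  proof
    show "L \<in> hom int_seq_group (add_monoid S)"
      using h.hom_closed h.hom_mult mc m_add by (auto simp: hom_def L_def simp del: prod_ring_simps)
    show "L a = \<one>\<^bsub>add_monoid S\<^esub>" if van: "\<forall>\<^sub>F n in sequentially. a n = 0" for a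
    proof -
      obtain n0 where n0: "\<And>n. n \<ge> n0 \<Longrightarrow> a n = 0" using van by (auto simp: eventually_sequentially)
      have "\<forall>\<^sub>F i in F. \<forall>n\<in>{..<n0}. A n i" using A by (intro eventually_ball_finite) auto
      then have mF: "\<forall>\<^sub>F i in F. i \<in> I \<longrightarrow> m a i = \<zero>\<^bsub>R i\<^esub>"
      proof eventually_elim
        case (elim i)
        show ?case
        proof
          assume i: "i \<in> I"
          show "m a i = \<zero>\<^bsub>R i\<^esub>"
          proof (cases "\<exists>n. \<not> A n i")
            case True
            then have "\<not> A (N i) i" unfolding N_def by (rule LeastI_ex)
            then have "a (N i) = 0" using elim n0 by (metis lessThan_iff not_le)
            then show ?thesis using i by (simp add: m_def)
          qed (use i in \<open>simp add: m_def\<close>)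
        qed
      qed
      have "h (m a) = h \<zero>\<^bsub>?P\<^esub>"
      proof (rule det[unfolded determined_by_def, rule_format, OF mc P.zero_closed])
        fix F' assume F': "F' \<in> \<U>"
        have e: "\<forall>\<^sub>F i in F'. i \<in> I \<longrightarrow> m a i = \<zero>\<^bsub>R i\<^esub>"
          using mF m_zero[of F' a] F' by (cases "F' = F") auto
        then show "\<forall>\<^sub>F i in F'. m a i = \<zero>\<^bsub>?P\<^esub> i"
          by eventually_elim (auto simp: m_def)
      qed
      then show ?thesis unfolding L_def using h.hom_one by simp
    qed
  qed
  moreover have "L (\<lambda>_. 1) = h z"
    unfolding L_def
  proof (rule det[unfolded determined_by_def, rule_format, OF mc z])
    fix F' assume F': "F' \<in> \<U>"
    show "\<forall>\<^sub>F i in F'. m (\<lambda>_. 1) i = z i"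
    proof (cases "F' = F")
      case True
      show ?thesis
        unfolding True using ex inI
        by eventually_elim (use zc group.int_pow_1[OF Gg] in \<open>auto simp: m_def\<close>)
    next
      case False
      then have "F' \<in> \<U> - {F}" using F' by blast
      show ?thesis
        using m_zero[OF \<open>F' \<in> \<U> - {F}\<close>, of "\<lambda>_. 1"] z0[OF \<open>F' \<in> \<U> - {F}\<close>]
        by eventually_elim (use z in \<open>auto simp: m_def PiE_iff extensional_def\<close>)
    qed
  qed
  ultimately show ?thesis using hz by metis
qed

text \<open>
  A determining set of least cardinality has a member that is not countably complete and that cannot
  be left out.
\<close>

lemma limit_hom_if_not_factors:
  assumes rings: "\<forall>i\<in>I. na_ring (R i)" and S: "comm_group (add_monoid S)"
    and h: "h \<in> na_hom (prod_ring I R) S"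
    and fac: "factors_through_ultraproducts (\<lambda>_. True) I R S h"
    and nfac: "\<not> factors_through_ultraproducts countably_complete I R S h"
  shows "\<exists>L. limit_hom (add_monoid S) L \<and> L (\<lambda>_. 1) \<noteq> \<zero>\<^bsub>S\<^esub>"
proof -
  define \<A> where "\<A> = {\<U>. finite \<U> \<and> (\<forall>F\<in>\<U>. ultrafilter_on I F) \<and> determined_by I R h \<U>}"
  have "\<exists>\<U>. \<U> \<in> \<A>"
    using fac unfolding factors_through_ultraproducts_iff[OF rings h] \<A>_def by blast
  then obtain \<U> where \<U>: "\<U> \<in> \<A>" and min: "\<forall>\<V>. \<V> \<in> \<A> \<longrightarrow> card \<U> \<le> card \<V>"
    using ex_has_least_nat[of "\<lambda>\<U>. \<U> \<in> \<A>" _ card] by blast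
  have fin: "finite \<U>" and uf: "\<forall>F\<in>\<U>. ultrafilter_on I F" and det: "determined_by I R h \<U>"
    using \<U> by (simp_all add: \<A>_def)
  have "\<not> (\<forall>F\<in>\<U>. countably_complete F)"
  proof
    assume "\<forall>F\<in>\<U>. countably_complete F"
    then have "\<forall>F\<in>\<U>. ultrafilter_on I F \<and> countably_complete F" using uf by blast
    then show False
      using nfac fin det unfolding factors_through_ultraproducts_iff[OF rings h] by blast
  qed
  then obtain F where F: "F \<in> \<U>" "\<not> countably_complete F" by blast
  have ndet: "\<not> determined_by I R h (\<U> - {F})"
  proof
    assume "determined_by I R h (\<U> - {F})"
    then have "\<U> - {F} \<in> \<A>" using fin uf by (simp add: \<A>_def)
    then have "card \<U> \<le> card (\<U> - {F})" using min by blast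
    then show False using card_Diff1_less[OF fin F(1)] by simp
  qed
  show ?thesis
  proof (rule limit_hom_if_not_countably_complete[OF _ S h _ F(2) det ndet])
    show "na_ring (R i)" if "i \<in> I" for i using rings that by blast
    show "ultrafilter_on I F" using uf F(1) by blast
  qed
qed

section \<open>Countably complete ultrafilters and measurable cardinals\<close>

lemma ultrafilter_on_principal: "x \<in> I \<Longrightarrow> ultrafilter_on I (principal {x})"
  by (auto simp: ultrafilter_on_def eventually_principal principal_eq_bot_iff)

lemma countably_complete_principal: "countably_complete (principal A)"
  by (auto simp: countably_complete_def eventually_principal)

lemma ultrafilter_on_singleton:
  assumes "ultrafilter_on I F" "\<forall>\<^sub>F i in F. i = x"
  shows "F = principal {x}"
proof -
  have ne: "\<not> eventually (\<lambda>_. False) F"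
    using assms(1) by (simp add: ultrafilter_on_def flip: trivial_limit_def)
  have "eventually P F \<longleftrightarrow> P x" for P
  proof
    assume "eventually P F"
    from this assms(2) have "\<forall>\<^sub>F i in F. P x" by eventually_elim auto
    then show "P x" using ne by (cases "P x") auto
  next
    assume "P x"
    from assms(2) show "eventually P F" by eventually_elim (use \<open>P x\<close> in simp)
  qed
  then show ?thesis by (simp add: filter_eq_iff eventually_principal)
qed

text \<open>
  Let \<^term>\<open>K\<close> be an index set of least cardinality for a family of large sets whose intersection is
  not large. The complements of points show that \<^term>\<open>K\<close> is no larger than \<^term>\<open>I\<close>, and countable
  completeness makes it uncountable. Sending each point outside the intersection to the index of a
  set that misses it pushes the ultrafilter forward to \<^term>\<open>K\<close>; completeness of the image below
  the cardinal of \<^term>\<open>K\<close> is the minimality of \<^term>\<open>K\<close>.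
\<close>

lemma uncountable_measurable_if_nonprincipal:
  fixes I :: "'i set"
  assumes F: "ultrafilter_on I F" and cc: "countably_complete F"
    and np: "\<And>x. x \<in> I \<Longrightarrow> F \<noteq> principal {x}"
  shows "\<exists>K :: 'i set. uncountable_measurable K \<and> (card_of K, card_of I) \<in> ordLeq"
proof -
  have ne: "\<not> eventually (\<lambda>_. False) F" and FI: "\<forall>\<^sub>F i in F. i \<in> I"
    using F by (simp_all add: ultrafilter_on_def le_principal flip: trivial_limit_def)
  define bad where "bad K \<longleftrightarrow> (\<exists>S :: 'i \<Rightarrow> 'i set.
    (\<forall>k\<in>K. \<forall>\<^sub>F i in F. i \<in> S k) \<and> \<not> (\<forall>\<^sub>F i in F. \<forall>k\<in>K. i \<in> S k))" for K :: "'i set"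
  have "bad I"
    unfolding bad_def
  proof (intro exI conjI ballI notI)
    fix k assume "k \<in> I"
    then have "\<not> (\<forall>\<^sub>F i in F. i = k)" using ultrafilter_on_singleton[OF F] np by blast
    then show "\<forall>\<^sub>F i in F. i \<in> - {k}" using ultrafilter_on_not[OF F] by simp
  next
    assume "\<forall>\<^sub>F i in F. \<forall>k\<in>I. i \<in> - {k}"
    with FI have "\<forall>\<^sub>F i in F. False" by eventually_elim blast
    then show False using ne by blast
  qed
  have "wf (inv_image ordLess (card_of :: 'i set \<Rightarrow> 'i rel))" using wf_ordLess by (rule wf_inv_image)
  then obtain K where K: "bad K"
    and min: "\<And>K'. (card_of K', card_of K) \<in> ordLess \<Longrightarrow> \<not> bad K'"
    using wfE_min[of _ I "Collect bad"] \<open>bad I\<close> by (metis in_inv_image mem_Collect_eq)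
  obtain S where S: "\<And>k. k \<in> K \<Longrightarrow> \<forall>\<^sub>F i in F. i \<in> S k" "\<not> (\<forall>\<^sub>F i in F. \<forall>k\<in>K. i \<in> S k)"
    using K unfolding bad_def by blast
  have KI: "(card_of K, card_of I) \<in> ordLeq"
    using min[of I] \<open>bad I\<close> card_of_Well_order not_ordLess_iff_ordLeq by blast
  have "uncountable K"
  proof
    assume "countable K"
    have "K \<noteq> {}" using S(2) by auto
    then obtain f :: "nat \<Rightarrow> 'i" where f: "range f = K" using \<open>countable K\<close> by (metis range_from_nat_into)
    then have "\<forall>n. \<forall>\<^sub>F i in F. i \<in> S (f n)" using S(1) by blast
    then have "\<forall>\<^sub>F i in F. \<forall>n. i \<in> S (f n)"
      using cc[unfolded countably_complete_def, rule_format, of "\<lambda>n i. i \<in> S (f n)"] by blast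
    then show False using S(2) f by auto
  qed
  moreover
  \<comment> \<open>the fibre of g over k is disjoint from the large set S k, so the image is nonprincipal\<close>
  define g where "g i = (SOME k. k \<in> K \<and> i \<notin> S k)" for i
  have g: "\<forall>\<^sub>F i in F. g i \<in> K \<and> i \<notin> S (g i)"
    using ultrafilter_on_not[OF F S(2)]
  proof eventually_elim
    case (elim i)
    then show ?case unfolding g_def using someI_ex[of "\<lambda>k. k \<in> K \<and> i \<notin> S k"] by blast
  qed
  let ?V = "filtermap g F"
  have "ultrafilter_on K ?V"
  proof -
    have "\<forall>\<^sub>F i in F. g i \<in> K" using g by eventually_elim simp
    then show ?thesis
      using F unfolding ultrafilter_on_def
      by (auto simp: filtermap_bot_iff le_principal eventually_filtermap)
  qed
  moreover have "?V \<noteq> principal {x}" if "x \<in> K" for x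
  proof
    assume "?V = principal {x}"
    then have "\<forall>\<^sub>F k in ?V. k = x" by (simp add: eventually_principal)
    then have "\<forall>\<^sub>F i in F. g i = x" by (simp add: eventually_filtermap)
    with g S(1)[OF that] have "\<forall>\<^sub>F i in F. False" by eventually_elim auto
    then show False using ne by blast
  qed
  moreover have "\<forall>\<^sub>F k in ?V. k \<in> \<Inter>\<S>"
    if card: "(card_of \<S>, card_of K) \<in> ordLess" and ev: "\<forall>T\<in>\<S>. \<forall>\<^sub>F k in ?V. k \<in> T" for \<S> :: "'i set set"
  proof (rule ccontr)
    assume neg: "\<not> (\<forall>\<^sub>F k in ?V. k \<in> \<Inter>\<S>)"
    have "(card_of \<S>, card_of K) \<in> ordLeq" using card by (rule ordLess_imp_ordLeq)
    then obtain e :: "'i set \<Rightarrow> 'i" where e: "inj_on e \<S>"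
      using card_of_ordLeq[of \<S> K] by auto
    have "(card_of (e ` \<S>), card_of K) \<in> ordLess"
      by (rule ordLeq_ordLess_trans[OF card_of_image card])
    then have "\<not> bad (e ` \<S>)" by (rule min)
    moreover have "bad (e ` \<S>)"
      unfolding bad_def
    proof (intro exI conjI ballI)
      show "\<forall>\<^sub>F i in F. i \<in> g -` inv_into \<S> e k" if "k \<in> e ` \<S>" for k
        using that ev e by (auto simp: eventually_filtermap)
      show "\<not> (\<forall>\<^sub>F i in F. \<forall>k\<in>e ` \<S>. i \<in> g -` inv_into \<S> e k)"
        using neg e by (simp add: eventually_filtermap)
    qed
    ultimately show False by blast
  qed
  ultimately have "uncountable_measurable K"
    unfolding uncountable_measurable_def by blast
  then show ?thesis using KI by blast
qed

lemma principal_if_below_measurable_cardinals: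
  assumes "below_measurable_cardinals I" "ultrafilter_on I F" "countably_complete F"
  shows "\<exists>x\<in>I. F = principal {x}"
  using uncountable_measurable_if_nonprincipal[OF assms(2,3)] assms(1) not_ordLeq_ordLess
  unfolding below_measurable_cardinals_def by blast

text \<open>
  Agreement modulo the principal ultrafilter at \<^term>\<open>j\<close> is equality of the coordinates at
  \<^term>\<open>j\<close>.
\<close>

lemma factors_through_finite_product_iff:
  assumes rings: "\<forall>i\<in>I. na_ring (R i)" and h: "h \<in> na_hom (prod_ring I R) S"
  shows "factors_through_finite_product I R S h \<longleftrightarrow>
    (\<exists>J. finite J \<and> J \<subseteq> I \<and> determined_by I R h ((\<lambda>j. principal {j}) ` J))" (is "?L \<longleftrightarrow> ?R")
proof
  assume ?L
  then obtain J g where J: "finite J" "J \<subseteq> I"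
    and g: "\<And>x. x \<in> carrier (prod_ring I R) \<Longrightarrow> h x = g (restrict x J)"
    unfolding factors_through_finite_product_def by blast
  have "determined_by I R h ((\<lambda>j. principal {j}) ` J)"
    unfolding determined_by_def
  proof (intro ballI impI)
    fix x y assume xy: "x \<in> carrier (prod_ring I R)" "y \<in> carrier (prod_ring I R)"
      and eq: "\<forall>F\<in>(\<lambda>j. principal {j}) ` J. \<forall>\<^sub>F i in F. x i = y i"
    then have "restrict x J = restrict y J"
      by (intro restrict_ext) (simp add: eventually_principal)
    then show "h x = h y" using g[OF xy(1)] g[OF xy(2)] by simp
  qed
  then show ?R using J by blast
next
  assume ?R
  then obtain J where J: "finite J" "J \<subseteq> I" and det: "determined_by I R h ((\<lambda>j. principal {j}) ` J)"
    by blast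
  interpret P: na_ring "prod_ring I R" by (rule na_ring_prod_ring[OF rings[rule_format]])
  let ?q = "\<lambda>x. restrict x J"
  have q: "?q \<in> na_hom (prod_ring I R) (prod_ring J R)"
    unfolding na_hom_iff using J(2) by (auto simp: fun_eq_iff PiE_iff)
  have "c \<in> ?q ` carrier (prod_ring I R)" if c: "c \<in> carrier (prod_ring J R)" for c
  proof
    let ?x = "\<lambda>i\<in>I. if i \<in> J then c i else \<zero>\<^bsub>R i\<^esub>"
    show "?x \<in> carrier (prod_ring I R)"
      using c abelian_monoid.zero_closed[OF abelian_group.axioms(1)[OF na_ring_abelian[OF rings[rule_format]]]]
      by (auto simp: PiE_iff)
    show "c = ?q ?x" using c J(2) by (auto simp: fun_eq_iff PiE_iff extensional_def)
  qed
  then have surj: "?q ` carrier (prod_ring I R) = carrier (prod_ring J R)"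
    using q by (auto simp: na_hom_iff simp del: prod_ring_simps)
  have fibre: "h x = h y" if "x \<in> carrier (prod_ring I R)" "y \<in> carrier (prod_ring I R)" "?q x = ?q y" for x y
  proof (rule det[unfolded determined_by_def, rule_format, OF that(1,2)])
    fix F assume "F \<in> (\<lambda>j. principal {j}) ` J"
    then obtain j where "j \<in> J" "F = principal {j}" by blast
    then show "\<forall>\<^sub>F i in F. x i = y i"
      using fun_cong[OF that(3), of j] by (simp add: eventually_principal)
  qed
  have "\<exists>g\<in>na_hom (prod_ring J R) S. \<forall>x\<in>carrier (prod_ring I R). h x = g (?q x)"
    by (rule na_hom_factor_surj[OF q surj h conjI[OF P.m_closed P.a_closed] fibre])
  then show ?L unfolding factors_through_finite_product_def using J by blast
qed

lemma countably_complete_iff_finite_product: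
  assumes rings: "\<forall>i\<in>I. na_ring (R i)" and h: "h \<in> na_hom (prod_ring I R) S"
    and below: "below_measurable_cardinals I"
  shows "factors_through_ultraproducts countably_complete I R S h \<longleftrightarrow> factors_through_finite_product I R S h"
proof
  assume "factors_through_ultraproducts countably_complete I R S h"
  then obtain \<U> where \<U>: "finite \<U>" "\<forall>F\<in>\<U>. ultrafilter_on I F \<and> countably_complete F"
    and det: "determined_by I R h \<U>"
    unfolding factors_through_ultraproducts_iff[OF rings h] by blast
  have "\<forall>F\<in>\<U>. \<exists>x. x \<in> I \<and> F = principal {x}"
    using principal_if_below_measurable_cardinals[OF below] \<U>(2) by blast
  then obtain x where x: "\<forall>F\<in>\<U>. x F \<in> I \<and> F = principal {x F}" by (rule bchoice[THEN exE])
  have xI: "x ` \<U> \<subseteq> I" by (intro image_subsetI) (rule conjunct1[OF bspec[OF x]])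
  have "(\<lambda>j. principal {j}) ` x ` \<U> = (\<lambda>F. F) ` \<U>"
    unfolding image_image
    by (rule image_cong[OF refl]) (rule conjunct2[OF bspec[OF x], symmetric])
  then have "determined_by I R h ((\<lambda>j. principal {j}) ` x ` \<U>)" using det by simp
  moreover have "finite (x ` \<U>)" using \<U>(1) by simp
  ultimately show "factors_through_finite_product I R S h"
    unfolding factors_through_finite_product_iff[OF rings h] using xI by blast
next
  assume "factors_through_finite_product I R S h"
  then obtain J where J: "finite J" "J \<subseteq> I" "determined_by I R h ((\<lambda>j. principal {j}) ` J)"
    unfolding factors_through_finite_product_iff[OF rings h] by blast
  have "\<forall>F\<in>(\<lambda>j. principal {j}) ` J. ultrafilter_on I F \<and> countably_complete F"
    using J(2) by (auto intro: ultrafilter_on_principal countably_complete_principal)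
  then show "factors_through_ultraproducts countably_complete I R S h"
    unfolding factors_through_ultraproducts_iff[OF rings h] using J(1,3) by blast
qed

section \<open>Images of direct products modulo their annihilators\<close>

theorem theorem40:
  fixes I :: "'i set" and R :: "'i \<Rightarrow> 'a ring" and B :: "'b ring"
    and f :: "('i \<Rightarrow> 'a) \<Rightarrow> 'b"
  assumes "\<And>i. i \<in> I \<Longrightarrow> na_ring (R i)"
    and "na_ring B"
    and "f \<in> na_hom (prod_ring I R) B"
    and "f ` carrier (prod_ring I R) = carrier B"
    and "factors_through_ultraproducts (\<lambda>_. True) I R (ann_quotient B) (ann_proj B \<circ> f)"
  shows
    "(\<not> factors_through_ultraproducts countably_complete I R (ann_quotient B) (ann_proj B \<circ> f)
        \<longrightarrow> (let G = add_monoid (ann_quotient B) in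
          has_nonzero_cotorsion_subgroup G \<and>
          (has_nonzero_cotorsion_subgroup G \<longleftrightarrow>
            (\<exists>x\<in>carrier G. x \<noteq> \<one>\<^bsub>G\<^esub> \<and> (\<exists>n::nat. 0 < n \<and> x [^]\<^bsub>G\<^esub> n = \<one>\<^bsub>G\<^esub>)) \<or>
            (\<exists>h. h \<in> mon rat_group G) \<or>
            (\<exists>p::nat. prime p \<and> (\<exists>h. h \<in> mon (padic_group p) G)))))
     \<and> (below_measurable_cardinals I \<longrightarrow>
          (\<not> factors_through_ultraproducts countably_complete I R (ann_quotient B) (ann_proj B \<circ> f)
            \<longleftrightarrow> \<not> factors_through_finite_product I R (ann_quotient B) (ann_proj B \<circ> f)))"
proof -
  let ?S = "ann_quotient B" and ?h = "ann_proj B \<circ> f"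
  interpret B: na_ring B by fact
  have h: "?h \<in> na_hom (prod_ring I R) ?S"
    by (rule na_hom_comp[OF assms(3) B.ann_proj_hom])
  have S: "comm_group (add_monoid ?S)"
    unfolding ann_quotient_def by (rule B.comm_group_Quot[OF B.subgroup_annihilator])
  have rings: "\<forall>i\<in>I. na_ring (R i)" using assms(1) by blast
  note iff = nonzero_cotorsion_subgroup_iff[OF S]
  have nonzero: "has_nonzero_cotorsion_subgroup (add_monoid ?S)"
    if nf: "\<not> factors_through_ultraproducts countably_complete I R ?S ?h"
  proof -
    obtain L where "limit_hom (add_monoid ?S) L" "L (\<lambda>_. 1) \<noteq> \<one>\<^bsub>add_monoid ?S\<^esub>"
      using limit_hom_if_not_factors[OF rings S h assms(5) nf] by auto
    then show ?thesis unfolding iff by (rule limit_hom.torsion_rat_or_padic)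
  qed
  show ?thesis
    unfolding Let_def
    by (intro conjI impI iff, erule nonzero, simp only: countably_complete_iff_finite_product[OF rings h])
qed

end
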